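(* Let $M=B\times_f\overline{F}$ be an $m$-dimensional nontrivial warped product proper pointwise semi-slant submanifold of a $(2n+1)$-dimensional Kenmotsu manifold $(N,\phi,\xi,\eta,g)$ with the semi-slant function $\theta$ such that $\mathcal{D}_1=TB$, $\mathcal{D}_2=T\overline{F}$, and $\xi$ is normal to $M$ with $\xi\in\Gamma(\mu)$. Write $\dim\mathcal{D}_1=2m_1$ and $\dim\mathcal{D}_2=2m_2$ (so $m=2m_1+2m_2$). Assume that $n=m_1+2m_2$. Then $$\|h\|^2\ \ge\ 4m_2(\csc^2\theta+\cot^2\theta)\,\|\nabla(\ln f)\|^2+2m_1,$$ with equality holding if and only if $g(h(Z,W),V)=0$ for all $Z,W\in\Gamma(T\overline{F})$ and $V\in\Gamma(TM^{\perp})$.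
   Context: An almost contact metric manifold $(N,\phi,\xi,\eta,g)$ is a smooth manifold $N$ of dimension $2n+1$ with a tensor field $\phi$ of type $(1,1)$, a vector field $\xi$, a $1$-form $\eta$ and a Riemannian metric $g$ such that $\phi^2=-I+\eta\otimes\xi$, $\eta(\xi)=1$ and $g(\phi X,\phi Y)=g(X,Y)-\eta(X)\eta(Y)$ for all vector fields $X,Y$ (hence $\phi\xi=0$, $\eta\circ\phi=0$, $\eta(X)=g(X,\xi)$). With $\overline{\nabla}$ the Levi-Civita connection of $(N,g)$, it is Kenmotsu iff $(\overline{\nabla}_X\phi)Y=g(\phi X,Y)\xi-\eta(Y)\phi X$ for all vector fields $X,Y$ on $N$. A submanifold $M$ of $N$ is a pointwise semi-slant submanifold if there is a distribution $\mathcal{D}_1\subset TM$ such that $TM=\mathcal{D}_1\oplus\mathcal{D}_2$, $\phi(\mathcal{D}_1)\subset\mathcal{D}_1$, and at each given point $p\in M$ the angle $\theta=\theta(X)$ between $\phi X$ and $(\mathcal{D}_2)_p$ is constant for nonzero $X\in(\mathcal{D}_2)_p$, where $\mathcal{D}_2$ is the orthogonal complement of $\mathcal{D}_1$ in $TM$. The function $\theta$ on $M$ is the semi-slant function; $M$ is proper if $\theta$ takes values in $(0,\frac{\pi}{2})$. When $\xi$ is normal to $M$ and $M$ is proper, $\dim\mathcal{D}_1$ and $\dim\mathcal{D}_2$ are even. For $X$ tangent to $M$ write $\phi X=TX+FX$, with $TX$ tangent and $FX$ normal to $M$. $\mu$ denotes the orthogonal complement of $F\mathcal{D}_2$ in the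 normal bundle $TM^\perp$. For Riemannian manifolds $(B,g_B)$, $(\overline{F},g_{\overline{F}})$ and a positive smooth function $f$ on $B$, the warped product $B\times_f\overline{F}$ is $B\times\overline{F}$ with metric $g_B+f^2g_{\overline{F}}$; it is trivial if the warping function $f$ is constant. Here $M$ with the induced metric is such a warped product, and $TB$, $T\overline{F}$ are identified with the corresponding subbundles of $TM$. $h$ is the second fundamental form of $M$ in $N$, $\|h\|^2=\sum_{i,j=1}^m g(h(e_i,e_j),h(e_i,e_j))$ for a local orthonormal frame $e_1,\dots,e_m$ of $TM$; $\nabla(\ln f)$ is the gradient on $M$ of $\ln f$ (with $f$ regarded as a function on $M$). *)

theory Defs
  imports "HOL-Analysis.Analysis"
begin

subsection \<open>Smooth maps between Euclidean spaces\<close>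

primrec Ck_on :: "nat \<Rightarrow> ('a::euclidean_space \<Rightarrow> 'b::real_normed_vector) \<Rightarrow> 'a set \<Rightarrow> bool" where
  "Ck_on 0 f S \<longleftrightarrow> continuous_on S f"
| "Ck_on (Suc k) f S \<longleftrightarrow> (\<forall>x\<in>S. f differentiable (at x)) \<and>
     (\<forall>v. Ck_on k (\<lambda>x. frechet_derivative f (at x) v) S)"

text \<open>Only used for open \<open>S\<close>.\<close>
definition smooth_on :: "'a::euclidean_space set \<Rightarrow> ('a \<Rightarrow> 'b::real_normed_vector) \<Rightarrow> bool" where
  "smooth_on S f \<longleftrightarrow> (\<forall>k. Ck_on k f S)"

subsection \<open>Smooth manifolds\<close>

text \<open>A chart is its open domain together with the coordinate map.  The underlying topological
  space of a manifold is a whole type.  Each point \<open>p\<close> carries a preferred chart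
  \<open>chart_at M p\<close>, which only serves to represent tangent vectors: the tangent space at \<open>p\<close> is the
  model space \<open>'e\<close>, a vector \<open>v :: 'e\<close> standing for the tangent vector at \<open>p\<close> whose
  coordinates in the chart \<open>chart_at M p\<close> are \<open>v\<close>.\<close>

type_synonym ('a, 'e) chart = "'a set \<times> ('a \<Rightarrow> 'e)"

record ('a, 'e) mfd =
  atlas :: "('a, 'e) chart set"
  chart_at :: "'a \<Rightarrow> ('a, 'e) chart"

definition cinv :: "('a, 'e) chart \<Rightarrow> 'e \<Rightarrow> 'a" where
  "cinv c = inv_into (fst c) (snd c)"

definition is_chart :: "('a::topological_space, 'e::euclidean_space) chart \<Rightarrow> bool" where
  "is_chart c \<longleftrightarrow> open (fst c) \<and> open (snd c ` fst c) \<and>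
     homeomorphism (fst c) (snd c ` fst c) (snd c) (cinv c)"

definition smooth_manifold ::
    "('a::{t2_space,second_countable_topology}, 'e::euclidean_space) mfd \<Rightarrow> bool" where
  "smooth_manifold M \<longleftrightarrow>
     (\<forall>c\<in>atlas M. is_chart c) \<and>
     (\<forall>p. chart_at M p \<in> atlas M \<and> p \<in> fst (chart_at M p)) \<and>
     (\<forall>c\<in>atlas M. \<forall>d\<in>atlas M. smooth_on (snd c ` (fst c \<inter> fst d)) (snd d \<circ> cinv c))"

text \<open>The preferred chart of a product is the product of the preferred charts, so that
  the tangent space at \<open>(b, x)\<close> is the product of the tangent spaces at \<open>b\<close> and \<open>x\<close>.\<close>

definition prod_chart ::
    "('a, 'd) chart \<Rightarrow> ('b, 'e) chart \<Rightarrow> ('a \<times> 'b, 'd \<times> 'e) chart" where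
  "prod_chart c d = (fst c \<times> fst d, map_prod (snd c) (snd d))"

definition prod_mfd :: "('a, 'd) mfd \<Rightarrow> ('b, 'e) mfd \<Rightarrow> ('a \<times> 'b, 'd \<times> 'e) mfd" where
  "prod_mfd B F = \<lparr> atlas = {prod_chart c d | c d. c \<in> atlas B \<and> d \<in> atlas F},
                    chart_at = (\<lambda>(b, x). prod_chart (chart_at B b) (chart_at F x)) \<rparr>"

subsection \<open>Functions, maps and tangent vectors\<close>

definition smooth_fun_on :: "('a::topological_space, 'e::euclidean_space) mfd \<Rightarrow> 'a set \<Rightarrow>
    ('a \<Rightarrow> 'v::real_normed_vector) \<Rightarrow> bool" where
  "smooth_fun_on M U f \<longleftrightarrow> open U \<and> (\<forall>c\<in>atlas M. smooth_on (snd c ` (fst c \<inter> U)) (f \<circ> cinv c))"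

text \<open>The derivative \<open>v f\<close> of \<open>f\<close> along the tangent vector \<open>v\<close> at \<open>p\<close>.\<close>
definition dir_deriv :: "('a, 'e::euclidean_space) mfd \<Rightarrow> 'a \<Rightarrow> 'e \<Rightarrow>
    ('a \<Rightarrow> 'v::real_normed_vector) \<Rightarrow> 'v" where
  "dir_deriv M p v f =
     frechet_derivative (f \<circ> cinv (chart_at M p)) (at (snd (chart_at M p) p)) v"

definition smooth_map :: "('a::topological_space, 'd::euclidean_space) mfd \<Rightarrow>
    ('b::topological_space, 'e::euclidean_space) mfd \<Rightarrow> ('a \<Rightarrow> 'b) \<Rightarrow> bool" where
  "smooth_map M N \<iota> \<longleftrightarrow> continuous_on UNIV \<iota> \<and>
     (\<forall>c\<in>atlas M. \<forall>d\<in>atlas N.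
        smooth_on (snd c ` (fst c \<inter> \<iota> -` fst d)) (snd d \<circ> \<iota> \<circ> cinv c))"

definition dmap :: "('a, 'd::euclidean_space) mfd \<Rightarrow> ('b, 'e::euclidean_space) mfd \<Rightarrow>
    ('a \<Rightarrow> 'b) \<Rightarrow> 'a \<Rightarrow> 'd \<Rightarrow> 'e" where
  "dmap M N \<iota> p v = dir_deriv M p v (snd (chart_at N (\<iota> p)) \<circ> \<iota>)"

definition immersion :: "('a::topological_space, 'd::euclidean_space) mfd \<Rightarrow>
    ('b::topological_space, 'e::euclidean_space) mfd \<Rightarrow> ('a \<Rightarrow> 'b) \<Rightarrow> bool" where
  "immersion M N \<iota> \<longleftrightarrow> smooth_map M N \<iota> \<and> (\<forall>p. inj (dmap M N \<iota> p))"

text \<open>Coordinates in the chart \<open>c\<close> of the tangent vector \<open>v\<close> at \<open>q\<close>; conversely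
  \<open>coord_field M c u\<close> is the vector field on the domain of \<open>c\<close> with constant
  \<open>c\<close>-coordinates \<open>u\<close>.\<close>

definition to_chart :: "('a, 'e::euclidean_space) mfd \<Rightarrow> ('a, 'e) chart \<Rightarrow> 'a \<Rightarrow> 'e \<Rightarrow> 'e" where
  "to_chart M c q v = dir_deriv M q v (snd c)"

definition coord_field :: "('a, 'e::euclidean_space) mfd \<Rightarrow> ('a, 'e) chart \<Rightarrow> 'e \<Rightarrow> 'a \<Rightarrow> 'e" where
  "coord_field M c u q = frechet_derivative (snd (chart_at M q) \<circ> cinv c) (at (snd c q)) u"

subsection \<open>Tensor fields and distributions\<close>

text \<open>\<open>smooth_vf_on M U X\<close>: \<open>X\<close> restricts to a smooth vector field on the open set \<open>U\<close>.\<close>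
definition smooth_vf_on :: "('a::topological_space, 'e::euclidean_space) mfd \<Rightarrow> 'a set \<Rightarrow>
    ('a \<Rightarrow> 'e) \<Rightarrow> bool" where
  "smooth_vf_on M U X \<longleftrightarrow> open U \<and>
     (\<forall>c\<in>atlas M. smooth_fun_on M (fst c \<inter> U) (\<lambda>q. to_chart M c q (X q)))"

definition one_form :: "('a::topological_space, 'e::euclidean_space) mfd \<Rightarrow>
    ('a \<Rightarrow> 'e \<Rightarrow> real) \<Rightarrow> bool" where
  "one_form M \<eta> \<longleftrightarrow> (\<forall>p. linear (\<eta> p)) \<and>
     (\<forall>U X. smooth_vf_on M U X \<longrightarrow> smooth_fun_on M U (\<lambda>p. \<eta> p (X p)))"

definition tensor_1_1 :: "('a::topological_space, 'e::euclidean_space) mfd \<Rightarrow>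
    ('a \<Rightarrow> 'e \<Rightarrow> 'e) \<Rightarrow> bool" where
  "tensor_1_1 M \<phi> \<longleftrightarrow> (\<forall>p. linear (\<phi> p)) \<and>
     (\<forall>U X. smooth_vf_on M U X \<longrightarrow> smooth_vf_on M U (\<lambda>p. \<phi> p (X p)))"

definition riemannian_metric :: "('a::topological_space, 'e::euclidean_space) mfd \<Rightarrow>
    ('a \<Rightarrow> 'e \<Rightarrow> 'e \<Rightarrow> real) \<Rightarrow> bool" where
  "riemannian_metric M g \<longleftrightarrow>
     (\<forall>p. bilinear (g p) \<and> (\<forall>u v. g p u v = g p v u) \<and> (\<forall>u. u \<noteq> 0 \<longrightarrow> g p u u > 0)) \<and>
     (\<forall>U X Y. smooth_vf_on M U X \<and> smooth_vf_on M U Y \<longrightarrow>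
        smooth_fun_on M U (\<lambda>p. g p (X p) (Y p)))"

definition riemannian_manifold :: "('a::{t2_space,second_countable_topology},
    'e::euclidean_space) mfd \<Rightarrow> ('a \<Rightarrow> 'e \<Rightarrow> 'e \<Rightarrow> real) \<Rightarrow> bool" where
  "riemannian_manifold M g \<longleftrightarrow> smooth_manifold M \<and> riemannian_metric M g"

definition distribution :: "('a::topological_space, 'e::euclidean_space) mfd \<Rightarrow>
    ('a \<Rightarrow> 'e set) \<Rightarrow> bool" where
  "distribution M D \<longleftrightarrow> (\<exists>k. \<forall>p. \<exists>U E. p \<in> U \<and> (\<forall>i<k. smooth_vf_on M U (E i)) \<and> open U \<and>
     (\<forall>q\<in>U. D q = span ((\<lambda>i. E i q) ` {..<k::nat}) \<and> dim (D q) = k))"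

definition gradient :: "('a, 'e::euclidean_space) mfd \<Rightarrow> ('a \<Rightarrow> 'e \<Rightarrow> 'e \<Rightarrow> real) \<Rightarrow>
    ('a \<Rightarrow> real) \<Rightarrow> 'a \<Rightarrow> 'e" where
  "gradient M g u p = (THE w. \<forall>v. g p w v = dir_deriv M p v u)"

subsection \<open>Linear algebra for an inner product \<open>G\<close>\<close>

definition orth_proj :: "('e::real_vector \<Rightarrow> 'e \<Rightarrow> real) \<Rightarrow> 'e set \<Rightarrow> 'e \<Rightarrow> 'e" where
  "orth_proj G W v = (THE w. w \<in> W \<and> (\<forall>z\<in>W. G (v - w) z = 0))"

definition orth_compl :: "('e \<Rightarrow> 'e \<Rightarrow> real) \<Rightarrow> 'e set \<Rightarrow> 'e set" where
  "orth_compl G W = {v. \<forall>w\<in>W. G v w = 0}"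

text \<open>The angle between a nonzero vector and a subspace, i.e. between the vector and its
  projection (and \<open>pi / 2\<close> if the projection vanishes).\<close>
definition angle_subspace :: "('e::real_vector \<Rightarrow> 'e \<Rightarrow> real) \<Rightarrow> 'e \<Rightarrow> 'e set \<Rightarrow> real" where
  "angle_subspace G v W =
     (let w = orth_proj G W v in arccos (sqrt (G w w) / sqrt (G v v)))"

definition orthonormal_basis :: "('e::real_vector \<Rightarrow> 'e \<Rightarrow> real) \<Rightarrow> 'e set \<Rightarrow> bool" where
  "orthonormal_basis G E \<longleftrightarrow> finite E \<and> span E = UNIV \<and>
     (\<forall>e\<in>E. \<forall>e'\<in>E. G e e' = (if e = e' then 1 else 0))"

subsection \<open>Connections\<close>

text \<open>A connection is taken in its local form: \<open>cd p v Y\<close> is the covariant derivative at \<open>p\<close>, in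
  direction of the tangent vector \<open>v\<close>, of a vector field \<open>Y\<close> that is smooth on some neighbourhood
  of \<open>p\<close>.  (For other \<open>Y\<close> the value is irrelevant.)  That it depends on the germ of
  \<open>Y\<close> only follows from the Leibniz rule.\<close>

type_synonym ('a, 'e) connection = "'a \<Rightarrow> 'e \<Rightarrow> ('a \<Rightarrow> 'e) \<Rightarrow> 'e"

definition affine_connection :: "('a::topological_space, 'e::euclidean_space) mfd \<Rightarrow>
    ('a, 'e) connection \<Rightarrow> bool" where
  "affine_connection M cd \<longleftrightarrow>
     (\<forall>U X Y. smooth_vf_on M U X \<and> smooth_vf_on M U Y \<longrightarrow>
        smooth_vf_on M U (\<lambda>p. cd p (X p) Y)) \<and>
     (\<forall>U Y. smooth_vf_on M U Y \<longrightarrow> (\<forall>p\<in>U. linear (\<lambda>v. cd p v Y))) \<and>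
     (\<forall>U Y Z. smooth_vf_on M U Y \<and> smooth_vf_on M U Z \<longrightarrow>
        (\<forall>p\<in>U. \<forall>v. cd p v (\<lambda>q. Y q + Z q) = cd p v Y + cd p v Z)) \<and>
     (\<forall>U f Y. smooth_fun_on M U (f :: 'a \<Rightarrow> real) \<and> smooth_vf_on M U Y \<longrightarrow>
        (\<forall>p\<in>U. \<forall>v. cd p v (\<lambda>q. f q *\<^sub>R Y q) = dir_deriv M p v f *\<^sub>R Y p + f p *\<^sub>R cd p v Y))"

text \<open>Torsion-freeness \<open>\<nabla>\<^sub>XY - \<nabla>\<^sub>YX = [X, Y]\<close>, with both sides applied to functions.\<close>
definition torsion_free :: "('a::topological_space, 'e::euclidean_space) mfd \<Rightarrow>
    ('a, 'e) connection \<Rightarrow> bool" where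
  "torsion_free M cd \<longleftrightarrow>
     (\<forall>U X Y f. smooth_vf_on M U X \<and> smooth_vf_on M U Y \<and> smooth_fun_on M U (f :: 'a \<Rightarrow> real) \<longrightarrow>
        (\<forall>p\<in>U. dir_deriv M p (cd p (X p) Y - cd p (Y p) X) f =
           dir_deriv M p (X p) (\<lambda>q. dir_deriv M q (Y q) f) -
           dir_deriv M p (Y p) (\<lambda>q. dir_deriv M q (X q) f)))"

definition metric_connection :: "('a::topological_space, 'e::euclidean_space) mfd \<Rightarrow>
    ('a \<Rightarrow> 'e \<Rightarrow> 'e \<Rightarrow> real) \<Rightarrow> ('a, 'e) connection \<Rightarrow> bool" where
  "metric_connection M g cd \<longleftrightarrow>
     (\<forall>U Y Z. smooth_vf_on M U Y \<and> smooth_vf_on M U Z \<longrightarrow>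
        (\<forall>p\<in>U. \<forall>v. dir_deriv M p v (\<lambda>q. g q (Y q) (Z q)) =
           g p (cd p v Y) (Z p) + g p (Y p) (cd p v Z)))"

definition levi_civita :: "('a::topological_space, 'e::euclidean_space) mfd \<Rightarrow>
    ('a \<Rightarrow> 'e \<Rightarrow> 'e \<Rightarrow> real) \<Rightarrow> ('a, 'e) connection \<Rightarrow> bool" where
  "levi_civita M g cd \<longleftrightarrow>
     affine_connection M cd \<and> torsion_free M cd \<and> metric_connection M g cd"

subsection \<open>Kenmotsu manifolds\<close>

definition almost_contact_metric :: "('a::{t2_space,second_countable_topology},
    'e::euclidean_space) mfd \<Rightarrow> ('a \<Rightarrow> 'e \<Rightarrow> 'e) \<Rightarrow> ('a \<Rightarrow> 'e) \<Rightarrow> ('a \<Rightarrow> 'e \<Rightarrow> real) \<Rightarrow>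
    ('a \<Rightarrow> 'e \<Rightarrow> 'e \<Rightarrow> real) \<Rightarrow> bool" where
  "almost_contact_metric N \<phi> \<xi> \<eta> g \<longleftrightarrow>
     riemannian_manifold N g \<and> odd DIM('e) \<and>
     tensor_1_1 N \<phi> \<and> smooth_vf_on N UNIV \<xi> \<and> one_form N \<eta> \<and>
     (\<forall>p v. \<phi> p (\<phi> p v) = - v + \<eta> p v *\<^sub>R \<xi> p) \<and>
     (\<forall>p. \<eta> p (\<xi> p) = 1) \<and>
     (\<forall>p u v. g p (\<phi> p u) (\<phi> p v) = g p u v - \<eta> p u * \<eta> p v)"

text \<open>\<open>cd\<close> is meant to be the Levi-Civita connection of \<open>g\<close>;
  \<open>(\<nabla>\<^sub>X\<phi>)Y = \<nabla>\<^sub>X(\<phi>Y) - \<phi>(\<nabla>\<^sub>XY)\<close>.\<close>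
definition kenmotsu :: "('a::{t2_space,second_countable_topology},
    'e::euclidean_space) mfd \<Rightarrow> ('a \<Rightarrow> 'e \<Rightarrow> 'e) \<Rightarrow> ('a \<Rightarrow> 'e) \<Rightarrow> ('a \<Rightarrow> 'e \<Rightarrow> real) \<Rightarrow>
    ('a \<Rightarrow> 'e \<Rightarrow> 'e \<Rightarrow> real) \<Rightarrow> ('a, 'e) connection \<Rightarrow> bool" where
  "kenmotsu N \<phi> \<xi> \<eta> g cd \<longleftrightarrow> almost_contact_metric N \<phi> \<xi> \<eta> g \<and>
     (\<forall>X Y. smooth_vf_on N UNIV X \<and> smooth_vf_on N UNIV Y \<longrightarrow>
        (\<forall>p. cd p (X p) (\<lambda>q. \<phi> q (Y q)) - \<phi> p (cd p (X p) Y) =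
             g p (\<phi> p (X p)) (Y p) *\<^sub>R \<xi> p - \<eta> p (Y p) *\<^sub>R \<phi> p (X p)))"

subsection \<open>Warped products\<close>

definition warped_metric :: "('a \<Rightarrow> 'd \<Rightarrow> 'd \<Rightarrow> real) \<Rightarrow> ('b \<Rightarrow> 'e \<Rightarrow> 'e \<Rightarrow> real) \<Rightarrow> ('a \<Rightarrow> real) \<Rightarrow>
    'a \<times> 'b \<Rightarrow> 'd \<times> 'e \<Rightarrow> 'd \<times> 'e \<Rightarrow> real" where
  "warped_metric gB gF f p u v =
     gB (fst p) (fst u) (fst v) + (f (fst p))\<^sup>2 * gF (snd p) (snd u) (snd v)"

definition tan_base :: "'a \<times> 'b \<Rightarrow> ('d \<times> 'e::zero) set" where
  "tan_base p = UNIV \<times> {0}"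

definition tan_fibre :: "'a \<times> 'b \<Rightarrow> ('d::zero \<times> 'e) set" where
  "tan_fibre p = {0} \<times> UNIV"

subsection \<open>Submanifolds\<close>

text \<open>A submanifold is given by an immersion \<open>\<iota>\<close> of \<open>M\<close> into \<open>N\<close>; the tangent space of the
  submanifold at \<open>p\<close> is the range of \<open>dmap M N \<iota> p\<close>.\<close>

definition induced_metric :: "('a, 'd::euclidean_space) mfd \<Rightarrow> ('b, 'e::euclidean_space) mfd \<Rightarrow>
    ('a \<Rightarrow> 'b) \<Rightarrow> ('b \<Rightarrow> 'e \<Rightarrow> 'e \<Rightarrow> real) \<Rightarrow> 'a \<Rightarrow> 'd \<Rightarrow> 'd \<Rightarrow> real" where
  "induced_metric M N \<iota> g p u v = g (\<iota> p) (dmap M N \<iota> p u) (dmap M N \<iota> p v)"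

definition normal_bundle :: "('a, 'd::euclidean_space) mfd \<Rightarrow> ('b, 'e::euclidean_space) mfd \<Rightarrow>
    ('a \<Rightarrow> 'b) \<Rightarrow> ('b \<Rightarrow> 'e \<Rightarrow> 'e \<Rightarrow> real) \<Rightarrow> 'a \<Rightarrow> 'e set" where
  "normal_bundle M N \<iota> g p = orth_compl (g (\<iota> p)) (range (dmap M N \<iota> p))"

definition normal_part :: "('a, 'd::euclidean_space) mfd \<Rightarrow> ('b, 'e::euclidean_space) mfd \<Rightarrow>
    ('a \<Rightarrow> 'b) \<Rightarrow> ('b \<Rightarrow> 'e \<Rightarrow> 'e \<Rightarrow> real) \<Rightarrow> 'a \<Rightarrow> 'e \<Rightarrow> 'e" where
  "normal_part M N \<iota> g p v = v - orth_proj (g (\<iota> p)) (range (dmap M N \<iota> p)) v"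

text \<open>Smooth sections of the pullback \<open>\<iota>\<^sup>*TN\<close> over \<open>M\<close>.\<close>
definition smooth_along :: "('a::topological_space, 'd::euclidean_space) mfd \<Rightarrow>
    ('b::topological_space, 'e::euclidean_space) mfd \<Rightarrow> ('a \<Rightarrow> 'b) \<Rightarrow> ('a \<Rightarrow> 'e) \<Rightarrow> bool" where
  "smooth_along M N \<iota> V \<longleftrightarrow>
     (\<forall>d\<in>atlas N. smooth_fun_on M (\<iota> -` fst d) (\<lambda>q. to_chart N d (\<iota> q) (V q)))"

text \<open>Derivative at \<open>p\<close>, in direction \<open>x\<close>, of the vector field \<open>V\<close> along \<open>\<iota>\<close> for the connection
  induced by \<open>cd\<close> on \<open>\<iota>\<^sup>*TN\<close>: with \<open>V = \<Sum>\<^sub>i V\<^sup>i (\<partial>\<^sub>i \<circ> \<iota>)\<close> in a chart, it is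
  \<open>\<Sum>\<^sub>i (x V\<^sup>i) \<partial>\<^sub>i + V\<^sup>i \<nabla>\<^sub>x \<partial>\<^sub>i\<close>.  For \<open>V = Y \<circ> \<iota>\<close> it is \<open>\<nabla>\<close> of \<open>Y\<close> in direction \<open>d\<iota> x\<close>.  The
  chart is the preferred one at \<open>\<iota> p\<close>, where \<open>V p\<close> is its own coordinate vector.\<close>
definition cd_along :: "('a, 'd::euclidean_space) mfd \<Rightarrow> ('b, 'e::euclidean_space) mfd \<Rightarrow>
    ('a \<Rightarrow> 'b) \<Rightarrow> ('b, 'e) connection \<Rightarrow> 'a \<Rightarrow> 'd \<Rightarrow> ('a \<Rightarrow> 'e) \<Rightarrow> 'e" where
  "cd_along M N \<iota> cd p x V =
     (let c = chart_at N (\<iota> p) in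
        dir_deriv M p x (\<lambda>q. to_chart N c (\<iota> q) (V q)) +
        (\<Sum>i\<in>Basis. (V p \<bullet> i) *\<^sub>R cd (\<iota> p) (dmap M N \<iota> p x) (coord_field N c i)))"

definition second_ff :: "('a, 'd::euclidean_space) mfd \<Rightarrow> ('b, 'e::euclidean_space) mfd \<Rightarrow>
    ('a \<Rightarrow> 'b) \<Rightarrow> ('b \<Rightarrow> 'e \<Rightarrow> 'e \<Rightarrow> real) \<Rightarrow> ('b, 'e) connection \<Rightarrow>
    ('a \<Rightarrow> 'd) \<Rightarrow> ('a \<Rightarrow> 'd) \<Rightarrow> 'a \<Rightarrow> 'e" where
  "second_ff M N \<iota> g cd X Y p =
     normal_part M N \<iota> g p (cd_along M N \<iota> cd p (X p) (\<lambda>q. dmap M N \<iota> q (Y q)))"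

text \<open>The value of the second fundamental form, which is tensorial, on two tangent vectors at
  \<open>p\<close>: they are extended with constant coordinates in the preferred chart at \<open>p\<close>.\<close>
definition second_ff_at :: "('a, 'd::euclidean_space) mfd \<Rightarrow> ('b, 'e::euclidean_space) mfd \<Rightarrow>
    ('a \<Rightarrow> 'b) \<Rightarrow> ('b \<Rightarrow> 'e \<Rightarrow> 'e \<Rightarrow> real) \<Rightarrow> ('b, 'e) connection \<Rightarrow> 'a \<Rightarrow> 'd \<Rightarrow> 'd \<Rightarrow> 'e" where
  "second_ff_at M N \<iota> g cd p x y =
     second_ff M N \<iota> g cd (coord_field M (chart_at M p) x) (coord_field M (chart_at M p) y) p"

text \<open>The squared norm of the second fundamental form; the sum does not depend on the
  orthonormal basis of the tangent space.\<close>
definition second_ff_norm2 :: "('a, 'd::euclidean_space) mfd \<Rightarrow> ('b, 'e::euclidean_space) mfd \<Rightarrow>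
    ('a \<Rightarrow> 'b) \<Rightarrow> ('b \<Rightarrow> 'e \<Rightarrow> 'e \<Rightarrow> real) \<Rightarrow> ('b, 'e) connection \<Rightarrow> 'a \<Rightarrow> real" where
  "second_ff_norm2 M N \<iota> g cd p =
     (let E = (SOME E. orthonormal_basis (induced_metric M N \<iota> g p) E)
      in \<Sum>e\<in>E. \<Sum>e'\<in>E. g (\<iota> p) (second_ff_at M N \<iota> g cd p e e') (second_ff_at M N \<iota> g cd p e e'))"

subsection \<open>Pointwise semi-slant submanifolds\<close>

text \<open>The decomposition \<open>TM = D1 \<oplus> D2\<close> is part of \<open>D2\<close> being the orthogonal complement.\<close>
definition pointwise_semi_slant :: "('a::topological_space, 'd::euclidean_space) mfd \<Rightarrow>
    ('b::topological_space, 'e::euclidean_space) mfd \<Rightarrow> ('a \<Rightarrow> 'b) \<Rightarrow> ('b \<Rightarrow> 'e \<Rightarrow> 'e) \<Rightarrow>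
    ('b \<Rightarrow> 'e \<Rightarrow> 'e \<Rightarrow> real) \<Rightarrow> ('a \<Rightarrow> 'd set) \<Rightarrow> ('a \<Rightarrow> 'd set) \<Rightarrow> ('a \<Rightarrow> real) \<Rightarrow> bool" where
  "pointwise_semi_slant M N \<iota> \<phi> g D1 D2 \<theta> \<longleftrightarrow>
     immersion M N \<iota> \<and> distribution M D1 \<and>
     (\<forall>p. D2 p = orth_compl (induced_metric M N \<iota> g p) (D1 p)) \<and>
     (\<forall>p. \<phi> (\<iota> p) ` dmap M N \<iota> p ` D1 p \<subseteq> dmap M N \<iota> p ` D1 p) \<and>
     (\<forall>p. \<forall>x\<in>D2 p. x \<noteq> 0 \<longrightarrow>
        angle_subspace (g (\<iota> p)) (\<phi> (\<iota> p) (dmap M N \<iota> p x)) (dmap M N \<iota> p ` D2 p) = \<theta> p)"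

definition proper_semi_slant :: "('a \<Rightarrow> real) \<Rightarrow> bool" where
  "proper_semi_slant \<theta> \<longleftrightarrow> (\<forall>p. 0 < \<theta> p \<and> \<theta> p < pi / 2)"

text \<open>The complement of \<open>F D2\<close> in the normal bundle, where \<open>FX\<close> is the normal part of
  \<open>\<phi>X\<close>.\<close>
definition mu_bundle :: "('a, 'd::euclidean_space) mfd \<Rightarrow> ('b, 'e::euclidean_space) mfd \<Rightarrow>
    ('a \<Rightarrow> 'b) \<Rightarrow> ('b \<Rightarrow> 'e \<Rightarrow> 'e) \<Rightarrow> ('b \<Rightarrow> 'e \<Rightarrow> 'e \<Rightarrow> real) \<Rightarrow> ('a \<Rightarrow> 'd set) \<Rightarrow> 'a \<Rightarrow> 'e set" where
  "mu_bundle M N \<iota> \<phi> g D2 p = normal_bundle M N \<iota> g p \<inter>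
     orth_compl (g (\<iota> p)) ((\<lambda>x. normal_part M N \<iota> g p (\<phi> (\<iota> p) (dmap M N \<iota> p x))) ` D2 p)"

end

theory Submission
  imports Defs
begin

text \<open>At a point \<open>p\<close> let \<open>H(x, y)\<close> be the covariant derivative along \<open>\<iota>\<close> of the coordinate field
  \<open>y\<close> in direction \<open>x\<close>, so that \<open>h\<close> is the normal part of \<open>H\<close>.  Koszul's formula for the warped
  product metric gives, for \<open>x\<close> tangent to the base and \<open>z\<close>, \<open>w\<close> tangent to the fibre,
  \<open>g(H(z, x), w) = x(ln f) g(z, w)\<close> and \<open>g(H(z, w), x) = - x(ln f) g(z, w)\<close>.  The Kenmotsu identity
  turns this into \<open>g(h(x, z), F w) = - (\<phi> x)(ln f) g(z, w) - x(ln f) g(z, \<phi> w)\<close>, and it also gives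
  \<open>\<nabla>\<^sub>v \<xi> = v - \<eta>(v) \<xi>\<close>, hence \<open>g(h(x, y), \<xi>) = - g(x, y)\<close>.  Since \<open>|F w| = sin \<theta> |w|\<close>, the vectors
  \<open>\<xi>\<close> and \<open>csc \<theta> F w\<close>, with \<open>w\<close> in an orthonormal basis of the fibre directions, are orthonormal, and
  Bessel's inequality yields
  \<open>\<parallel>h\<parallel>\<^sup>2 \<ge> 4 m\<^sub>2 (csc\<^sup>2 \<theta> + cot\<^sup>2 \<theta>) \<parallel>\<nabla>(ln f)\<parallel>\<^sup>2 + 2 m\<^sub>1 + 2 m\<^sub>2\<close>.
  So the inequality is strict at every point; on the other hand \<open>g(h(Z, Z), \<xi>) = - g(Z, Z)\<close> is nonzero
  for some field \<open>Z\<close> tangent to the fibres, and both sides of the equality criterion are false.\<close>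

subsection \<open>Calculus of smooth maps\<close>

text \<open>The Kenmotsu identity is assumed only for vector fields on all of \<open>N\<close>,
  while the fields to which it is applied are sections along \<open>\<iota>\<close>, which need not
  come from fields on \<open>N\<close>. Cutoff functions carry it to single tangent vectors and to
  coordinate fields; a section along \<open>\<iota>\<close> is then expanded in the coordinate
  fields of one chart, and the product rules for \<open>g\<close> and \<open>\<phi>\<close> are
  derived from this expansion. Extending tangent vectors of \<open>M\<close> with constant
  coordinates makes \<open>H\<close> a Hessian in charts plus a Christoffel term, so its symmetry
  rests on that of second derivatives and no Lie brackets on \<open>M\<close> occur. Product charts
  keep these extensions tangent to base or fibre. In the estimate the mixed pairs are counted in
  both orders, hence 2 dim D2 = 4 m2. The csc^2 term uses that \<phi> is an isometry of D1, the
  cot^2 term that the tangential part of \<open>\<phi> w\<close> has length cos \<theta> |w|; they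
  do not interact because g(w, \<phi> w) = 0.\<close>

lemma frechet_derivative_cong_open:
  assumes "open S" "x \<in> S" "\<And>y. y \<in> S \<Longrightarrow> f y = h y"
  shows "frechet_derivative f (at x) = frechet_derivative h (at x)"
proof -
  have "(f has_derivative D) (at x) \<longleftrightarrow> (h has_derivative D) (at x)" for D
    using assms has_derivative_transform_within_open by metis
  then show ?thesis by (simp add: frechet_derivative_def)
qed

lemma differentiable_cong_open:
  assumes "open S" "x \<in> S" "\<And>y. y \<in> S \<Longrightarrow> f y = h y" "f differentiable (at x)"
  shows "h differentiable (at x)"
  using assms has_derivative_transform_within_open unfolding differentiable_def by metis

lemma Ck_on_cong:
  assumes "open S" "\<And>x. x \<in> S \<Longrightarrow> f x = h x" "Ck_on k f S"
  shows "Ck_on k h S"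
  using assms(2,3)
proof (induction k arbitrary: f h)
  case 0
  then show ?case using continuous_on_cong by fastforce
next
  case (Suc k)
  have "h differentiable (at x)" if "x \<in> S" for x
    using differentiable_cong_open[OF assms(1) that Suc.prems(1)] Suc.prems(2) that by simp
  moreover have "Ck_on k (\<lambda>x. frechet_derivative h (at x) v) S" for v
  proof (rule Suc.IH)
    show "Ck_on k (\<lambda>x. frechet_derivative f (at x) v) S" using Suc.prems(2) by simp
  next
    fix x assume "x \<in> S"
    then show "frechet_derivative f (at x) v = frechet_derivative h (at x) v"
      using frechet_derivative_cong_open[OF assms(1) _ Suc.prems(1)] by simp
  qed
  ultimately show ?case by simp
qed

lemma Ck_on_subset: "Ck_on k f S \<Longrightarrow> T \<subseteq> S \<Longrightarrow> Ck_on k f T"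
  by (induction k arbitrary: f) (auto intro: continuous_on_subset)

lemma Ck_on_SucD: "Ck_on (Suc k) f S \<Longrightarrow> Ck_on k f S"
proof (induction k arbitrary: f)
  case 0
  then show ?case
    by (auto intro!: continuous_at_imp_continuous_on differentiable_imp_continuous_within)
next
  case (Suc k)
  then show ?case by (metis Ck_on.simps(2))
qed

text \<open>Derivatives in \<open>Ck_on\<close> are full derivatives \<open>at x\<close>, so only
  neighbourhoods of the points of \<open>S\<close> matter; \<open>S\<close> itself may be
  arbitrary.\<close>

lemma Ck_on_local:
  assumes "\<And>x. x \<in> S \<Longrightarrow> \<exists>T. open T \<and> x \<in> T \<and> Ck_on k f T"
  shows "Ck_on k f S"
  using assms
proof (induction k arbitrary: f)
  case 0
  show ?case
    unfolding Ck_on.simps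
  proof (rule continuous_at_imp_continuous_on, intro ballI)
    fix x assume "x \<in> S"
    then obtain T where "open T" "x \<in> T" "continuous_on T f" using 0 by auto
    then show "isCont f x" using continuous_on_eq_continuous_at by blast
  qed
next
  case (Suc k)
  have "f differentiable at x" if "x \<in> S" for x
    using Suc.prems[OF that] by auto
  moreover have "Ck_on k (\<lambda>x. frechet_derivative f (at x) v) S" for v
    by (rule Suc.IH) (use Suc.prems in fastforce)
  ultimately show ?case by simp
qed

lemma Ck_on_const: "Ck_on k (\<lambda>x. c) S"
  by (induction k arbitrary: c) auto

text \<open>Trades the choice operator in \<open>frechet_derivative\<close> for an explicit
  derivative \<open>f'\<close>, so that each closure rule becomes an induction on \<open>k\<close>
  driven by the matching \<open>has_derivative\<close> rule.\<close>

lemma Ck_on_SucI: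
  assumes "open S" "\<And>x. x \<in> S \<Longrightarrow> (f has_derivative f' x) (at x)"
    and "\<And>v. Ck_on k (\<lambda>x. f' x v) S"
  shows "Ck_on (Suc k) f S"
proof -
  have eq: "frechet_derivative f (at x) = f' x" if "x \<in> S" for x
    using frechet_derivative_at[OF assms(2)[OF that]] by simp
  have "Ck_on k (\<lambda>x. frechet_derivative f (at x) v) S" for v
    by (rule Ck_on_cong[OF assms(1) _ assms(3)[of v]]) (simp add: eq)
  then show ?thesis using assms(2) by (auto simp: differentiable_def)
qed

lemma Ck_on_has_derivative:
  "Ck_on (Suc k) f S \<Longrightarrow> x \<in> S \<Longrightarrow> (f has_derivative frechet_derivative f (at x)) (at x)"
  by (simp add: frechet_derivative_works)

lemma Ck_on_add:
  assumes "open S" "Ck_on k f S" "Ck_on k h S"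
  shows "Ck_on k (\<lambda>x. f x + h x) S"
  using assms(2,3)
proof (induction k arbitrary: f h)
  case 0 then show ?case by (auto intro: continuous_on_add)
next
  case (Suc k)
  show ?case
    by (rule Ck_on_SucI[OF assms(1) has_derivative_add
          [OF Ck_on_has_derivative[OF Suc.prems(1)] Ck_on_has_derivative[OF Suc.prems(2)]]])
       (use Suc in auto)
qed

lemma Ck_on_sum:
  assumes "open S" "\<And>i. i \<in> A \<Longrightarrow> Ck_on k (f i) S"
  shows "Ck_on k (\<lambda>x. \<Sum>i\<in>A. f i x) S"
  using assms(2)
  by (induction A rule: infinite_finite_induct) (auto intro: Ck_on_const Ck_on_add[OF assms(1)])

lemma Ck_on_bounded_linear:
  assumes "open S" "bounded_linear L" "Ck_on k f S"
  shows "Ck_on k (\<lambda>x. L (f x)) S"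
  using assms(3)
proof (induction k arbitrary: f)
  case 0 then show ?case
    by (auto intro: continuous_on_compose2[OF linear_continuous_on[OF assms(2)]])
next
  case (Suc k)
  show ?case
    by (rule Ck_on_SucI[OF assms(1) bounded_linear.has_derivative
          [OF assms(2) Ck_on_has_derivative[OF Suc.prems]]])
       (use Suc in auto)
qed

lemma Ck_on_linear: "open S \<Longrightarrow> bounded_linear L \<Longrightarrow> Ck_on k L S"
proof (cases k)
  case (Suc j)
  assume "open S" "bounded_linear L"
  then show ?thesis
    unfolding Suc
    by (intro Ck_on_SucI[where f' = "\<lambda>_. L"] bounded_linear_imp_has_derivative Ck_on_const)
qed (simp add: linear_continuous_on)

lemma Ck_on_scaleR:
  assumes "open S" "Ck_on k f S" "Ck_on k h S"
  shows "Ck_on k (\<lambda>x. f x *\<^sub>R h x) S"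
  using assms(2,3)
proof (induction k arbitrary: f h)
  case 0 then show ?case by (auto intro: continuous_on_scaleR)
next
  case (Suc k)
  note low = Ck_on_SucD[OF Suc.prems(1)] Ck_on_SucD[OF Suc.prems(2)]
  show ?case
    by (rule Ck_on_SucI[OF assms(1) has_derivative_scaleR
          [OF Ck_on_has_derivative[OF Suc.prems(1)] Ck_on_has_derivative[OF Suc.prems(2)]]])
       (use Suc.prems in \<open>auto intro!: Ck_on_add[OF assms(1)] Suc.IH low\<close>)
qed

lemma linear_sum_Basis:
  assumes "linear L"
  shows "L v = (\<Sum>i\<in>Basis. (v \<bullet> i) *\<^sub>R L (i :: 'a::euclidean_space))"
proof -
  have "L v = L (\<Sum>i\<in>Basis. (v \<bullet> i) *\<^sub>R i)" by (simp add: euclidean_representation)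
  also have "\<dots> = (\<Sum>i\<in>Basis. (v \<bullet> i) *\<^sub>R L i)"
    by (simp add: linear_sum[OF assms] linear_cmul[OF assms])
  finally show ?thesis .
qed

text \<open>By the chain rule the derivative of \<open>f\<close> is applied to a vector that moves
  with \<open>x\<close>, whereas \<open>Ck_on\<close> speaks only of fixed directions. Expanding
  that vector in \<open>Basis\<close> reduces to fixed directions \<open>i\<close>, to which the
  induction hypothesis applies.\<close>

lemma Ck_on_compose:
  fixes f :: "'b::euclidean_space \<Rightarrow> 'c::real_normed_vector"
  assumes "open S" "open T" "h ` S \<subseteq> T" "Ck_on k h S" "Ck_on k f T"
  shows "Ck_on k (f \<circ> h) S"
  using assms(4,5)
proof (induction k arbitrary: f)
  case 0 then show ?case
    using assms(3) continuous_on_compose[of S h f] continuous_on_subset by (metis Ck_on.simps(1))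
next
  case (Suc k)
  note hk = Ck_on_SucD[OF Suc.prems(1)]
  have hT: "h x \<in> T" if "x \<in> S" for x using assms(3) that by auto
  have lin: "linear (frechet_derivative f (at y))" if "y \<in> T" for y
    using Suc.prems(2) that by (simp add: linear_frechet_derivative)
  show ?case
  proof (rule Ck_on_SucI[OF assms(1)])
    fix x assume "x \<in> S"
    then show "(f \<circ> h has_derivative (\<lambda>v. \<Sum>i\<in>Basis. (frechet_derivative h (at x) v \<bullet> i) *\<^sub>R
        (((\<lambda>y. frechet_derivative f (at y) i) \<circ> h) x))) (at x)"
      using diff_chain_at[OF Ck_on_has_derivative[OF Suc.prems(1)]
          Ck_on_has_derivative[OF Suc.prems(2) hT]]
      by (simp add: o_def linear_sum_Basis[OF lin[OF hT], symmetric])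
  next
    fix v
    show "Ck_on k (\<lambda>x. \<Sum>i\<in>Basis. (frechet_derivative h (at x) v \<bullet> i) *\<^sub>R
        (((\<lambda>y. frechet_derivative f (at y) i) \<circ> h) x)) S"
      using Suc
      by (intro Ck_on_sum Ck_on_scaleR assms(1) Suc.IH[OF hk]
          Ck_on_bounded_linear[OF _ bounded_linear_inner_left]) auto
  qed
qed

lemma Ck_on_Pair:
  assumes "open S" "Ck_on k f S" "Ck_on k h S"
  shows "Ck_on k (\<lambda>x. (f x, h x)) S"
proof -
  have "bounded_linear (\<lambda>x. (x, 0))" "bounded_linear (\<lambda>y. (0, y))"
    by (auto intro: bounded_linear_Pair bounded_linear_ident bounded_linear_zero)
  then have "Ck_on k (\<lambda>x. (f x, 0) + (0, h x)) S"
    by (intro Ck_on_add assms(1) Ck_on_bounded_linear[OF assms(1) _ assms(2)]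
        Ck_on_bounded_linear[OF assms(1) _ assms(3)])
  then show ?thesis by simp
qed

section \<open>Closure properties of smooth maps, and symmetry of second derivatives\<close>

lemma smooth_on_cong:
  "open S \<Longrightarrow> (\<And>x. x \<in> S \<Longrightarrow> f x = h x) \<Longrightarrow> smooth_on S f \<Longrightarrow> smooth_on S h"
  unfolding smooth_on_def using Ck_on_cong by metis

lemma smooth_on_subset: "smooth_on S f \<Longrightarrow> T \<subseteq> S \<Longrightarrow> smooth_on T f"
  unfolding smooth_on_def using Ck_on_subset by metis

lemma smooth_on_local:
  assumes "\<And>x. x \<in> S \<Longrightarrow> \<exists>T. open T \<and> x \<in> T \<and> smooth_on T f"
  shows "smooth_on S f"
  unfolding smooth_on_def by (intro allI Ck_on_local) (use assms smooth_on_def in blast)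

lemma smooth_on_const: "smooth_on S (\<lambda>x. c)"
  by (simp add: smooth_on_def Ck_on_const)

lemma smooth_on_add:
  "open S \<Longrightarrow> smooth_on S f \<Longrightarrow> smooth_on S h \<Longrightarrow> smooth_on S (\<lambda>x. f x + h x)"
  by (simp add: smooth_on_def Ck_on_add)

lemma smooth_on_sum:
  "open S \<Longrightarrow> (\<And>i. i \<in> A \<Longrightarrow> smooth_on S (f i)) \<Longrightarrow> smooth_on S (\<lambda>x. \<Sum>i\<in>A. f i x)"
  by (simp add: smooth_on_def Ck_on_sum)

lemma smooth_on_bounded_linear:
  "open S \<Longrightarrow> bounded_linear L \<Longrightarrow> smooth_on S f \<Longrightarrow> smooth_on S (\<lambda>x. L (f x))"
  by (simp add: smooth_on_def Ck_on_bounded_linear)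

lemma smooth_on_linear: "open S \<Longrightarrow> bounded_linear L \<Longrightarrow> smooth_on S L"
  by (simp add: smooth_on_def Ck_on_linear)

lemma smooth_on_scaleR:
  "open S \<Longrightarrow> smooth_on S f \<Longrightarrow> smooth_on S h \<Longrightarrow> smooth_on S (\<lambda>x. f x *\<^sub>R h x)"
  by (simp add: smooth_on_def Ck_on_scaleR)

lemma smooth_on_mult:
  fixes f h :: "'a::euclidean_space \<Rightarrow> real"
  shows "open S \<Longrightarrow> smooth_on S f \<Longrightarrow> smooth_on S h \<Longrightarrow> smooth_on S (\<lambda>x. f x * h x)"
  using smooth_on_scaleR[of S f h] by simp

lemma smooth_on_compose:
  fixes f :: "'b::euclidean_space \<Rightarrow> 'c::real_normed_vector"
  assumes "open S" "open T" "h ` S \<subseteq> T" "smooth_on S h" "smooth_on T f"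
  shows "smooth_on S (f \<circ> h)"
  using assms Ck_on_compose unfolding smooth_on_def by metis

lemma smooth_on_Pair:
  "open S \<Longrightarrow> smooth_on S f \<Longrightarrow> smooth_on S h \<Longrightarrow> smooth_on S (\<lambda>x. (f x, h x))"
  by (simp add: smooth_on_def Ck_on_Pair)

lemma smooth_on_has_derivative:
  "smooth_on S f \<Longrightarrow> x \<in> S \<Longrightarrow> (f has_derivative frechet_derivative f (at x)) (at x)"
  unfolding smooth_on_def using Ck_on_has_derivative by blast

lemma smooth_on_differentiable: "smooth_on S f \<Longrightarrow> x \<in> S \<Longrightarrow> f differentiable (at x)"
  using smooth_on_has_derivative differentiable_def by blast

lemma smooth_on_continuous: "smooth_on S f \<Longrightarrow> continuous_on S f"
  unfolding smooth_on_def by (metis Ck_on.simps(1))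

lemma smooth_on_frechet_derivative:
  "smooth_on S f \<Longrightarrow> smooth_on S (\<lambda>x. frechet_derivative f (at x) v)"
  unfolding smooth_on_def by (metis Ck_on.simps(2))

lemma smooth_on_frechet_derivative_linear:
  "smooth_on S f \<Longrightarrow> x \<in> S \<Longrightarrow> linear (frechet_derivative f (at x))"
  using linear_frechet_derivative smooth_on_differentiable by blast

text \<open>Both mixed second derivatives are limits of the same second difference quotient.\<close>
lemma mixed_difference_mean_value:
  fixes f :: "'a::euclidean_space \<Rightarrow> real"
  assumes f: "smooth_on (ball x r) f" and h: "0 < h" "h * (norm v + norm w) < r"
  shows "\<exists>y. norm (y - x) \<le> h * (norm v + norm w) \<and>
    f (x + h *\<^sub>R v + h *\<^sub>R w) - f (x + h *\<^sub>R v) - f (x + h *\<^sub>R w) + f x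
      = h * h * frechet_derivative (\<lambda>z. frechet_derivative f (at z) v) (at y) w"
proof -
  define Df where "Df = (\<lambda>z. frechet_derivative f (at z) v)"
  have norm_le: "norm (s *\<^sub>R v + t *\<^sub>R w) \<le> h * (norm v + norm w)"
    if "0 \<le> s" "s \<le> h" "0 \<le> t" "t \<le> h" for s t
  proof -
    have "norm (s *\<^sub>R v + t *\<^sub>R w) \<le> s * norm v + t * norm w"
      using norm_triangle_ineq[of "s *\<^sub>R v" "t *\<^sub>R w"] that by simp
    also have "\<dots> \<le> h * norm v + h * norm w" using that by (intro add_mono mult_right_mono) auto
    finally show ?thesis by (simp add: distrib_left)
  qed
  have inb: "x + s *\<^sub>R v + t *\<^sub>R w \<in> ball x r"
    if "0 \<le> s" "s \<le> h" "0 \<le> t" "t \<le> h" for s t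
  proof -
    have "dist x (x + s *\<^sub>R v + t *\<^sub>R w) = norm (s *\<^sub>R v + t *\<^sub>R w)"
      by (metis add.assoc add_diff_cancel_left' dist_commute dist_norm)
    then show ?thesis using norm_le[OF that] h(2) by simp
  qed
  have d: "((\<lambda>s. f (x + s *\<^sub>R v + t *\<^sub>R w)) has_real_derivative Df (x + s *\<^sub>R v + t *\<^sub>R w)) (at s)"
    if "0 \<le> s" "s \<le> h" "0 \<le> t" "t \<le> h" for s t
  proof -
    have "((\<lambda>s. x + s *\<^sub>R v + t *\<^sub>R w) has_derivative (\<lambda>k. k *\<^sub>R v)) (at s)"
      by (auto intro!: derivative_eq_intros)
    from diff_chain_at[OF this smooth_on_has_derivative[OF f inb[OF that]]]
    have "((\<lambda>s. f (x + s *\<^sub>R v + t *\<^sub>R w)) has_derivative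
      (\<lambda>k. frechet_derivative f (at (x + s *\<^sub>R v + t *\<^sub>R w)) (k *\<^sub>R v))) (at s)"
      by (simp add: o_def)
    then show ?thesis
      unfolding has_field_derivative_def
      using linear_cmul[OF smooth_on_frechet_derivative_linear[OF f inb[OF that]]]
      by (simp add: Df_def mult.commute[of _ "frechet_derivative _ _ _"] mult_commute_abs)
  qed
  \<comment> \<open>The mean value theorem in \<open>s\<close> is applied to the difference of the
    slices \<open>t = h\<close> and \<open>t = 0\<close>; the zero multiples are kept so that
    \<open>d\<close> fits all four terms.\<close>
  have "\<exists>s. 0 < s \<and> s < h \<and>
    (f (x + h *\<^sub>R v + h *\<^sub>R w) - f (x + h *\<^sub>R v + 0 *\<^sub>R w)) - (f (x + 0 *\<^sub>R v + h *\<^sub>R w) - f (x + 0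
        *\<^sub>R v + 0 *\<^sub>R w))
      = (h - 0) * (Df (x + s *\<^sub>R v + h *\<^sub>R w) - Df (x + s *\<^sub>R v + 0 *\<^sub>R w))"
    using h by (intro MVT2 DERIV_diff d) auto
  then obtain s where s: "0 < s" "s < h" and eq1:
    "f (x + h *\<^sub>R v + h *\<^sub>R w) - f (x + h *\<^sub>R v) - f (x + h *\<^sub>R w) + f x
      = h * (Df (x + s *\<^sub>R v + h *\<^sub>R w) - Df (x + s *\<^sub>R v + 0 *\<^sub>R w))" by auto
  have Df: "smooth_on (ball x r) Df" unfolding Df_def by (rule smooth_on_frechet_derivative[OF f])
  have d2: "((\<lambda>t. Df (x + s *\<^sub>R v + t *\<^sub>R w)) has_real_derivative
      frechet_derivative Df (at (x + s *\<^sub>R v + t *\<^sub>R w)) w) (at t)"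
    if "0 \<le> t" "t \<le> h" for t
  proof -
    have in': "x + s *\<^sub>R v + t *\<^sub>R w \<in> ball x r" using inb[of s t] s that by simp
    have "((\<lambda>t. x + s *\<^sub>R v + t *\<^sub>R w) has_derivative (\<lambda>k. k *\<^sub>R w)) (at t)"
      by (auto intro!: derivative_eq_intros)
    from diff_chain_at[OF this smooth_on_has_derivative[OF Df in']]
    have "((\<lambda>t. Df (x + s *\<^sub>R v + t *\<^sub>R w)) has_derivative
      (\<lambda>k. frechet_derivative Df (at (x + s *\<^sub>R v + t *\<^sub>R w)) (k *\<^sub>R w))) (at t)"
      by (simp add: o_def)
    then show ?thesis
      unfolding has_field_derivative_def
      using linear_cmul[OF smooth_on_frechet_derivative_linear[OF Df in']]
      by (simp add: mult_commute_abs)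
  qed
  have "\<exists>t. 0 < t \<and> t < h \<and> Df (x + s *\<^sub>R v + h *\<^sub>R w) - Df (x + s *\<^sub>R v + 0 *\<^sub>R w)
      = (h - 0) * frechet_derivative Df (at (x + s *\<^sub>R v + t *\<^sub>R w)) w"
    using h by (intro MVT2 d2) auto
  then obtain t where t: "0 < t" "t < h" and eq2: "Df (x + s *\<^sub>R v + h *\<^sub>R w) - Df (x + s *\<^sub>R v + 0
      *\<^sub>R w)
      = h * frechet_derivative Df (at (x + s *\<^sub>R v + t *\<^sub>R w)) w" by auto
  show ?thesis
    using eq1 eq2 norm_le[of s t] s t
    by (intro exI[of _ "x + s *\<^sub>R v + t *\<^sub>R w"]) (simp add: Df_def add.assoc)
qed

text \<open>The mean value point lies within \<open>h * (norm v + norm w)\<close> of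
  \<open>x\<close>, so continuity of the second derivative gives the limit.\<close>

lemma second_difference_tendsto:
  fixes f :: "'a::euclidean_space \<Rightarrow> real"
  assumes f: "smooth_on (ball x r) f" and "0 < r"
  shows "((\<lambda>h. (f (x + h *\<^sub>R v + h *\<^sub>R w) - f (x + h *\<^sub>R v) - f (x + h *\<^sub>R w) + f x) / (h * h))
    \<longlongrightarrow> frechet_derivative (\<lambda>z. frechet_derivative f (at z) v) (at x) w) (at_right 0)"
proof -
  define D2 where "D2 = (\<lambda>y. frechet_derivative (\<lambda>z. frechet_derivative f (at z) v) (at y) w)"
  define m where "m = norm v + norm w"
  have "continuous_on (ball x r) D2" unfolding D2_def
    by (intro smooth_on_continuous smooth_on_frechet_derivative f)
  then have cont: "isCont D2 x"
    using \<open>0 < r\<close> continuous_on_eq_continuous_at[of "ball x r" D2] by simp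
  have "((\<lambda>h. (f (x + h *\<^sub>R v + h *\<^sub>R w) - f (x + h *\<^sub>R v) - f (x + h *\<^sub>R w) + f x) / (h * h))
    \<longlongrightarrow> D2 x) (at_right 0)"
    unfolding tendsto_iff
  proof (intro allI impI)
    fix e :: real assume "0 < e"
    then obtain s where s: "0 < s" "\<And>y. norm (y - x) < s \<Longrightarrow> dist (D2 y) (D2 x) < e"
      using cont unfolding continuous_at_eps_delta by (metis dist_norm)
    \<comment> \<open>\<open>m\<close> may be 0, whence the division by \<open>m + 1\<close> below.
      The bound \<open>min r s\<close> keeps the increments inside the ball and the mean value point
      within the continuity radius \<open>s\<close>.\<close>
    have m0: "0 \<le> m" by (simp add: m_def)
    have "\<forall>\<^sub>F h in at_right 0. h < min r s / (m + 1)"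
      by (rule order_tendstoD(2)[OF tendsto_ident_at]) (use s \<open>0 < r\<close> m0 in auto)
    then show "\<forall>\<^sub>F h in at_right 0. dist ((f (x + h *\<^sub>R v + h *\<^sub>R w) - f (x + h *\<^sub>R v)
        - f (x + h *\<^sub>R w) + f x) / (h * h)) (D2 x) < e"
      using eventually_at_right_less[of 0]
    proof eventually_elim
      case (elim h)
      have "h * m \<le> h * (m + 1)" using elim by simp
      also have "\<dots> < min r s" using elim m0 by (simp add: pos_less_divide_eq)
      finally have hm: "h * m < min r s" .
      then obtain y where y: "norm (y - x) \<le> h * m" and
        "f (x + h *\<^sub>R v + h *\<^sub>R w) - f (x + h *\<^sub>R v) - f (x + h *\<^sub>R w) + f x = h * h * D2 y"
        using mixed_difference_mean_value[OF f, of h v w] elim(2) unfolding m_def D2_def by auto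
      then show ?case using s(2)[of y] hm elim(2) by simp
    qed
  qed
  then show ?thesis by (simp add: D2_def)
qed

text \<open>The second difference quotient is symmetric in \<open>v\<close> and \<open>w\<close>, so
  both orders of differentiation have the same limit. The mean value theorem needs real values,
  hence the passage to components \<open>f z \<bullet> b\<close>.\<close>

lemma second_derivative_symmetric:
  fixes f :: "'a::euclidean_space \<Rightarrow> 'b::euclidean_space"
  assumes "open S" "x \<in> S" "smooth_on S f"
  shows "frechet_derivative (\<lambda>z. frechet_derivative f (at z) v) (at x) w
       = frechet_derivative (\<lambda>z. frechet_derivative f (at z) w) (at x) v"
proof (rule euclidean_eqI)
  fix b :: 'b assume "b \<in> Basis"
  define F where "F = (\<lambda>z. f z \<bullet> b)"
  have F: "smooth_on S F" unfolding F_def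
    by (rule smooth_on_bounded_linear[OF assms(1) bounded_linear_inner_left assms(3)])
  have comp: "frechet_derivative (\<lambda>z. h z \<bullet> b) (at z) u = frechet_derivative h (at z) u \<bullet> b"
    if "smooth_on S h" "z \<in> S" for h :: "'a \<Rightarrow> 'b" and z u
    using frechet_derivative_at[OF bounded_linear.has_derivative[OF
        bounded_linear_inner_left[of b] smooth_on_has_derivative[OF that]]] by metis
  have D2: "frechet_derivative (\<lambda>z. frechet_derivative F (at z) u) (at x) u'
      = frechet_derivative (\<lambda>z. frechet_derivative f (at z) u) (at x) u' \<bullet> b" for u u'
  proof -
    have "frechet_derivative (\<lambda>z. frechet_derivative F (at z) u) (at x)
      = frechet_derivative (\<lambda>z. frechet_derivative f (at z) u \<bullet> b) (at x)"
      by (rule frechet_derivative_cong_open[OF assms(1,2)]) (simp add: F_def comp[OF assms(3)])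
    then show ?thesis using comp[OF smooth_on_frechet_derivative[OF assms(3)] assms(2)] by simp
  qed
  obtain r where r: "0 < r" "ball x r \<subseteq> S" using assms open_contains_ball by blast
  have Fb: "smooth_on (ball x r) F" using F r(2) smooth_on_subset by blast
  have "frechet_derivative (\<lambda>z. frechet_derivative F (at z) v) (at x) w
       = frechet_derivative (\<lambda>z. frechet_derivative F (at z) w) (at x) v"
    using second_difference_tendsto[OF Fb r(1), of v w] second_difference_tendsto[OF Fb r(1), of w v]
    by (intro tendsto_unique[OF trivial_limit_at_right_real])
       (simp_all add: algebra_simps)
  then show "frechet_derivative (\<lambda>z. frechet_derivative f (at z) v) (at x) w \<bullet> b
    = frechet_derivative (\<lambda>z. frechet_derivative f (at z) w) (at x) v \<bullet> b"
    by (simp add: D2)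
qed

text \<open>The family \<open>x\<^sup>-\<^sup>k exp (-1/x)\<close>, extended by \<open>0\<close>, is closed under derivatives up to linear
  combinations.\<close>
definition flat :: "nat \<Rightarrow> real \<Rightarrow> real" where
  "flat k x = (if x > 0 then (1 / x) ^ k * exp (- (1 / x)) else 0)"

lemma flat_tendsto_0: "(flat k \<longlongrightarrow> 0) (at 0)"
proof -
  have "((\<lambda>x. (inverse x) ^ k / exp (inverse x)) \<longlongrightarrow> 0) (at_right (0::real))"
    using filterlim_compose[OF tendsto_power_div_exp_0 filterlim_inverse_at_top_right] .
  moreover have "\<forall>\<^sub>F x in at_right (0::real). (inverse x) ^ k / exp (inverse x) = flat k x"
    using eventually_at_right_less[of 0]
    by eventually_elim (simp add: flat_def exp_minus field_simps)
  ultimately have "(flat k \<longlongrightarrow> 0) (at_right 0)" using Lim_transform_eventually by blast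
  moreover have "(flat k \<longlongrightarrow> 0) (at_left 0)"
    by (rule tendsto_eventually) (auto simp: flat_def eventually_at_filter)
  ultimately show ?thesis by (simp add: filterlim_split_at)
qed

lemma flat_derivative:
  "(flat k has_real_derivative (flat (k + 2) x - real k * flat (k + 1) x)) (at x)"
proof -
  consider "x < 0" | "x = 0" | "x > 0" by linarith
  then show ?thesis
  proof cases
    case 1
    have "((\<lambda>x. 0) has_real_derivative 0) (at x)" by simp
    then have "(flat k has_real_derivative 0) (at x)"
      by (rule has_field_derivative_transform_within_open[of _ _ _ "{..<0}"])
         (use 1 in \<open>auto simp: flat_def\<close>)
    then show ?thesis using 1 by (simp add: flat_def)
  next
    case 2
    \<comment> \<open>At 0 the difference quotient of \<open>flat k\<close> is the next member of
      the family, which tends to 0.\<close>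
    have "(\<lambda>h. (flat k (0 + h) - flat k 0) / h) = flat (k + 1)"
      by (rule ext) (simp add: flat_def)
    then show ?thesis using flat_tendsto_0[of "k + 1"] 2 by (simp add: DERIV_def flat_def)
  next
    case 3
    have "((\<lambda>x. (1 / x) ^ k * exp (- (1 / x))) has_real_derivative
      (1 / x) ^ k * (exp (- (1 / x)) * (1 / x)^2) - real k * (1 / x) ^ (k + 1) * exp (- (1 / x)))
          (at x)"
    proof (cases k)
      case 0
      then show ?thesis using 3
        by (auto intro!: derivative_eq_intros simp: power2_eq_square field_simps)
    next
      case (Suc j)
      have "((\<lambda>x. 1 / x) has_real_derivative - ((1 / x)^2)) (at x)"
        using 3 by (auto intro!: derivative_eq_intros simp: power2_eq_square field_simps)
      from DERIV_mult[OF DERIV_power[OF this, of k] DERIV_fun_exp[OF DERIV_minus[OF this]]]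
      show ?thesis by (simp add: Suc power2_eq_square algebra_simps)
    qed
    then have "(flat k has_real_derivative
      (1 / x) ^ k * (exp (- (1 / x)) * (1 / x)^2) - real k * (1 / x) ^ (k + 1) * exp (- (1 / x)))
          (at x)"
      by (rule has_field_derivative_transform_within_open[of _ _ _ "{0<..}"])
         (use 3 in \<open>auto simp: flat_def\<close>)
    then show ?thesis using 3 by (simp add: flat_def algebra_simps power2_eq_square)
  qed
qed

lemma Ck_on_flat: "Ck_on n (flat k) UNIV"
proof (induction n arbitrary: k)
  case 0
  show ?case using DERIV_isCont[OF flat_derivative] by (simp add: continuous_at_imp_continuous_on)
next
  case (Suc n)
  have "Ck_on n (\<lambda>x. v *\<^sub>R (flat (k + 2) x + (- real k) *\<^sub>R flat (k + 1) x)) UNIV" for v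
    by (intro Ck_on_scaleR Ck_on_add Ck_on_const open_UNIV Suc.IH)
  then show ?case
    by (intro Ck_on_SucI[OF open_UNIV flat_derivative[unfolded has_field_derivative_def]])
       (simp add: mult.commute)
qed

lemma bump_function_exists:
  fixes t :: "'a::euclidean_space"
  assumes "0 < r"
  shows "\<exists>b :: 'a \<Rightarrow> real. smooth_on UNIV b \<and> b t = 1 \<and> (\<forall>s. s \<notin> cball t r \<longrightarrow> b s = 0)"
proof -
  \<comment> \<open>This is r^2 - |s - t|^2, written only with operations that have a smoothness
    rule. It is at most 0 outside the ball, where \<open>flat 0\<close> vanishes.\<close>
  define q where "q = (\<lambda>s. r\<^sup>2 + (-1) *\<^sub>R (\<Sum>i\<in>Basis. ((s + - t) \<bullet> i) * ((s + - t) \<bullet> i)))"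
  have q: "q s = r\<^sup>2 - (dist t s)\<^sup>2" for s
    by (simp add: q_def dist_norm norm_minus_commute power2_norm_eq_inner euclidean_inner[symmetric])
  have "smooth_on UNIV q" unfolding q_def
    by (intro smooth_on_add smooth_on_scaleR smooth_on_sum smooth_on_mult smooth_on_const
        smooth_on_bounded_linear[OF _ bounded_linear_inner_left]
        smooth_on_linear[OF _ bounded_linear_ident] open_UNIV)
  then have "smooth_on UNIV (flat 0 \<circ> q)"
    by (rule smooth_on_compose[OF open_UNIV open_UNIV subset_UNIV])
       (simp add: smooth_on_def Ck_on_flat)
  then have "smooth_on UNIV (\<lambda>s. inverse (flat 0 (r\<^sup>2)) *\<^sub>R (flat 0 \<circ> q) s)"
    by (intro smooth_on_scaleR smooth_on_const open_UNIV)
  moreover have "flat 0 (r\<^sup>2) \<noteq> 0" using assms by (simp add: flat_def)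
  moreover have "(flat 0 \<circ> q) s = 0" if "s \<notin> cball t r" for s
  proof -
    have "r\<^sup>2 \<le> (dist t s)\<^sup>2" using that assms by (intro power_mono) auto
    then show ?thesis by (simp add: flat_def q)
  qed
  ultimately show ?thesis
    by (intro exI[of _ "\<lambda>s. inverse (flat 0 (r\<^sup>2)) *\<^sub>R (flat 0 \<circ> q) s"]) (auto simp: q)
qed

subsection \<open>Charts and vector fields\<close>

lemma chart_props:
  assumes "is_chart c"
  shows "open (fst c)" "open (snd c ` fst c)" "inj_on (snd c) (fst c)"
    and "q \<in> fst c \<Longrightarrow> cinv c (snd c q) = q"
    and "t \<in> snd c ` fst c \<Longrightarrow> cinv c t \<in> fst c"
    and "t \<in> snd c ` fst c \<Longrightarrow> snd c (cinv c t) = t"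
    and "continuous_on (fst c) (snd c)" "continuous_on (snd c ` fst c) (cinv c)"
  using assms unfolding is_chart_def homeomorphism_def inj_on_def by (blast | metis)+

lemma open_chart_image:
  assumes "is_chart c" "open U"
  shows "open (snd c ` (fst c \<inter> U))"
proof -
  have "snd c ` (fst c \<inter> U) = (snd c ` fst c) \<inter> cinv c -` U"
    using chart_props(4)[OF assms(1)] chart_props(5,6)[OF assms(1)] by auto
  then show ?thesis
    using continuous_open_preimage[OF chart_props(8,2)[OF assms(1)] assms(2)] by simp
qed

text \<open>The Jacobian of the transition map. \<open>to_chart\<close> and
  \<open>coord_field\<close> are the cases in which one chart is the preferred one, so a single
  cocycle rule shows that they are inverse to each other.\<close>

definition chart_change_deriv ::
    "('a, 'e::euclidean_space) chart \<Rightarrow> ('a, 'e) chart \<Rightarrow> 'a \<Rightarrow> 'e \<Rightarrow> 'e" where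
  "chart_change_deriv c d q = frechet_derivative (snd d \<circ> cinv c) (at (snd c q))"

lemma to_chart_eq: "to_chart M c q = chart_change_deriv (chart_at M q) c q"
  by (rule ext) (simp add: to_chart_def dir_deriv_def chart_change_deriv_def)

lemma coord_field_eq: "coord_field M c a q = chart_change_deriv c (chart_at M q) q a"
  by (simp add: coord_field_def chart_change_deriv_def)

context
  fixes M :: "('a::{t2_space,second_countable_topology}, 'e::euclidean_space) mfd"
  assumes M: "smooth_manifold M"
begin

lemma atlas_is_chart: "c \<in> atlas M \<Longrightarrow> is_chart c"
  using M by (simp add: smooth_manifold_def)

lemma chart_at_atlas: "chart_at M p \<in> atlas M" "p \<in> fst (chart_at M p)"
  using M by (simp_all add: smooth_manifold_def)

lemma smooth_on_chart_change:
  "c \<in> atlas M \<Longrightarrow> d \<in> atlas M \<Longrightarrow> smooth_on (snd c ` (fst c \<inter> fst d)) (snd d \<circ> cinv c)"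
  using M by (simp add: smooth_manifold_def)

lemma open_chart_dom: "c \<in> atlas M \<Longrightarrow> open (fst c)"
  using atlas_is_chart chart_props(1) by blast

lemma chart_change_has_derivative:
  assumes "c \<in> atlas M" "d \<in> atlas M" "q \<in> fst c" "q \<in> fst d"
  shows "((snd d \<circ> cinv c) has_derivative chart_change_deriv c d q) (at (snd c q))"
  unfolding chart_change_deriv_def
  by (rule smooth_on_has_derivative[OF smooth_on_chart_change]) (use assms in auto)

lemma has_derivative_chart_change:
  assumes "c \<in> atlas M" "d \<in> atlas M" "q \<in> fst c" "q \<in> fst d"
    and "((f \<circ> cinv d) has_derivative D) (at (snd d q))"
  shows "((f \<circ> cinv c) has_derivative (\<lambda>a. D (chart_change_deriv c d q a))) (at (snd c q))"
proof -
  note c = chart_props[OF atlas_is_chart[OF assms(1)]] and d = chart_props[OF atlas_is_chart[OF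
      assms(2)]]
  have "(f \<circ> cinv d has_derivative D) (at ((snd d \<circ> cinv c) (snd c q)))"
    using assms(5) c(4)[OF assms(3)] by simp
  from diff_chain_at[OF chart_change_has_derivative[OF assms(1-4)] this]
  have "(f \<circ> cinv d \<circ> (snd d \<circ> cinv c) has_derivative D \<circ> chart_change_deriv c d q) (at (snd c q))" .
  then have "(f \<circ> cinv c has_derivative D \<circ> chart_change_deriv c d q) (at (snd c q))"
    by (rule has_derivative_transform_within_open
        [OF _ open_chart_image[OF atlas_is_chart[OF assms(1)] d(1)]])
       (use assms c d in auto)
  then show ?thesis by (simp add: o_def)
qed

lemma chart_change_deriv_linear:
  "c \<in> atlas M \<Longrightarrow> d \<in> atlas M \<Longrightarrow> q \<in> fst c \<Longrightarrow> q \<in> fst d \<Longrightarrow> linear (chart_change_deriv c d q)"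
  using chart_change_has_derivative has_derivative_linear by blast

lemma chart_change_deriv_refl:
  assumes "c \<in> atlas M" "q \<in> fst c"
  shows "chart_change_deriv c c q a = a"
proof -
  note c = chart_props[OF atlas_is_chart[OF assms(1)]]
  have "frechet_derivative (snd c \<circ> cinv c) (at (snd c q)) = frechet_derivative (\<lambda>x. x) (at (snd c q))"
    by (rule frechet_derivative_cong_open[OF c(2)]) (use assms c in auto)
  then show ?thesis by (simp add: chart_change_deriv_def)
qed

lemma chart_change_deriv_trans:
  assumes "c \<in> atlas M" "d \<in> atlas M" "e \<in> atlas M" "q \<in> fst c" "q \<in> fst d" "q \<in> fst e"
  shows "chart_change_deriv d e q (chart_change_deriv c d q a) = chart_change_deriv c e q a"
  using frechet_derivative_at[OF has_derivative_chart_change[OF assms(1,2,4,5)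
      chart_change_has_derivative[OF assms(2,3,5,6)]]]
  by (simp add: chart_change_deriv_def[of c e]) metis

lemma to_chart_linear: "c \<in> atlas M \<Longrightarrow> q \<in> fst c \<Longrightarrow> linear (to_chart M c q)"
  by (simp add: to_chart_eq chart_change_deriv_linear chart_at_atlas)

lemma coord_field_linear: "c \<in> atlas M \<Longrightarrow> q \<in> fst c \<Longrightarrow> linear (\<lambda>a. coord_field M c a q)"
  by (simp add: coord_field_eq chart_change_deriv_linear chart_at_atlas)

lemma to_chart_coord_field:
  "c \<in> atlas M \<Longrightarrow> q \<in> fst c \<Longrightarrow> to_chart M c q (coord_field M c a q) = a"
  by (simp add: to_chart_eq coord_field_eq chart_change_deriv_trans chart_at_atlas
      chart_change_deriv_refl)

lemma coord_field_to_chart: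
  "c \<in> atlas M \<Longrightarrow> q \<in> fst c \<Longrightarrow> coord_field M c (to_chart M c q v) q = v"
  by (simp add: to_chart_eq coord_field_eq chart_change_deriv_trans chart_at_atlas
      chart_change_deriv_refl)

lemma coord_field_chart_at: "coord_field M (chart_at M p) a p = a"
  by (simp add: coord_field_eq chart_at_atlas chart_change_deriv_refl)

lemma to_chart_chart_at: "to_chart M (chart_at M p) p v = v"
  by (simp add: to_chart_eq chart_at_atlas chart_change_deriv_refl)

lemma coord_field_expansion:
  assumes "c \<in> atlas M" "q \<in> fst c"
  shows "v = (\<Sum>i\<in>Basis. (to_chart M c q v \<bullet> i) *\<^sub>R coord_field M c i q)"
  using linear_sum_Basis[OF coord_field_linear[OF assms], of "to_chart M c q v"]
    coord_field_to_chart[OF assms] by simp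

lemma dir_deriv_coord_field:
  assumes "c \<in> atlas M" "q \<in> fst c" "(f \<circ> cinv c) differentiable (at (snd c q))"
  shows "dir_deriv M q (coord_field M c a q) f = frechet_derivative (f \<circ> cinv c) (at (snd c q)) a"
proof -
  have "((f \<circ> cinv c) has_derivative frechet_derivative (f \<circ> cinv c) (at (snd c q))) (at (snd c q))"
    using assms(3) by (simp add: frechet_derivative_works)
  from fun_cong[OF frechet_derivative_at[OF has_derivative_chart_change
      [OF chart_at_atlas(1) assms(1) chart_at_atlas(2) assms(2) this]]]
  have "frechet_derivative (f \<circ> cinv (chart_at M q)) (at (snd (chart_at M q) q)) b
    = frechet_derivative (f \<circ> cinv c) (at (snd c q)) (chart_change_deriv (chart_at M q) c q b)" for b
    by metis
  then show ?thesis
    by (simp add: dir_deriv_def coord_field_eq chart_change_deriv_trans chart_at_atlas assms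
        chart_change_deriv_refl)
qed

text \<open>One chart containing \<open>U\<close> suffices, because every other coordinate
  expression differs from it by a smooth transition map.\<close>

lemma smooth_fun_onI_chart:
  assumes "c \<in> atlas M" "open U" "U \<subseteq> fst c" "smooth_on (snd c ` U) (f \<circ> cinv c)"
  shows "smooth_fun_on M U f"
  unfolding smooth_fun_on_def
proof (intro conjI ballI)
  fix d assume d: "d \<in> atlas M"
  note cp = chart_props[OF atlas_is_chart[OF assms(1)]] and dp = chart_props[OF atlas_is_chart[OF d]]
  have op: "open (snd d ` (fst d \<inter> U))" using open_chart_image[OF atlas_is_chart[OF d] assms(2)] .
  have op': "open (snd c ` U)"
    using open_chart_image[OF atlas_is_chart[OF assms(1)] assms(2)] assms(3) by (simp add: Int_absorb1)
  have "smooth_on (snd d ` (fst d \<inter> U)) (f \<circ> cinv c \<circ> (snd c \<circ> cinv d))"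
    by (rule smooth_on_compose[OF op op' _
          smooth_on_subset[OF smooth_on_chart_change[OF d assms(1)]] assms(4)])
       (use assms(3) dp in auto)
  then show "smooth_on (snd d ` (fst d \<inter> U)) (f \<circ> cinv d)"
    by (rule smooth_on_cong[OF op, rotated]) (use assms(3) cp dp in auto)
qed (use assms in simp)

lemma smooth_fun_on_subset:
  "smooth_fun_on M U f \<Longrightarrow> open V \<Longrightarrow> V \<subseteq> U \<Longrightarrow> smooth_fun_on M V f"
  unfolding smooth_fun_on_def by (metis smooth_on_subset image_mono Int_mono order_refl)

lemma smooth_fun_on_cong:
  assumes "\<And>q. q \<in> U \<Longrightarrow> f q = h q" "smooth_fun_on M U f"
  shows "smooth_fun_on M U h"
  unfolding smooth_fun_on_def
proof (intro conjI ballI)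
  fix c assume c: "c \<in> atlas M"
  show "smooth_on (snd c ` (fst c \<inter> U)) (h \<circ> cinv c)"
    by (rule smooth_on_cong[OF open_chart_image[OF atlas_is_chart[OF c]], where f = "f \<circ> cinv c"])
       (use assms chart_props[OF atlas_is_chart[OF c]] c in \<open>auto simp: smooth_fun_on_def\<close>)
qed (use assms in \<open>simp add: smooth_fun_on_def\<close>)

lemma smooth_fun_on_local:
  assumes "open U" "\<And>q. q \<in> U \<Longrightarrow> \<exists>V. q \<in> V \<and> smooth_fun_on M V f"
  shows "smooth_fun_on M U f"
  unfolding smooth_fun_on_def
proof (intro conjI ballI smooth_on_local)
  fix c t assume c: "c \<in> atlas M" and "t \<in> snd c ` (fst c \<inter> U)"
  then obtain q where q: "q \<in> fst c" "q \<in> U" "t = snd c q" by auto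
  then obtain V where "q \<in> V" "smooth_fun_on M V f" using assms(2) by blast
  then show "\<exists>T. open T \<and> t \<in> T \<and> smooth_on T (f \<circ> cinv c)"
    using q c open_chart_image[OF atlas_is_chart[OF c]] unfolding smooth_fun_on_def
    by (intro exI[of _ "snd c ` (fst c \<inter> V)"]) auto
qed (use assms in simp)

lemma smooth_fun_on_chart:
  "smooth_fun_on M U f \<Longrightarrow> c \<in> atlas M \<Longrightarrow> smooth_on (snd c ` (fst c \<inter> U)) (f \<circ> cinv c)"
  by (simp add: smooth_fun_on_def)

lemma smooth_fun_on_differentiable:
  "smooth_fun_on M U f \<Longrightarrow> c \<in> atlas M \<Longrightarrow> q \<in> fst c \<Longrightarrow> q \<in> U \<Longrightarrow>
    (f \<circ> cinv c) differentiable (at (snd c q))"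
  using smooth_on_differentiable[OF smooth_fun_on_chart] by blast

lemma smooth_fun_on_const: "open U \<Longrightarrow> smooth_fun_on M U (\<lambda>q. k)"
  by (simp add: smooth_fun_on_def o_def smooth_on_const)

lemma smooth_fun_on_scaleR:
  "smooth_fun_on M U f \<Longrightarrow> smooth_fun_on M U h \<Longrightarrow> smooth_fun_on M U (\<lambda>q. f q *\<^sub>R h q)"
  unfolding smooth_fun_on_def o_def by (auto intro!: smooth_on_scaleR open_chart_image atlas_is_chart)

lemma smooth_fun_on_add:
  "smooth_fun_on M U f \<Longrightarrow> smooth_fun_on M U h \<Longrightarrow> smooth_fun_on M U (\<lambda>q. f q + h q)"
  unfolding smooth_fun_on_def o_def by (auto intro!: smooth_on_add open_chart_image atlas_is_chart)

lemma smooth_fun_on_bounded_linear: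
  assumes "bounded_linear L" "smooth_fun_on M U f"
  shows "smooth_fun_on M U (\<lambda>q. L (f q))"
  unfolding smooth_fun_on_def
proof (intro conjI ballI)
  fix c assume c: "c \<in> atlas M"
  show "smooth_on (snd c ` (fst c \<inter> U)) ((\<lambda>q. L (f q)) \<circ> cinv c)"
    using smooth_on_bounded_linear[OF open_chart_image[OF atlas_is_chart[OF c]] assms(1)
        smooth_fun_on_chart[OF assms(2) c]] assms(2)
    by (simp add: o_def smooth_fun_on_def)
qed (use assms(2) in \<open>simp add: smooth_fun_on_def\<close>)

section \<open>Smooth vector fields\<close>

lemma smooth_vf_on_to_chart:
  "smooth_vf_on M U X \<Longrightarrow> c \<in> atlas M \<Longrightarrow> smooth_fun_on M (fst c \<inter> U) (\<lambda>q. to_chart M c q (X q))"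
  by (simp add: smooth_vf_on_def)

lemma smooth_vf_on_open: "smooth_vf_on M U X \<Longrightarrow> open U"
  by (simp add: smooth_vf_on_def)

text \<open>In another chart \<open>e\<close> the components of the field are a directional
  derivative of the transition map from \<open>c\<close> to \<open>e\<close>.\<close>

lemma smooth_vf_on_coord_field:
  assumes "c \<in> atlas M"
  shows "smooth_vf_on M (fst c) (coord_field M c a)"
  unfolding smooth_vf_on_def
proof (intro conjI ballI)
  fix e assume e: "e \<in> atlas M"
  note cp = chart_props[OF atlas_is_chart[OF assms]]
  let ?W = "fst e \<inter> fst c"
  have W: "open ?W" using open_chart_dom e assms by blast
  show "smooth_fun_on M ?W (\<lambda>q. to_chart M e q (coord_field M c a q))"
  proof (rule smooth_fun_onI_chart[OF assms W])
    have op: "open (snd c ` ?W)"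
      using open_chart_image[OF atlas_is_chart[OF assms] open_chart_dom[OF e]] by (simp add:
          Int_commute)
    have "smooth_on (snd c ` ?W) (\<lambda>s. frechet_derivative (snd e \<circ> cinv c) (at s) a)"
      by (rule smooth_on_frechet_derivative)
         (use smooth_on_chart_change[OF assms e] in \<open>simp add: Int_commute\<close>)
    then show "smooth_on (snd c ` ?W) ((\<lambda>q. to_chart M e q (coord_field M c a q)) \<circ> cinv c)"
      by (rule smooth_on_cong[OF op, rotated])
         (use cp e assms in \<open>auto simp: to_chart_eq coord_field_eq chart_change_deriv_trans
           chart_at_atlas, simp_all add: chart_change_deriv_def\<close>)
  qed simp
qed (use open_chart_dom assms in simp)

lemma smooth_vf_on_subset:
  "smooth_vf_on M U X \<Longrightarrow> open V \<Longrightarrow> V \<subseteq> U \<Longrightarrow> smooth_vf_on M V X"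
  unfolding smooth_vf_on_def
  by (metis smooth_fun_on_subset Int_mono order_refl open_Int open_chart_dom)

lemma smooth_vf_on_cong:
  "(\<And>q. q \<in> U \<Longrightarrow> X q = Y q) \<Longrightarrow> smooth_vf_on M U X \<Longrightarrow> smooth_vf_on M U Y"
  unfolding smooth_vf_on_def
proof (intro conjI ballI)
  fix c assume eq: "\<And>q. q \<in> U \<Longrightarrow> X q = Y q" and c: "c \<in> atlas M"
    and X: "open U \<and> (\<forall>c\<in>atlas M. smooth_fun_on M (fst c \<inter> U) (\<lambda>q. to_chart M c q (X q)))"
  show "smooth_fun_on M (fst c \<inter> U) (\<lambda>q. to_chart M c q (Y q))"
    by (rule smooth_fun_on_cong[where f = "\<lambda>q. to_chart M c q (X q)"]) (use eq X c in auto)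
qed simp

lemma smooth_vf_on_local:
  assumes "open U" "\<And>q. q \<in> U \<Longrightarrow> \<exists>V. q \<in> V \<and> smooth_vf_on M V X"
  shows "smooth_vf_on M U X"
  unfolding smooth_vf_on_def
proof (intro conjI ballI)
  fix c assume c: "c \<in> atlas M"
  show "smooth_fun_on M (fst c \<inter> U) (\<lambda>q. to_chart M c q (X q))"
  proof (rule smooth_fun_on_local)
    fix q assume "q \<in> fst c \<inter> U"
    then obtain V where "q \<in> V" "smooth_vf_on M V X" using assms(2) by blast
    then show "\<exists>V. q \<in> V \<and> smooth_fun_on M V (\<lambda>q. to_chart M c q (X q))"
      using \<open>q \<in> fst c \<inter> U\<close> smooth_vf_on_to_chart c by blast
  qed (simp add: c assms(1) open_chart_dom open_Int)
qed (use assms in simp)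

lemma smooth_vf_on_scaleR:
  assumes "smooth_fun_on M U f" "smooth_vf_on M U X"
  shows "smooth_vf_on M U (\<lambda>q. f q *\<^sub>R X q)"
  unfolding smooth_vf_on_def
proof (intro conjI ballI)
  fix c assume c: "c \<in> atlas M"
  have op: "open (fst c \<inter> U)" using assms(2) c by (simp add: open_chart_dom smooth_vf_on_open open_Int)
  show "smooth_fun_on M (fst c \<inter> U) (\<lambda>q. to_chart M c q (f q *\<^sub>R X q))"
    by (rule smooth_fun_on_cong[OF _ smooth_fun_on_scaleR[OF smooth_fun_on_subset[OF assms(1) op]
            smooth_vf_on_to_chart[OF assms(2) c]]])
       (use c in \<open>auto simp: linear_cmul[OF to_chart_linear]\<close>)
qed (use assms smooth_vf_on_open in blast)

lemma smooth_vf_on_zero: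
  assumes "open U" shows "smooth_vf_on M U (\<lambda>q. 0)"
  unfolding smooth_vf_on_def
proof (intro conjI ballI)
  fix c assume c: "c \<in> atlas M"
  show "smooth_fun_on M (fst c \<inter> U) (\<lambda>q. to_chart M c q 0)"
    by (rule smooth_fun_on_cong[OF _ smooth_fun_on_const[of _ 0]])
       (auto simp: linear_0[OF to_chart_linear] c assms open_chart_dom open_Int)
qed (rule assms)

lemma smooth_vf_on_add:
  assumes "smooth_vf_on M U X" "smooth_vf_on M U Y"
  shows "smooth_vf_on M U (\<lambda>q. X q + Y q)"
  unfolding smooth_vf_on_def
proof (intro conjI ballI)
  fix c assume c: "c \<in> atlas M"
  have op: "open (fst c \<inter> U)" using assms(2) c by (simp add: open_chart_dom smooth_vf_on_open open_Int)
  have "smooth_fun_on M (fst c \<inter> U) (\<lambda>q. to_chart M c q (X q) + to_chart M c q (Y q))"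
    by (intro smooth_fun_on_add smooth_vf_on_to_chart assms c)
  then show "smooth_fun_on M (fst c \<inter> U) (\<lambda>q. to_chart M c q (X q + Y q))"
    by (rule smooth_fun_on_cong[rotated])
       (use c in \<open>auto simp: linear_add[OF to_chart_linear]\<close>)
qed (use assms smooth_vf_on_open in blast)

lemma smooth_vf_on_sum:
  "open U \<Longrightarrow> (\<And>i. i \<in> A \<Longrightarrow> smooth_vf_on M U (X i)) \<Longrightarrow> smooth_vf_on M U (\<lambda>q. \<Sum>i\<in>A. X i q)"
  by (induction A rule: infinite_finite_induct) (auto intro: smooth_vf_on_zero smooth_vf_on_add)

section \<open>Coordinate functions, cutoffs and globally defined fields\<close>

lemma smooth_fun_on_coordinate:
  assumes "c \<in> atlas M" "bounded_linear L"
  shows "smooth_fun_on M (fst c) (\<lambda>q. L (snd c q))"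
proof (rule smooth_fun_onI_chart[OF assms(1)])
  note cp = chart_props[OF atlas_is_chart[OF assms(1)]]
  show "smooth_on (snd c ` fst c) ((\<lambda>q. L (snd c q)) \<circ> cinv c)"
    by (rule smooth_on_cong[OF cp(2) _ smooth_on_linear[OF cp(2) assms(2)]]) (use cp in auto)
qed (use open_chart_dom assms in auto)

text \<open>Turns coordinate fields, which are smooth only on a chart, into global fields with the
  same value at \<open>p\<close>; both the Kenmotsu identity and the equality criterion speak of
  global fields.\<close>

lemma cutoff_function_exists:
  assumes "c \<in> atlas M" "p \<in> fst c"
  shows "\<exists>\<psi> :: 'a \<Rightarrow> real. \<exists>C. smooth_fun_on M (fst c) \<psi> \<and> \<psi> p = 1 \<and> closed C \<and> C \<subseteq> fst c \<and>
    (\<forall>q. q \<notin> C \<longrightarrow> \<psi> q = 0)"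
proof -
  note cp = chart_props[OF atlas_is_chart[OF assms(1)]]
  obtain r where r: "0 < r" "cball (snd c p) r \<subseteq> snd c ` fst c"
    using cp(2) assms(2) open_contains_cball by blast
  obtain b :: "'e \<Rightarrow> real" where b: "smooth_on UNIV b" "b (snd c p) = 1"
    "\<And>s. s \<notin> cball (snd c p) r \<Longrightarrow> b s = 0"
    using bump_function_exists[OF r(1), of "snd c p"] by blast
  define C where "C = cinv c ` cball (snd c p) r"
  define \<psi> where "\<psi> = (\<lambda>q. if q \<in> fst c then b (snd c q) else 0)"
  \<comment> \<open>Compactness makes \<open>C\<close> closed because the manifold is Hausdorff;
    closedness is what makes extension by zero smooth.\<close>
  have "compact C" unfolding C_def
    by (rule compact_continuous_image[OF continuous_on_subset[OF cp(8) r(2)] compact_cball])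
  moreover have "C \<subseteq> fst c" unfolding C_def using cp(5) r(2) by blast
  moreover have "\<psi> q = 0" if "q \<notin> C" for q
    using that b(3)[of "snd c q"] cp(4)[of q] unfolding \<psi>_def C_def by force
  moreover have "smooth_fun_on M (fst c) \<psi>"
  proof (rule smooth_fun_onI_chart[OF assms(1)])
    show "smooth_on (snd c ` fst c) (\<psi> \<circ> cinv c)"
      by (rule smooth_on_cong[OF cp(2) _ smooth_on_subset[OF b(1) subset_UNIV]])
         (use cp in \<open>auto simp: \<psi>_def\<close>)
  qed (use open_chart_dom assms in auto)
  ultimately show ?thesis
    using assms(2) b(2) compact_imp_closed by (intro exI[of _ \<psi>] exI[of _ C]) (auto simp: \<psi>_def)
qed

text \<open>The open sets \<open>U\<close> and \<open>- C\<close> cover the manifold, and the field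
  is smooth on each.\<close>

lemma smooth_vf_on_extend_by_zero:
  assumes "smooth_vf_on M U X" "closed C" "C \<subseteq> U" "\<And>q. q \<notin> C \<Longrightarrow> X q = 0"
  shows "smooth_vf_on M UNIV X"
proof (rule smooth_vf_on_local)
  fix q
  have "smooth_vf_on M (- C) X"
    by (rule smooth_vf_on_cong[OF _ smooth_vf_on_zero]) (use assms in auto)
  then show "\<exists>V. q \<in> V \<and> smooth_vf_on M V X" using assms by (cases "q \<in> C") auto
qed simp

lemma cutoff_coord_field_smooth:
  assumes "c \<in> atlas M" "smooth_fun_on M (fst c) \<psi>" "closed C" "C \<subseteq> fst c"
    "\<And>q. q \<notin> C \<Longrightarrow> \<psi> q = 0"
  shows "smooth_vf_on M UNIV (\<lambda>q. \<psi> q *\<^sub>R coord_field M c a q)"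
  by (rule smooth_vf_on_extend_by_zero[OF smooth_vf_on_scaleR[OF assms(2)
          smooth_vf_on_coord_field[OF assms(1)]] assms(3,4)]) (simp add: assms)

end

subsection \<open>Connections and the Kenmotsu identity\<close>

lemma dir_deriv_const [simp]: "dir_deriv M p v (\<lambda>q. k) = 0"
  by (simp add: dir_deriv_def o_def)

lemma dir_deriv_cong:
  assumes "smooth_manifold M" "open U" "p \<in> U" "\<And>q. q \<in> U \<Longrightarrow> f q = h q"
  shows "dir_deriv M p v f = dir_deriv M p v h"
proof -
  let ?c = "chart_at M p"
  note c = chart_props[OF atlas_is_chart[OF assms(1) chart_at_atlas(1)[OF assms(1)]]]
  have "frechet_derivative (f \<circ> cinv ?c) (at (snd ?c p))
      = frechet_derivative (h \<circ> cinv ?c) (at (snd ?c p))"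
    by (rule frechet_derivative_cong_open[OF open_chart_image[OF
          atlas_is_chart[OF assms(1) chart_at_atlas(1)[OF assms(1)]] assms(2)]])
       (use assms c chart_at_atlas(2)[OF assms(1)] in auto)
  then show ?thesis by (simp add: dir_deriv_def)
qed

lemma dir_deriv_has_derivative:
  assumes "smooth_manifold M" "smooth_fun_on M U f" "p \<in> U"
  shows "((f \<circ> cinv (chart_at M p)) has_derivative (\<lambda>v. dir_deriv M p v f))
    (at (snd (chart_at M p) p))"
  using smooth_fun_on_differentiable[OF assms(1,2) chart_at_atlas[OF assms(1)] assms(3)]
  by (simp add: dir_deriv_def frechet_derivative_works)

lemma dir_deriv_bounded_linear:
  assumes "smooth_manifold M" "smooth_fun_on M U f" "p \<in> U" "bounded_linear L"
  shows "dir_deriv M p v (\<lambda>q. L (f q)) = L (dir_deriv M p v f)"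
  using frechet_derivative_at[OF bounded_linear.has_derivative[OF assms(4)
      dir_deriv_has_derivative[OF assms(1-3)]]]
  by (simp add: dir_deriv_def o_def) metis

text \<open>The Christoffel symbols at \<open>p\<close> in the preferred chart, as a vector-valued
  map instead of an array: the coordinate fields are differentiated along \<open>v\<close> and
  combined with the components of \<open>w\<close>.\<close>

definition christoffel :: "('a, 'e::euclidean_space) mfd \<Rightarrow> ('a, 'e) connection \<Rightarrow> 'a \<Rightarrow> 'e \<Rightarrow> 'e \<Rightarrow> 'e"
    where
  "christoffel N cd p v w = (\<Sum>i\<in>Basis. (w \<bullet> i) *\<^sub>R cd p v (coord_field N (chart_at N p) i))"

lemma christoffel_Basis:
  assumes "i \<in> Basis"
  shows "christoffel N cd p v i = cd p v (coord_field N (chart_at N p) i)"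
proof -
  have "christoffel N cd p v i
      = (\<Sum>j\<in>Basis. if j = i then cd p v (coord_field N (chart_at N p) j) else 0)"
    unfolding christoffel_def by (rule sum.cong) (use assms in \<open>auto simp: inner_Basis\<close>)
  then show ?thesis using assms by simp
qed

lemma christoffel_linear: "linear (christoffel N cd p v)"
  unfolding christoffel_def
  by (rule linearI) (simp_all add: inner_add_left scaleR_add_left sum.distrib scaleR_sum_right)

section \<open>Affine connections in a chart\<close>

context
  fixes N :: "('a::{t2_space,second_countable_topology}, 'e::euclidean_space) mfd"
    and cd :: "('a, 'e) connection"
  assumes N: "smooth_manifold N" and cd: "affine_connection N cd"
begin

lemma cd_linear:
  assumes "smooth_vf_on N U Y" "p \<in> U"
  shows "linear (\<lambda>v. cd p v Y)"
proof -
  have "\<forall>U Y. smooth_vf_on N U Y \<longrightarrow> (\<forall>p\<in>U. linear (\<lambda>v. cd p v Y))"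
    using cd unfolding affine_connection_def by (elim conjE)
  then show ?thesis using assms by simp
qed

lemma cd_add:
  assumes "smooth_vf_on N U Y" "smooth_vf_on N U Z" "p \<in> U"
  shows "cd p v (\<lambda>q. Y q + Z q) = cd p v Y + cd p v Z"
proof -
  have "\<forall>U Y Z. smooth_vf_on N U Y \<and> smooth_vf_on N U Z \<longrightarrow>
        (\<forall>p\<in>U. \<forall>v. cd p v (\<lambda>q. Y q + Z q) = cd p v Y + cd p v Z)"
    using cd unfolding affine_connection_def by (elim conjE)
  then show ?thesis using assms by simp
qed

lemma cd_scaleR:
  assumes "smooth_fun_on N U f" "smooth_vf_on N U Y" "p \<in> U"
  shows "cd p v (\<lambda>q. f q *\<^sub>R Y q) = dir_deriv N p v f *\<^sub>R Y p + f p *\<^sub>R cd p v Y"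
proof -
  have "\<forall>U f Y. smooth_fun_on N U (f :: 'a \<Rightarrow> real) \<and> smooth_vf_on N U Y \<longrightarrow>
      (\<forall>p\<in>U. \<forall>v. cd p v (\<lambda>q. f q *\<^sub>R Y q) = dir_deriv N p v f *\<^sub>R Y p + f p *\<^sub>R cd p v Y)"
    using cd unfolding affine_connection_def by (elim conjE)
  then show ?thesis using assms by simp
qed

lemma cd_zero: "cd p v (\<lambda>q. 0) = 0"
  using cd_add[OF smooth_vf_on_zero[OF N open_UNIV] smooth_vf_on_zero[OF N open_UNIV], of p v] by simp

text \<open>The indicator function of \<open>U\<close> is smooth on \<open>U\<close>, so the Leibniz rule alone gives locality.\<close>
lemma cd_local:
  assumes "smooth_vf_on N U Y" "smooth_vf_on N U Z" "p \<in> U" "\<And>q. q \<in> U \<Longrightarrow> Y q = Z q"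
  shows "cd p v Y = cd p v Z"
proof -
  define \<psi> where "\<psi> = (\<lambda>q. if q \<in> U then 1 else (0::real))"
  have U: "open U" using smooth_vf_on_open[OF N assms(1)] .
  have \<psi>: "smooth_fun_on N U \<psi>"
    by (rule smooth_fun_on_cong[OF N _ smooth_fun_on_const[OF N U, of 1]]) (simp add: \<psi>_def)
  have "dir_deriv N p v \<psi> = dir_deriv N p v (\<lambda>q. 1 :: real)"
    by (rule dir_deriv_cong[OF N U assms(3)]) (simp add: \<psi>_def)
  then have d: "dir_deriv N p v \<psi> = 0" by simp
  have "(\<lambda>q. \<psi> q *\<^sub>R Y q) = (\<lambda>q. \<psi> q *\<^sub>R Z q)" using assms(4) by (auto simp: \<psi>_def)
  then show ?thesis
    using cd_scaleR[OF \<psi> assms(1,3), of v] cd_scaleR[OF \<psi> assms(2,3), of v] d assms(3)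
    by (simp add: \<psi>_def)
qed

lemma cd_sum:
  assumes "open U" "\<And>i. i \<in> A \<Longrightarrow> smooth_fun_on N U (f i)" "\<And>i. i \<in> A \<Longrightarrow> smooth_vf_on N U (Y i)"
    "p \<in> U" "finite A"
  shows "cd p v (\<lambda>q. \<Sum>i\<in>A. f i q *\<^sub>R Y i q)
    = (\<Sum>i\<in>A. dir_deriv N p v (f i) *\<^sub>R Y i p + f i p *\<^sub>R cd p v (Y i))"
  using assms(5,2,3)
proof (induction A rule: finite_induct)
  case empty
  show ?case by (simp add: cd_zero)
next
  case (insert a A)
  have "smooth_vf_on N U (\<lambda>q. f a q *\<^sub>R Y a q)"
    by (rule smooth_vf_on_scaleR[OF N]) (use insert.prems in auto)
  moreover have "smooth_vf_on N U (\<lambda>q. \<Sum>i\<in>A. f i q *\<^sub>R Y i q)"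
    by (intro smooth_vf_on_sum[OF N assms(1)] smooth_vf_on_scaleR[OF N]) (use insert.prems in auto)
  ultimately show ?case
    using insert cd_add[OF _ _ assms(4), of "\<lambda>q. f a q *\<^sub>R Y a q" "\<lambda>q. \<Sum>i\<in>A. f i q *\<^sub>R Y i q" v]
      cd_scaleR[of U "f a" "Y a" p v] assms(4) by simp
qed

lemma cd_in_chart:
  assumes "smooth_vf_on N U Y" "p \<in> U"
  shows "cd p v Y = dir_deriv N p v (\<lambda>q. to_chart N (chart_at N p) q (Y q)) + christoffel N cd p v
      (Y p)"
proof -
  let ?c = "chart_at N p"
  note c = chart_at_atlas[OF N, of p]
  define W where "W = fst ?c \<inter> U"
  have W: "open W" "p \<in> W"
    using open_chart_dom[OF N c(1)] c(2) assms smooth_vf_on_open[OF N assms(1)]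
    by (auto simp: W_def)
  define Y' where "Y' = (\<lambda>q. to_chart N ?c q (Y q))"
  have Y': "smooth_fun_on N W Y'"
    unfolding W_def Y'_def by (rule smooth_vf_on_to_chart[OF N assms(1) c(1)])
  have Y'i: "smooth_fun_on N W (\<lambda>q. Y' q \<bullet> i)" for i
    by (rule smooth_fun_on_bounded_linear[OF N bounded_linear_inner_left Y'])
  have A: "smooth_vf_on N W (coord_field N ?c i)" for i
    by (rule smooth_vf_on_subset[OF N smooth_vf_on_coord_field[OF N c(1)] W(1)]) (simp add: W_def)
  have YW: "smooth_vf_on N W Y"
    by (rule smooth_vf_on_subset[OF N assms(1) W(1)]) (simp add: W_def)
  \<comment> \<open>The expansion in coordinate fields is valid only on the chart domain, so
    locality of \<open>cd\<close> is needed before the Leibniz rule can be applied.\<close>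
  have "cd p v Y = cd p v (\<lambda>q. \<Sum>i\<in>Basis. (Y' q \<bullet> i) *\<^sub>R coord_field N ?c i q)"
    by (rule cd_local[OF YW smooth_vf_on_sum[OF N W(1) smooth_vf_on_scaleR[OF N Y'i A]] W(2)])
       (use coord_field_expansion[OF N c(1)] in \<open>simp add: Y'_def W_def\<close>)
  also have "\<dots> = (\<Sum>i\<in>Basis. dir_deriv N p v (\<lambda>q. Y' q \<bullet> i) *\<^sub>R coord_field N ?c i p
      + (Y' p \<bullet> i) *\<^sub>R cd p v (coord_field N ?c i))"
    by (rule cd_sum[OF W(1) Y'i A W(2)]) simp
  also have "\<dots> = (\<Sum>i\<in>Basis. (dir_deriv N p v Y' \<bullet> i) *\<^sub>R i + (Y p \<bullet> i) *\<^sub>R cd p v (coord_field N ?c i))"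
    using dir_deriv_bounded_linear[OF N Y' W(2) bounded_linear_inner_left]
    by (simp add: coord_field_chart_at[OF N] Y'_def to_chart_chart_at[OF N])
  finally show ?thesis
    by (simp add: sum.distrib euclidean_representation christoffel_def Y'_def)
qed

lemma christoffel_linear_left: "linear (\<lambda>v. christoffel N cd p v w)"
proof -
  have "linear (\<lambda>v. cd p v (coord_field N (chart_at N p) i))" for i
    using cd_linear[OF smooth_vf_on_coord_field[OF N chart_at_atlas(1)[OF N]] chart_at_atlas(2)[OF N]] .
  then show ?thesis
    unfolding christoffel_def by (intro linear_compose_sum ballI linear_compose_scale_right)
qed

text \<open>Torsion-freeness is stated through its action on functions, so it is tested on the
  coordinate functions, which separate tangent vectors. Symmetry on \<open>Basis\<close> then
  extends by bilinearity.\<close>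

lemma christoffel_symmetric:
  assumes "torsion_free N cd"
  shows "christoffel N cd p v w = christoffel N cd p w v"
proof -
  let ?c = "chart_at N p" and ?A = "coord_field N (chart_at N p)"
  note c = chart_at_atlas[OF N, of p]
  note cp = chart_props[OF atlas_is_chart[OF N c(1)]]
  have dc: "dir_deriv N q (?A a q) (\<lambda>q. snd ?c q \<bullet> k) = a \<bullet> k" if "q \<in> fst ?c" for q a k
  proof -
    have "((\<lambda>q. snd ?c q \<bullet> k) \<circ> cinv ?c) differentiable at (snd ?c q)"
      by (rule smooth_fun_on_differentiable[OF N smooth_fun_on_coordinate
            [OF N c(1) bounded_linear_inner_left] c(1) that that])
    then have "dir_deriv N q (?A a q) (\<lambda>q. snd ?c q \<bullet> k)
        = frechet_derivative ((\<lambda>q. snd ?c q \<bullet> k) \<circ> cinv ?c) (at (snd ?c q)) a"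
      by (rule dir_deriv_coord_field[OF N c(1) that])
    also have "\<dots> = frechet_derivative (\<lambda>t. t \<bullet> k) (at (snd ?c q)) a"
      by (rule arg_cong2[where f = "\<lambda>D a. D a", OF frechet_derivative_cong_open[OF cp(2)]])
         (use that cp in auto)
    also have "\<dots> = a \<bullet> k"
      using frechet_derivative_at[OF bounded_linear_imp_has_derivative[OF bounded_linear_inner_left]]
      by metis
    finally show ?thesis .
  qed
  have "cd p i (?A j) = cd p j (?A i)" for i j
  proof -
    have "(cd p i (?A j) - cd p j (?A i)) \<bullet> k = 0" for k
    proof -
      have "dir_deriv N p (cd p (?A i p) (?A j) - cd p (?A j p) (?A i)) (\<lambda>q. snd ?c q \<bullet> k) =
         dir_deriv N p (?A i p) (\<lambda>q. dir_deriv N q (?A j q) (\<lambda>q. snd ?c q \<bullet> k)) -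
         dir_deriv N p (?A j p) (\<lambda>q. dir_deriv N q (?A i q) (\<lambda>q. snd ?c q \<bullet> k))"
        by (rule assms[unfolded torsion_free_def, rule_format, OF _ c(2)])
           (intro conjI smooth_vf_on_coord_field[OF N c(1)]
             smooth_fun_on_coordinate[OF N c(1) bounded_linear_inner_left])
      \<comment> \<open>A coordinate field differentiates a coordinate function to a constant, so
        the outer derivatives vanish: coordinate fields commute.\<close>
      also have "\<dots> = dir_deriv N p (?A i p) (\<lambda>q. j \<bullet> k) - dir_deriv N p (?A j p) (\<lambda>q. i \<bullet> k)"
        using dir_deriv_cong[OF N open_chart_dom[OF N c(1)] c(2) dc] by presburger
      finally show ?thesis using dc[OF c(2)] by (simp add: coord_field_chart_at[OF N])
    qed
    then show ?thesis by (metis euclidean_eq_iff eq_iff_diff_eq_0 inner_zero_left)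
  qed
  then have "christoffel N cd p i j = christoffel N cd p j i" if "i \<in> Basis" "j \<in> Basis" for i j
    using that by (simp add: christoffel_Basis)
  note sym = this
  have expand: "christoffel N cd p a b
      = (\<Sum>i\<in>Basis. \<Sum>j\<in>Basis. (a \<bullet> i) *\<^sub>R (b \<bullet> j) *\<^sub>R christoffel N cd p i j)" for a b
  proof -
    have "christoffel N cd p a b = (\<Sum>i\<in>Basis. (a \<bullet> i) *\<^sub>R christoffel N cd p i b)"
      by (rule linear_sum_Basis[OF christoffel_linear_left])
    also have "\<dots> = (\<Sum>i\<in>Basis. (a \<bullet> i) *\<^sub>R (\<Sum>j\<in>Basis. (b \<bullet> j) *\<^sub>R christoffel N cd p i j))"
      using linear_sum_Basis[OF christoffel_linear, of N cd p _ b] by presburger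
    finally show ?thesis by (simp add: scaleR_sum_right)
  qed
  have "christoffel N cd p v w
      = (\<Sum>i\<in>Basis. \<Sum>j\<in>Basis. (v \<bullet> i) *\<^sub>R (w \<bullet> j) *\<^sub>R christoffel N cd p i j)"
    by (rule expand)
  also have "\<dots> = (\<Sum>i\<in>Basis. \<Sum>j\<in>Basis. (w \<bullet> j) *\<^sub>R (v \<bullet> i) *\<^sub>R christoffel N cd p j i)"
    by (intro sum.cong refl) (simp only: sym scaleR_left_commute)
  also have "\<dots> = (\<Sum>j\<in>Basis. \<Sum>i\<in>Basis. (w \<bullet> j) *\<^sub>R (v \<bullet> i) *\<^sub>R christoffel N cd p j i)"
    by (rule sum.swap)
  also have "\<dots> = christoffel N cd p w v"
    by (rule expand[symmetric])
  finally show ?thesis .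
qed

lemma metric_derivative_coord_field:
  assumes "metric_connection N g cd" "i \<in> Basis" "j \<in> Basis"
  shows "dir_deriv N p v (\<lambda>q. g q (coord_field N (chart_at N p) i q) (coord_field N (chart_at N p) j q))
    = g p (christoffel N cd p v i) j + g p i (christoffel N cd p v j)"
  using assms(1)[unfolded metric_connection_def, rule_format,
      OF conjI[OF smooth_vf_on_coord_field smooth_vf_on_coord_field],
      OF N chart_at_atlas(1)[OF N] N chart_at_atlas(1)[OF N] chart_at_atlas(2)[OF N]]
  by (simp add: christoffel_Basis assms(2,3) coord_field_chart_at[OF N])

end

section \<open>Algebra of almost contact metric structures\<close>

context
  fixes N :: "('a::{t2_space,second_countable_topology}, 'e::euclidean_space) mfd"
    and \<phi> \<xi> \<eta> g
  assumes acm: "almost_contact_metric N \<phi> \<xi> \<eta> g"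
begin

lemma acm_basics:
  shows "linear (\<phi> p)" "linear (\<eta> p)" "bilinear (g p)" "g p u v = g p v u"
    "u \<noteq> 0 \<Longrightarrow> g p u u > 0" "\<phi> p (\<phi> p v) = - v + \<eta> p v *\<^sub>R \<xi> p" "\<eta> p (\<xi> p) = 1"
    "g p (\<phi> p u) (\<phi> p v) = g p u v - \<eta> p u * \<eta> p v"
    "smooth_manifold N"
  using acm unfolding almost_contact_metric_def riemannian_manifold_def riemannian_metric_def
    tensor_1_1_def one_form_def by simp_all

lemma acm_metric_linear: "linear (g p u)" "linear (\<lambda>u. g p u v)"
  using acm_basics(3) unfolding bilinear_def by auto

text \<open>\<phi>^2 kills \<xi>, so evaluating \<phi>^2 at \<phi>\<xi> shows that \<phi>\<xi> is
  the multiple \<eta>(\<phi>\<xi>) of \<xi>. One more \<phi> gives 0 = \<eta>(\<phi>\<xi>)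
  \<phi>\<xi>, and either factor being zero makes \<phi>\<xi> zero.\<close>

lemma phi_xi: "\<phi> p (\<xi> p) = 0"
proof -
  have 1: "\<phi> p (\<phi> p (\<xi> p)) = 0" by (simp add: acm_basics)
  have 2: "\<phi> p (\<xi> p) = \<eta> p (\<phi> p (\<xi> p)) *\<^sub>R \<xi> p"
    using acm_basics(6)[of p "\<phi> p (\<xi> p)"] 1 linear_0[OF acm_basics(1)] by simp
  then have "0 = \<eta> p (\<phi> p (\<xi> p)) *\<^sub>R \<phi> p (\<xi> p)"
    using 1 linear_cmul[OF acm_basics(1)] by metis
  then show ?thesis using 2 by force
qed

text \<open>\<phi>^3 is computed in two ways, as \<phi> of \<phi>^2 and as \<phi>^2 of \<phi>; the
  difference is \<eta>(\<phi> v) \<xi>.\<close>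

lemma eta_phi: "\<eta> p (\<phi> p v) = 0"
proof -
  have "\<phi> p (\<phi> p (\<phi> p v)) = - \<phi> p v"
    by (simp only: acm_basics(6)[of p v])
       (simp only: linear_add[OF acm_basics(1)] linear_neg[OF acm_basics(1)] linear_cmul[OF
           acm_basics(1)] phi_xi scaleR_zero_right add_0_right)
  then have "\<eta> p (\<phi> p v) *\<^sub>R \<xi> p = 0" using acm_basics(6)[of p "\<phi> p v"] by simp
  moreover have "\<xi> p \<noteq> 0" using acm_basics(7)[of p] linear_0[OF acm_basics(2)] by force
  ultimately show ?thesis by simp
qed

lemma metric_xi: "g p v (\<xi> p) = \<eta> p v"
  using acm_basics(8)[of p v "\<xi> p"]
  by (simp add: phi_xi acm_basics(7) linear_0[OF acm_metric_linear(1)])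

text \<open>Metric compatibility with \<open>\<phi> p v\<close> in the second slot; the \<xi>-term
  of \<phi>^2 disappears because \<eta> vanishes on the image of \<phi>.\<close>

lemma phi_skew: "g p (\<phi> p u) v = - g p u (\<phi> p v)"
proof -
  have "g p (\<phi> p u) (\<phi> p (\<phi> p v)) = g p u (\<phi> p v)"
    by (subst acm_basics(8)) (simp add: eta_phi)
  then show ?thesis
    by (simp add: acm_basics(6) linear_add[OF acm_metric_linear(1)] linear_neg[OF acm_metric_linear(1)]
         linear_cmul[OF acm_metric_linear(1)] linear_diff[OF acm_metric_linear(1)] metric_xi eta_phi)
qed

lemma smooth_vf_on_phi:
  "smooth_vf_on N U X \<Longrightarrow> smooth_vf_on N U (\<lambda>p. \<phi> p (X p))"
  using acm unfolding almost_contact_metric_def tensor_1_1_def by simp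

lemma smooth_vf_on_xi: "smooth_vf_on N UNIV \<xi>"
  using acm unfolding almost_contact_metric_def by blast

end

section \<open>The Kenmotsu identity at a point and the derivative of the Reeb field\<close>

context
  fixes N :: "('a::{t2_space,second_countable_topology}, 'e::euclidean_space) mfd"
    and \<phi> \<xi> \<eta> g cd
  assumes lc: "levi_civita N g cd" and ken: "kenmotsu N \<phi> \<xi> \<eta> g cd"
begin

lemma kenmotsu_acm: "almost_contact_metric N \<phi> \<xi> \<eta> g"
  using ken by (simp add: kenmotsu_def)

lemma kenmotsu_connection: "smooth_manifold N" "affine_connection N cd" "torsion_free N cd"
    "metric_connection N g cd"
  using acm_basics(9)[OF kenmotsu_acm] lc by (simp_all add: levi_civita_def)

text \<open>The direction need only be a vector: a cutoff coordinate field is a global field with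
  value \<open>v\<close> at \<open>p\<close>.\<close>

lemma kenmotsu_at:
  assumes "smooth_vf_on N UNIV Y"
  shows "cd p v (\<lambda>q. \<phi> q (Y q)) - \<phi> p (cd p v Y) = g p (\<phi> p v) (Y p) *\<^sub>R \<xi> p - \<eta> p (Y p) *\<^sub>R \<phi> p v"
proof -
  note N = kenmotsu_connection(1)
  note c = chart_at_atlas[OF N, of p]
  obtain \<psi> :: "'a \<Rightarrow> real" and C where \<psi>: "smooth_fun_on N (fst (chart_at N p)) \<psi>" "\<psi> p = 1"
    "closed C" "C \<subseteq> fst (chart_at N p)" "\<And>q. q \<notin> C \<Longrightarrow> \<psi> q = 0"
    using cutoff_function_exists[OF N c] by blast
  define X where "X = (\<lambda>q. \<psi> q *\<^sub>R coord_field N (chart_at N p) v q)"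
  have "smooth_vf_on N UNIV X"
    unfolding X_def by (rule cutoff_coord_field_smooth[OF N c(1) \<psi>(1,3,4,5)])
  moreover have "X p = v" by (simp add: X_def \<psi>(2) coord_field_chart_at[OF N])
  moreover have "\<forall>X Y. smooth_vf_on N UNIV X \<and> smooth_vf_on N UNIV Y \<longrightarrow>
        (\<forall>p. cd p (X p) (\<lambda>q. \<phi> q (Y q)) - \<phi> p (cd p (X p) Y) =
             g p (\<phi> p (X p)) (Y p) *\<^sub>R \<xi> p - \<eta> p (Y p) *\<^sub>R \<phi> p (X p))"
    using ken unfolding kenmotsu_def by (elim conjE)
  ultimately show ?thesis using assms by auto
qed

text \<open>The second field may be a local coordinate field: cutting it off by
  \<open>\<psi>\<close> adds the same term, the derivative of \<open>\<psi>\<close> times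
  \<open>\<phi> p a\<close>, to both covariant derivatives, and it cancels in their
  difference.\<close>

lemma kenmotsu_coord_field:
  "cd p v (\<lambda>q. \<phi> q (coord_field N (chart_at N p) a q))
    = \<phi> p (cd p v (coord_field N (chart_at N p) a)) + g p (\<phi> p v) a *\<^sub>R \<xi> p - \<eta> p a *\<^sub>R \<phi> p v"
proof -
  note N = kenmotsu_connection(1)
  note c = chart_at_atlas[OF N, of p]
  note lin = acm_basics(1)[OF kenmotsu_acm]
  let ?A = "coord_field N (chart_at N p) a"
  obtain \<psi> :: "'a \<Rightarrow> real" and C where \<psi>: "smooth_fun_on N (fst (chart_at N p)) \<psi>" "\<psi> p = 1"
    "closed C" "C \<subseteq> fst (chart_at N p)" "\<And>q. q \<notin> C \<Longrightarrow> \<psi> q = 0"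
    using cutoff_function_exists[OF N c] by blast
  note A = smooth_vf_on_coord_field[OF N c(1), of a]
  have "cd p v (\<lambda>q. \<phi> q (\<psi> q *\<^sub>R ?A q)) - \<phi> p (cd p v (\<lambda>q. \<psi> q *\<^sub>R ?A q))
    = g p (\<phi> p v) a *\<^sub>R \<xi> p - \<eta> p a *\<^sub>R \<phi> p v"
    using kenmotsu_at[OF cutoff_coord_field_smooth[OF N c(1) \<psi>(1,3,4,5)], of p v a]
    by (simp add: \<psi>(2) coord_field_chart_at[OF N])
  moreover have "cd p v (\<lambda>q. \<phi> q (\<psi> q *\<^sub>R ?A q))
      = dir_deriv N p v \<psi> *\<^sub>R \<phi> p a + cd p v (\<lambda>q. \<phi> q (?A q))"
    using cd_scaleR[OF N kenmotsu_connection(2) \<psi>(1) smooth_vf_on_phi[OF kenmotsu_acm A] c(2), of v]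
    by (simp add: linear_cmul[OF lin] \<psi>(2) coord_field_chart_at[OF N])
  moreover have "\<phi> p (cd p v (\<lambda>q. \<psi> q *\<^sub>R ?A q))
      = dir_deriv N p v \<psi> *\<^sub>R \<phi> p a + \<phi> p (cd p v ?A)"
    using cd_scaleR[OF N kenmotsu_connection(2) \<psi>(1) A c(2), of v]
    by (simp add: linear_cmul[OF lin] linear_add[OF lin] \<psi>(2) coord_field_chart_at[OF N])
  ultimately show ?thesis by (simp add: algebra_simps)
qed

text \<open>The identity for the constant-length field \<xi> reads \<phi>(\<nabla>\<xi>) = \<phi> v,
  since \<phi>\<xi> = 0. As \<phi> determines a vector up to its \<xi>-component, only that
  component remains, and it is 0 because \<xi> is a unit field.\<close>

lemma cd_xi: "cd p v \<xi> = v - \<eta> p v *\<^sub>R \<xi> p"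
proof -
  note acm = kenmotsu_acm
  note N = kenmotsu_connection(1)
  note lin = acm_basics(1)[OF acm]
  have "\<phi> p (cd p v \<xi>) = \<phi> p v"
    using kenmotsu_at[OF smooth_vf_on_xi[OF acm], of p v]
    by (simp add: phi_xi[OF acm] cd_zero[OF N kenmotsu_connection(2)] acm_basics(7)[OF acm]
        metric_xi[OF acm] eta_phi[OF acm])
  then have eq: "- cd p v \<xi> + \<eta> p (cd p v \<xi>) *\<^sub>R \<xi> p = - v + \<eta> p v *\<^sub>R \<xi> p"
    using acm_basics(6)[OF acm] by metis
  have "dir_deriv N p v (\<lambda>q. g q (\<xi> q) (\<xi> q)) = g p (cd p v \<xi>) (\<xi> p) + g p (\<xi> p) (cd p v \<xi>)"
    using kenmotsu_connection(4) smooth_vf_on_xi[OF acm] unfolding metric_connection_def by simp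
  then have "\<eta> p (cd p v \<xi>) = 0"
    using acm_basics(4)[OF acm, of p "\<xi> p" "cd p v \<xi>"]
    by (simp add: metric_xi[OF acm] acm_basics(7)[OF acm])
  then show ?thesis using eq by (simp add: algebra_simps)
qed

end

subsection \<open>Differentiation along an immersion\<close>

lemma bilinear_sum_Basis:
  fixes f :: "'a::euclidean_space \<Rightarrow> 'b::euclidean_space \<Rightarrow> real"
  assumes "bilinear f"
  shows "f a b = (\<Sum>i\<in>Basis. \<Sum>j\<in>Basis. (a \<bullet> i) * (b \<bullet> j) * f i j)"
proof -
  have "f a b = (\<Sum>i\<in>Basis. (a \<bullet> i) * f i b)"
    using linear_sum_Basis[of "\<lambda>a. f a b" a] assms by (simp add: bilinear_def)
  also have "\<dots> = (\<Sum>i\<in>Basis. (a \<bullet> i) * (\<Sum>j\<in>Basis. (b \<bullet> j) * f i j))"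
    using linear_sum_Basis[of "f _" b] assms by (simp add: bilinear_def)
  finally show ?thesis by (simp add: sum_distrib_left mult.assoc)
qed

definition map_deriv :: "('a, 'd::euclidean_space) chart \<Rightarrow> ('b, 'e::euclidean_space) chart \<Rightarrow>
    ('a \<Rightarrow> 'b) \<Rightarrow> 'a \<Rightarrow> 'd \<Rightarrow> 'e" where
  "map_deriv c d \<iota> q = frechet_derivative (snd d \<circ> \<iota> \<circ> cinv c) (at (snd c q))"

lemma dmap_eq: "dmap M N \<iota> q = map_deriv (chart_at M q) (chart_at N (\<iota> q)) \<iota> q"
  by (rule ext) (simp add: dmap_def dir_deriv_def map_deriv_def)

text \<open>Differentiability at the one point \<open>p\<close>, in the chart in which
  \<open>cd_along\<close> differentiates; this is all that the product rules below require of a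
  section along \<open>\<iota>\<close>.\<close>

definition differentiable_along :: "('a, 'd::euclidean_space) mfd \<Rightarrow> ('b, 'e::euclidean_space) mfd \<Rightarrow>
    ('a \<Rightarrow> 'b) \<Rightarrow> 'a \<Rightarrow> ('a \<Rightarrow> 'e) \<Rightarrow> bool" where
  "differentiable_along M N \<iota> p V \<longleftrightarrow>
     ((\<lambda>q. to_chart N (chart_at N (\<iota> p)) (\<iota> q) (V q)) \<circ> cinv (chart_at M p))
       differentiable (at (snd (chart_at M p) p))"

lemma cd_along_eq:
  "cd_along M N \<iota> cd p x V =
    dir_deriv M p x (\<lambda>q. to_chart N (chart_at N (\<iota> p)) (\<iota> q) (V q)) +
    christoffel N cd (\<iota> p) (dmap M N \<iota> p x) (V p)"
  by (simp add: cd_along_def christoffel_def Let_def)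

lemma differentiable_along_has_derivative:
  assumes "differentiable_along M N \<iota> p V"
  shows "((\<lambda>q. to_chart N (chart_at N (\<iota> p)) (\<iota> q) (V q)) \<circ> cinv (chart_at M p)
    has_derivative (\<lambda>x. cd_along M N \<iota> cd p x V - christoffel N cd (\<iota> p) (dmap M N \<iota> p x) (V p)))
    (at (snd (chart_at M p) p))"
  using assms by (simp add: cd_along_eq differentiable_along_def dir_deriv_def frechet_derivative_works)

lemma differentiable_alongI:
  assumes "((\<lambda>q. to_chart N (chart_at N (\<iota> p)) (\<iota> q) (V q)) \<circ> cinv (chart_at M p)
    has_derivative D) (at (snd (chart_at M p) p))"
  shows "differentiable_along M N \<iota> p V"
    and "cd_along M N \<iota> cd p x V = D x + christoffel N cd (\<iota> p) (dmap M N \<iota> p x) (V p)"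
  using assms frechet_derivative_at[OF assms]
  by (auto simp: cd_along_eq dir_deriv_def differentiable_along_def differentiable_def)

text \<open>The normal part of this vector is the second fundamental form.\<close>
definition cd_coord :: "('a, 'd::euclidean_space) mfd \<Rightarrow> ('b, 'e::euclidean_space) mfd \<Rightarrow>
    ('a \<Rightarrow> 'b) \<Rightarrow> ('b, 'e) connection \<Rightarrow> 'a \<Rightarrow> 'd \<Rightarrow> 'd \<Rightarrow> 'e" where
  "cd_coord M N \<iota> cd p x y =
     cd_along M N \<iota> cd p x (\<lambda>q. dmap M N \<iota> q (coord_field M (chart_at M p) y q))"

context
  fixes M :: "('a::{t2_space,second_countable_topology}, 'd::euclidean_space) mfd"
    and N :: "('b::{t2_space,second_countable_topology}, 'e::euclidean_space) mfd"
    and \<iota> :: "'a \<Rightarrow> 'b"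
  assumes M: "smooth_manifold M" and N: "smooth_manifold N" and \<iota>: "smooth_map M N \<iota>"
begin

lemma open_vimage_map: "open U \<Longrightarrow> open (\<iota> -` U)"
  using \<iota> continuous_on_open_vimage[of UNIV \<iota>] by (auto simp: smooth_map_def)

lemma open_map_chart_dom:
  assumes "c \<in> atlas M" "open U"
  shows "open (snd c ` (fst c \<inter> \<iota> -` U))"
  by (rule open_chart_image[OF atlas_is_chart[OF M assms(1)] open_vimage_map[OF assms(2)]])

lemma smooth_on_map:
  "c \<in> atlas M \<Longrightarrow> d \<in> atlas N \<Longrightarrow> smooth_on (snd c ` (fst c \<inter> \<iota> -` fst d)) (snd d \<circ> \<iota> \<circ> cinv c)"
  using \<iota> by (simp add: smooth_map_def)

lemma map_has_derivative:
  assumes "c \<in> atlas M" "d \<in> atlas N" "q \<in> fst c" "\<iota> q \<in> fst d"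
  shows "(snd d \<circ> \<iota> \<circ> cinv c has_derivative map_deriv c d \<iota> q) (at (snd c q))"
  unfolding map_deriv_def
  by (rule smooth_on_has_derivative[OF smooth_on_map[OF assms(1,2)]]) (use assms in auto)

lemma map_deriv_linear:
  "c \<in> atlas M \<Longrightarrow> d \<in> atlas N \<Longrightarrow> q \<in> fst c \<Longrightarrow> \<iota> q \<in> fst d \<Longrightarrow> linear (map_deriv c d \<iota> q)"
  using map_has_derivative has_derivative_linear by blast

lemma dmap_linear: "linear (dmap M N \<iota> q)"
  by (simp add: dmap_eq map_deriv_linear chart_at_atlas[OF M] chart_at_atlas[OF N])

lemma map_deriv_change:
  assumes "c \<in> atlas M" "c' \<in> atlas M" "d \<in> atlas N" "d' \<in> atlas N"
    and "q \<in> fst c" "q \<in> fst c'" "\<iota> q \<in> fst d" "\<iota> q \<in> fst d'"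
  shows "map_deriv c d \<iota> q a
    = chart_change_deriv d' d (\<iota> q) (map_deriv c' d' \<iota> q (chart_change_deriv c c' q a))"
proof -
  note c' = chart_props[OF atlas_is_chart[OF M assms(2)]]
    and d = chart_props[OF atlas_is_chart[OF N assms(3)]]
    and d' = chart_props[OF atlas_is_chart[OF N assms(4)]]
  have "(snd d \<circ> cinv d' has_derivative chart_change_deriv d' d (\<iota> q))
      (at ((snd d' \<circ> \<iota> \<circ> cinv c') (snd c' q)))"
    using chart_change_has_derivative[OF N assms(4,3,8,7)] c'(4)[OF assms(6)] by simp
  from diff_chain_at[OF map_has_derivative[OF assms(2,4,6,8)] this]
  have "(snd d \<circ> \<iota> \<circ> cinv c' has_derivative chart_change_deriv d' d (\<iota> q) \<circ> map_deriv c' d' \<iota> q)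
      (at (snd c' q))"
    by (rule has_derivative_transform_within_open[OF _ open_map_chart_dom[OF assms(2) open_Int[OF
        d(1) d'(1)]]])
       (use assms c' d' in auto)
  from has_derivative_chart_change[OF M assms(1,2,5,6) this]
  have "(snd d \<circ> \<iota> \<circ> cinv c has_derivative
      (\<lambda>a. chart_change_deriv d' d (\<iota> q) (map_deriv c' d' \<iota> q (chart_change_deriv c c' q a))))
      (at (snd c q))" by (simp add: o_def)
  from frechet_derivative_at[OF this] show ?thesis by (metis map_deriv_def)
qed

lemma dmap_coord_field:
  assumes "c \<in> atlas M" "d \<in> atlas N" "q \<in> fst c" "\<iota> q \<in> fst d"
  shows "dmap M N \<iota> q (coord_field M c a q) = coord_field N d (map_deriv c d \<iota> q a) (\<iota> q)"
proof -
  have "map_deriv c d \<iota> q a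
    = chart_change_deriv (chart_at N (\<iota> q)) d (\<iota> q) (dmap M N \<iota> q (coord_field M c a q))"
    using map_deriv_change[OF assms(1) chart_at_atlas(1)[OF M] assms(2) chart_at_atlas(1)[OF N]
        assms(3) chart_at_atlas(2)[OF M] assms(4) chart_at_atlas(2)[OF N]]
    by (simp add: dmap_eq coord_field_eq)
  then show ?thesis
    by (simp add: coord_field_eq[of N] chart_change_deriv_trans[OF N] chart_at_atlas[OF N] assms
        chart_change_deriv_refl[OF N])
qed

lemma pullback_has_derivative:
  assumes "smooth_fun_on N U h" "\<iota> p \<in> U"
  shows "((\<lambda>q. h (\<iota> q)) \<circ> cinv (chart_at M p) has_derivative
    (\<lambda>x. dir_deriv N (\<iota> p) (dmap M N \<iota> p x) h)) (at (snd (chart_at M p) p))"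
proof -
  let ?c = "chart_at M p" and ?d = "chart_at N (\<iota> p)"
  note c = chart_at_atlas[OF M, of p] and d = chart_at_atlas[OF N, of "\<iota> p"]
  note cp = chart_props[OF atlas_is_chart[OF M c(1)]] and dp = chart_props[OF atlas_is_chart[OF N d(1)]]
  have "(h \<circ> cinv ?d has_derivative (\<lambda>v. dir_deriv N (\<iota> p) v h))
      (at ((snd ?d \<circ> \<iota> \<circ> cinv ?c) (snd ?c p)))"
    using dir_deriv_has_derivative[OF N assms] cp(4)[OF c(2)] by simp
  from diff_chain_at[OF map_has_derivative[OF c(1) d(1) c(2) d(2)] this]
  have "((\<lambda>q. h (\<iota> q)) \<circ> cinv ?c has_derivative (\<lambda>v. dir_deriv N (\<iota> p) v h) \<circ> map_deriv ?c ?d \<iota> p)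
      (at (snd ?c p))"
    by (rule has_derivative_transform_within_open[OF _ open_map_chart_dom[OF c(1) dp(1)]])
       (use c d cp dp in auto)
  then show ?thesis by (simp add: o_def dmap_eq)
qed

lemma eventually_chart_cong_has_derivative:
  assumes "(f \<circ> cinv (chart_at M p) has_derivative D) (at (snd (chart_at M p) p))"
    and "\<And>q. q \<in> fst (chart_at M p) \<Longrightarrow> \<iota> q \<in> fst (chart_at N (\<iota> p)) \<Longrightarrow> f q = h q"
  shows "(h \<circ> cinv (chart_at M p) has_derivative D) (at (snd (chart_at M p) p))"
proof -
  note c = chart_at_atlas[OF M, of p] and d = chart_at_atlas[OF N, of "\<iota> p"]
  show ?thesis
    by (rule has_derivative_transform_within_open[OF assms(1) open_map_chart_dom[OF c(1)
          open_chart_dom[OF N d(1)]]])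
       (use assms(2) c d chart_props[OF atlas_is_chart[OF M c(1)]] in auto)
qed

text \<open>Carries facts on \<open>cd\<close> over to the submanifold; it is applied to the Reeb
  field, so that \<open>cd_xi\<close> becomes available along \<open>\<iota>\<close>.\<close>

lemma cd_along_pullback:
  assumes "affine_connection N cd" "smooth_vf_on N U Y" "\<iota> p \<in> U"
  shows "differentiable_along M N \<iota> p (\<lambda>q. Y (\<iota> q))"
    and "cd_along M N \<iota> cd p x (\<lambda>q. Y (\<iota> q)) = cd (\<iota> p) (dmap M N \<iota> p x) Y"
proof -
  note d = chart_at_atlas[OF N, of "\<iota> p"]
  note D = pullback_has_derivative[OF smooth_vf_on_to_chart[OF N assms(2) d(1)]
      IntI[OF d(2) assms(3)]]
  show "differentiable_along M N \<iota> p (\<lambda>q. Y (\<iota> q))" by (rule differentiable_alongI(1)[OF D])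
  show "cd_along M N \<iota> cd p x (\<lambda>q. Y (\<iota> q)) = cd (\<iota> p) (dmap M N \<iota> p x) Y"
    by (simp add: differentiable_alongI(2)[OF D] cd_in_chart[OF N assms])
qed

text \<open>In coordinates g(V, W) is a sum of V_i W_j g_ij. Metric compatibility for coordinate
  fields turns the derivative of each g_ij into two Christoffel terms, and these complete the
  coordinate derivatives of \<open>V\<close> and \<open>W\<close> to covariant ones.\<close>

lemma cd_along_metric:
  assumes "affine_connection N cd" "metric_connection N g cd" "riemannian_metric N g"
    and V: "differentiable_along M N \<iota> p V" and W: "differentiable_along M N \<iota> p W"
  shows "((\<lambda>q. g (\<iota> q) (V q) (W q)) \<circ> cinv (chart_at M p) has_derivative
    (\<lambda>x. g (\<iota> p) (cd_along M N \<iota> cd p x V) (W p) + g (\<iota> p) (V p) (cd_along M N \<iota> cd p x W)))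
    (at (snd (chart_at M p) p))"
proof -
  define c where "c = chart_at M p"
  define d where "d = chart_at N (\<iota> p)"
  define A where "A = coord_field N d"
  define \<Gamma> where "\<Gamma> = (\<lambda>x. christoffel N cd (\<iota> p) (dmap M N \<iota> p x))"
  define V' where "V' = (\<lambda>q. to_chart N d (\<iota> q) (V q))"
  define W' where "W' = (\<lambda>q. to_chart N d (\<iota> q) (W q))"
  note dd = chart_at_atlas[OF N, of "\<iota> p", folded d_def]
  note cc = chart_at_atlas[OF M, of p, folded c_def]
  have bil: "bilinear (g q)" for q using assms(3) by (simp add: riemannian_metric_def)
  have linl: "linear (\<lambda>a. g q a b)" and linr: "linear (g q b)" for q b
    using bil[of q] unfolding bilinear_def by auto
  have dV: "(V' \<circ> cinv c has_derivative (\<lambda>x. cd_along M N \<iota> cd p x V - \<Gamma> x (V p))) (at (snd c p))"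
    using differentiable_along_has_derivative[OF V, of cd] by (simp add: V'_def c_def d_def \<Gamma>_def)
  have dW: "(W' \<circ> cinv c has_derivative (\<lambda>x. cd_along M N \<iota> cd p x W - \<Gamma> x (W p))) (at (snd c p))"
    using differentiable_along_has_derivative[OF W, of cd] by (simp add: W'_def c_def d_def \<Gamma>_def)
  have dG: "((\<lambda>q. g (\<iota> q) (A i (\<iota> q)) (A j (\<iota> q))) \<circ> cinv c has_derivative
      (\<lambda>x. g (\<iota> p) (\<Gamma> x i) j + g (\<iota> p) i (\<Gamma> x j))) (at (snd c p))"
    if "i \<in> Basis" "j \<in> Basis" for i j
  proof -
    have "smooth_fun_on N (fst d) (\<lambda>q. g q (A i q) (A j q))"
      using assms(3) smooth_vf_on_coord_field[OF N dd(1)]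
      unfolding riemannian_metric_def A_def by simp
    from pullback_has_derivative[OF this dd(2)] show ?thesis
      using metric_derivative_coord_field[OF N assms(1,2) that]
      by (simp add: A_def d_def \<Gamma>_def c_def)
  qed
  have p: "cinv c (snd c p) = p" "V' p = V p" "W' p = W p" "A i (\<iota> p) = i" for i
    using chart_props(4)[OF atlas_is_chart[OF M cc(1)] cc(2)]
    by (simp_all add: V'_def W'_def A_def d_def to_chart_chart_at[OF N] coord_field_chart_at[OF N])
  have "((\<lambda>q. \<Sum>i\<in>Basis. \<Sum>j\<in>Basis. (V' q \<bullet> i) * (W' q \<bullet> j) * g (\<iota> q) (A i (\<iota> q)) (A j (\<iota> q))) \<circ> cinv c
    has_derivative (\<lambda>x. \<Sum>i\<in>Basis. \<Sum>j\<in>Basis.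
      (V p \<bullet> i) * (W p \<bullet> j) * (g (\<iota> p) (\<Gamma> x i) j + g (\<iota> p) i (\<Gamma> x j)) +
      ((V p \<bullet> i) * ((cd_along M N \<iota> cd p x W - \<Gamma> x (W p)) \<bullet> j) +
       ((cd_along M N \<iota> cd p x V - \<Gamma> x (V p)) \<bullet> i) * (W p \<bullet> j)) * g (\<iota> p) i j)) (at (snd c p))"
    unfolding o_def
    by (intro has_derivative_sum)
       (use has_derivative_mult[OF has_derivative_mult[OF
            bounded_linear.has_derivative[OF bounded_linear_inner_left dV]
            bounded_linear.has_derivative[OF bounded_linear_inner_left dW]] dG] in
          \<open>simp add: o_def p\<close>)
  moreover have "(\<lambda>x. \<Sum>i\<in>Basis. \<Sum>j\<in>Basis.
      (V p \<bullet> i) * (W p \<bullet> j) * (g (\<iota> p) (\<Gamma> x i) j + g (\<iota> p) i (\<Gamma> x j)) +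
      ((V p \<bullet> i) * ((cd_along M N \<iota> cd p x W - \<Gamma> x (W p)) \<bullet> j) +
       ((cd_along M N \<iota> cd p x V - \<Gamma> x (V p)) \<bullet> i) * (W p \<bullet> j)) * g (\<iota> p) i j)
    = (\<lambda>x. g (\<iota> p) (cd_along M N \<iota> cd p x V) (W p) + g (\<iota> p) (V p) (cd_along M N \<iota> cd p x W))"
  proof
    fix x
    have lin\<Gamma>: "linear (\<Gamma> x)" unfolding \<Gamma>_def by (rule christoffel_linear)
    have b1: "bilinear (\<lambda>a b. g (\<iota> p) (\<Gamma> x a) b)" and b2: "bilinear (\<lambda>a b. g (\<iota> p) a (\<Gamma> x b))"
      unfolding bilinear_def
      using linear_compose[OF lin\<Gamma> linl] linear_compose[OF lin\<Gamma> linr] linl linr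
      by (auto simp: o_def)
    have "g (\<iota> p) (cd_along M N \<iota> cd p x V) (W p) + g (\<iota> p) (V p) (cd_along M N \<iota> cd p x W)
      = g (\<iota> p) (\<Gamma> x (V p)) (W p) + g (\<iota> p) (V p) (\<Gamma> x (W p))
        + (g (\<iota> p) (V p) (cd_along M N \<iota> cd p x W - \<Gamma> x (W p))
        + g (\<iota> p) (cd_along M N \<iota> cd p x V - \<Gamma> x (V p)) (W p))"
      by (simp add: linear_diff[OF linl] linear_diff[OF linr])
    also have "\<dots> = (\<Sum>i\<in>Basis. \<Sum>j\<in>Basis. (V p \<bullet> i) * (W p \<bullet> j) * g (\<iota> p) (\<Gamma> x i) j)
      + (\<Sum>i\<in>Basis. \<Sum>j\<in>Basis. (V p \<bullet> i) * (W p \<bullet> j) * g (\<iota> p) i (\<Gamma> x j))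
      + ((\<Sum>i\<in>Basis. \<Sum>j\<in>Basis. (V p \<bullet> i) * ((cd_along M N \<iota> cd p x W - \<Gamma> x (W p)) \<bullet> j) * g (\<iota> p) i j)
      + (\<Sum>i\<in>Basis. \<Sum>j\<in>Basis. ((cd_along M N \<iota> cd p x V - \<Gamma> x (V p)) \<bullet> i) * (W p \<bullet> j) * g (\<iota> p) i j))"
      by (intro arg_cong2[where f = "(+)"] bilinear_sum_Basis bil b1 b2)
    finally show "(\<Sum>i\<in>Basis. \<Sum>j\<in>Basis.
      (V p \<bullet> i) * (W p \<bullet> j) * (g (\<iota> p) (\<Gamma> x i) j + g (\<iota> p) i (\<Gamma> x j)) +
      ((V p \<bullet> i) * ((cd_along M N \<iota> cd p x W - \<Gamma> x (W p)) \<bullet> j) +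
       ((cd_along M N \<iota> cd p x V - \<Gamma> x (V p)) \<bullet> i) * (W p \<bullet> j)) * g (\<iota> p) i j)
     = g (\<iota> p) (cd_along M N \<iota> cd p x V) (W p) + g (\<iota> p) (V p) (cd_along M N \<iota> cd p x W)"
      by (simp only: distrib_left distrib_right sum.distrib add.assoc)
  qed
  ultimately have "((\<lambda>q. \<Sum>i\<in>Basis. \<Sum>j\<in>Basis. (V' q \<bullet> i) * (W' q \<bullet> j) * g (\<iota> q) (A i (\<iota> q)) (A j (\<iota>
      q))) \<circ> cinv c
    has_derivative (\<lambda>x. g (\<iota> p) (cd_along M N \<iota> cd p x V) (W p) + g (\<iota> p) (V p) (cd_along M N \<iota> cd p
        x W)))
    (at (snd c p))" by simp
  then show ?thesis unfolding c_def
  proof (rule eventually_chart_cong_has_derivative)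
    fix q assume "q \<in> fst (chart_at M p)" and q: "\<iota> q \<in> fst (chart_at N (\<iota> p))"
    have lA: "linear (\<lambda>a. A a (\<iota> q))"
      unfolding A_def using coord_field_linear[OF N dd(1)] q by (simp add: d_def)
    have "bilinear (\<lambda>a b. g (\<iota> q) (A a (\<iota> q)) (A b (\<iota> q)))"
      unfolding bilinear_def
      using linear_compose[OF lA linl] linear_compose[OF lA linr] by (auto simp: o_def)
    from bilinear_sum_Basis[OF this, of "V' q" "W' q"]
    show "(\<Sum>i\<in>Basis. \<Sum>j\<in>Basis. (V' q \<bullet> i) * (W' q \<bullet> j) * g (\<iota> q) (A i (\<iota> q)) (A j (\<iota> q)))
        = g (\<iota> q) (V q) (W q)"
      using coord_field_to_chart[OF N dd(1), of "\<iota> q"] q by (simp add: A_def V'_def W'_def d_def)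
  qed
qed

text \<open>\<open>V\<close> need not extend to a field on \<open>N\<close>, so it is expanded in
  coordinate fields. The Kenmotsu identity is used for each of them, and its right-hand side, being
  linear in the differentiated field, reassembles to its value at \<open>V p\<close>.\<close>

lemma cd_along_phi:
  assumes "levi_civita N g cd" "kenmotsu N \<phi> \<xi> \<eta> g cd" and V: "differentiable_along M N \<iota> p V"
  shows "differentiable_along M N \<iota> p (\<lambda>q. \<phi> (\<iota> q) (V q))"
    and "cd_along M N \<iota> cd p x (\<lambda>q. \<phi> (\<iota> q) (V q)) = \<phi> (\<iota> p) (cd_along M N \<iota> cd p x V)
      + g (\<iota> p) (\<phi> (\<iota> p) (dmap M N \<iota> p x)) (V p) *\<^sub>R \<xi> (\<iota> p)
      - \<eta> (\<iota> p) (V p) *\<^sub>R \<phi> (\<iota> p) (dmap M N \<iota> p x)"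
proof -
  define c where "c = chart_at M p"
  define d where "d = chart_at N (\<iota> p)"
  define A where "A = coord_field N d"
  define \<Gamma> where "\<Gamma> = (\<lambda>x. christoffel N cd (\<iota> p) (dmap M N \<iota> p x))"
  define V' where "V' = (\<lambda>q. to_chart N d (\<iota> q) (V q))"
  define \<Phi> where "\<Phi> = (\<lambda>i q. to_chart N d q (\<phi> q (A i q)))"
  \<comment> \<open>The right-hand side of the Kenmotsu identity in the direction of the image of
    \<open>x\<close>, as a linear function of the value \<open>a\<close> of the second
    field.\<close>
  define E where "E = (\<lambda>x a. g (\<iota> p) (\<phi> (\<iota> p) (dmap M N \<iota> p x)) a *\<^sub>R \<xi> (\<iota> p)
      - \<eta> (\<iota> p) a *\<^sub>R \<phi> (\<iota> p) (dmap M N \<iota> p x))"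
  note dd = chart_at_atlas[OF N, of "\<iota> p", folded d_def]
  note cc = chart_at_atlas[OF M, of p, folded c_def]
  note acm = kenmotsu_acm[OF assms(1,2)] and conn = kenmotsu_connection[OF assms(1,2)]
  note lin\<phi> = acm_basics(1)[OF acm]
  have dV: "(V' \<circ> cinv c has_derivative (\<lambda>x. cd_along M N \<iota> cd p x V - \<Gamma> x (V p))) (at (snd c p))"
    using differentiable_along_has_derivative[OF V, of cd] by (simp add: V'_def c_def d_def \<Gamma>_def)
  have lin\<Gamma>: "linear (\<Gamma> x)" for x unfolding \<Gamma>_def by (rule christoffel_linear)
  have linE: "linear (E x)" for x
    unfolding E_def
    by (intro linear_compose_sub linearI)
       (simp_all add: linear_add[OF acm_basics(2)[OF acm]] linear_cmul[OF acm_basics(2)[OF acm]]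
          linear_add[OF acm_metric_linear(1)[OF acm]] linear_cmul[OF acm_metric_linear(1)[OF acm]]
          scaleR_add_left)
  have d\<Phi>: "(\<Phi> i \<circ> \<iota> \<circ> cinv c has_derivative
      (\<lambda>x. \<phi> (\<iota> p) (\<Gamma> x i) + E x i - \<Gamma> x (\<phi> (\<iota> p) i))) (at (snd c p))"
    if "i \<in> Basis" for i
  proof -
    note vf = smooth_vf_on_phi[OF acm smooth_vf_on_coord_field[OF N dd(1), of i]]
    have sm: "smooth_fun_on N (fst d) (\<Phi> i)"
      using smooth_vf_on_to_chart[OF N vf dd(1)] by (simp add: \<Phi>_def A_def)
    have "dir_deriv N (\<iota> p) v (\<Phi> i) = \<phi> (\<iota> p) (christoffel N cd (\<iota> p) v i)
        + (g (\<iota> p) (\<phi> (\<iota> p) v) i *\<^sub>R \<xi> (\<iota> p) - \<eta> (\<iota> p) i *\<^sub>R \<phi> (\<iota> p) v)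
        - christoffel N cd (\<iota> p) v (\<phi> (\<iota> p) i)" for v
      using cd_in_chart[OF N conn(2) vf dd(2), of v]
        kenmotsu_coord_field[OF assms(1,2), of "\<iota> p" v i] christoffel_Basis[OF that, of N cd "\<iota> p" v]
      by (simp add: \<Phi>_def A_def d_def coord_field_chart_at[OF N] algebra_simps)
    then show ?thesis
      using pullback_has_derivative[OF sm dd(2)] by (simp add: o_def c_def \<Gamma>_def E_def)
  qed
  have p: "cinv c (snd c p) = p" "V' p = V p" "\<Phi> i (\<iota> p) = \<phi> (\<iota> p) i" for i
    using chart_props(4)[OF atlas_is_chart[OF M cc(1)] cc(2)]
    by (simp_all add: V'_def \<Phi>_def A_def d_def to_chart_chart_at[OF N] coord_field_chart_at[OF N])
  have "((\<lambda>q. \<Sum>i\<in>Basis. (V' q \<bullet> i) *\<^sub>R \<Phi> i (\<iota> q)) \<circ> cinv c has_derivative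
    (\<lambda>x. \<Sum>i\<in>Basis. (V p \<bullet> i) *\<^sub>R (\<phi> (\<iota> p) (\<Gamma> x i) + E x i - \<Gamma> x (\<phi> (\<iota> p) i))
      + ((cd_along M N \<iota> cd p x V - \<Gamma> x (V p)) \<bullet> i) *\<^sub>R \<phi> (\<iota> p) i)) (at (snd c p))"
    unfolding o_def
    by (intro has_derivative_sum)
       (use has_derivative_scaleR[OF bounded_linear.has_derivative[OF bounded_linear_inner_left dV] d\<Phi>]
         in \<open>simp add: o_def p\<close>)
  moreover have "(\<lambda>x. \<Sum>i\<in>Basis. (V p \<bullet> i) *\<^sub>R (\<phi> (\<iota> p) (\<Gamma> x i) + E x i - \<Gamma> x (\<phi> (\<iota> p) i))
      + ((cd_along M N \<iota> cd p x V - \<Gamma> x (V p)) \<bullet> i) *\<^sub>R \<phi> (\<iota> p) i)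
    = (\<lambda>x. \<phi> (\<iota> p) (cd_along M N \<iota> cd p x V) + E x (V p) - \<Gamma> x (\<phi> (\<iota> p) (V p)))"
  proof
    fix x
    let ?L = "\<lambda>a. \<phi> (\<iota> p) (\<Gamma> x a) + E x a - \<Gamma> x (\<phi> (\<iota> p) a)"
    have "linear ?L"
      by (intro linear_compose_sub linear_compose_add linE
          linear_compose[OF lin\<Gamma> lin\<phi>, unfolded o_def] linear_compose[OF lin\<phi> lin\<Gamma>, unfolded o_def])
    note sums = linear_sum_Basis[OF this, of "V p"]
      linear_sum_Basis[OF lin\<phi>, of "\<iota> p" "cd_along M N \<iota> cd p x V - \<Gamma> x (V p)"]
    show "(\<Sum>i\<in>Basis. (V p \<bullet> i) *\<^sub>R ?L i
      + ((cd_along M N \<iota> cd p x V - \<Gamma> x (V p)) \<bullet> i) *\<^sub>R \<phi> (\<iota> p) i)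
    = \<phi> (\<iota> p) (cd_along M N \<iota> cd p x V) + E x (V p) - \<Gamma> x (\<phi> (\<iota> p) (V p))"
      by (simp only: sum.distrib sums[symmetric] linear_diff[OF lin\<phi>]) simp
  qed
  ultimately have D: "((\<lambda>q. \<Sum>i\<in>Basis. (V' q \<bullet> i) *\<^sub>R \<Phi> i (\<iota> q)) \<circ> cinv c has_derivative
     (\<lambda>x. \<phi> (\<iota> p) (cd_along M N \<iota> cd p x V) + E x (V p) - \<Gamma> x (\<phi> (\<iota> p) (V p)))) (at (snd c p))"
    by simp
  have D: "((\<lambda>q. to_chart N d (\<iota> q) (\<phi> (\<iota> q) (V q))) \<circ> cinv c has_derivative
     (\<lambda>x. \<phi> (\<iota> p) (cd_along M N \<iota> cd p x V) + E x (V p) - \<Gamma> x (\<phi> (\<iota> p) (V p)))) (at (snd c p))"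
    unfolding c_def
  proof (rule eventually_chart_cong_has_derivative[OF D[unfolded c_def]])
    fix q assume "q \<in> fst (chart_at M p)" and "\<iota> q \<in> fst (chart_at N (\<iota> p))"
    then have q: "\<iota> q \<in> fst d" by (simp add: d_def)
    have "linear (\<lambda>a. to_chart N d (\<iota> q) (\<phi> (\<iota> q) (A a (\<iota> q))))"
      using linear_compose[OF linear_compose[OF coord_field_linear[OF N dd(1) q] lin\<phi>]
          to_chart_linear[OF N dd(1) q]] by (simp add: o_def A_def)
    from linear_sum_Basis[OF this, of "V' q"]
    show "(\<Sum>i\<in>Basis. (V' q \<bullet> i) *\<^sub>R \<Phi> i (\<iota> q)) = to_chart N d (\<iota> q) (\<phi> (\<iota> q) (V q))"
      using coord_field_to_chart[OF N dd(1) q] by (simp add: A_def V'_def \<Phi>_def)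
  qed
  note D = D[unfolded c_def d_def]
  show "differentiable_along M N \<iota> p (\<lambda>q. \<phi> (\<iota> q) (V q))" by (rule differentiable_alongI(1)[OF D])
  show "cd_along M N \<iota> cd p x (\<lambda>q. \<phi> (\<iota> q) (V q)) = \<phi> (\<iota> p) (cd_along M N \<iota> cd p x V)
      + g (\<iota> p) (\<phi> (\<iota> p) (dmap M N \<iota> p x)) (V p) *\<^sub>R \<xi> (\<iota> p)
      - \<eta> (\<iota> p) (V p) *\<^sub>R \<phi> (\<iota> p) (dmap M N \<iota> p x)"
    by (simp add: differentiable_alongI(2)[OF D] \<Gamma>_def E_def)
qed

lemma differentiable_along_dmap:
  assumes "smooth_vf_on M U X" "p \<in> U"
  shows "differentiable_along M N \<iota> p (\<lambda>q. dmap M N \<iota> q (X q))"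
proof -
  define c where "c = chart_at M p"
  define d where "d = chart_at N (\<iota> p)"
  note dd = chart_at_atlas[OF N, of "\<iota> p", folded d_def]
  note cc = chart_at_atlas[OF M, of p, folded c_def]
  note cp = chart_props[OF atlas_is_chart[OF M cc(1)]]
  let ?I = "snd d \<circ> \<iota> \<circ> cinv c" and ?X = "\<lambda>q. to_chart M c q (X q)"
  have W: "snd c p \<in> snd c ` (fst c \<inter> \<iota> -` fst d)" using cc dd by auto
  have "?X \<circ> cinv c differentiable at (snd c p)"
    by (rule smooth_fun_on_differentiable[OF M smooth_vf_on_to_chart[OF M assms(1) cc(1)] cc])
       (use cc assms in auto)
  then obtain D where D: "(?X \<circ> cinv c has_derivative D) (at (snd c p))"
    by (auto simp: differentiable_def)
  have "((\<lambda>u. \<Sum>i\<in>Basis. ((?X \<circ> cinv c) u \<bullet> i) *\<^sub>R frechet_derivative ?I (at u) i) has_derivative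
    (\<lambda>x. \<Sum>i\<in>Basis. ((?X \<circ> cinv c) (snd c p) \<bullet> i) *\<^sub>R
         frechet_derivative (\<lambda>u. frechet_derivative ?I (at u) i) (at (snd c p)) x
       + (D x \<bullet> i) *\<^sub>R frechet_derivative ?I (at (snd c p)) i)) (at (snd c p))"
    by (intro has_derivative_sum has_derivative_scaleR
        bounded_linear.has_derivative[OF bounded_linear_inner_left D]
        smooth_on_has_derivative[OF smooth_on_frechet_derivative[OF smooth_on_map[OF cc(1) dd(1)]] W])
  then obtain D' where "((\<lambda>u. \<Sum>i\<in>Basis. ((?X \<circ> cinv c) u \<bullet> i) *\<^sub>R frechet_derivative ?I (at u) i)
      has_derivative D') (at (snd c p))" by blast
  then have "((\<lambda>q. to_chart N d (\<iota> q) (dmap M N \<iota> q (X q))) \<circ> cinv c has_derivative D') (at (snd c p))"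
  proof (rule has_derivative_transform_within_open[OF _ open_map_chart_dom[OF cc(1)
      open_chart_dom[OF N dd(1)]] W])
    fix u assume "u \<in> snd c ` (fst c \<inter> \<iota> -` fst d)"
    then obtain q where q: "q \<in> fst c" "\<iota> q \<in> fst d" "u = snd c q" by auto
    have "to_chart N d (\<iota> q) (dmap M N \<iota> q (X q)) = map_deriv c d \<iota> q (?X q)"
      using dmap_coord_field[OF cc(1) dd(1) q(1,2), of "?X q"]
      by (simp add: coord_field_to_chart[OF M cc(1) q(1)] to_chart_coord_field[OF N dd(1) q(2)])
    then show "(\<Sum>i\<in>Basis. ((?X \<circ> cinv c) u \<bullet> i) *\<^sub>R frechet_derivative ?I (at u) i)
        = ((\<lambda>q. to_chart N d (\<iota> q) (dmap M N \<iota> q (X q))) \<circ> cinv c) u"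
      using linear_sum_Basis[OF map_deriv_linear[OF cc(1) dd(1) q(1,2)], of "?X q"] cp(4)[OF q(1)] q(3)
      by (simp add: map_deriv_def)
  qed
  then show ?thesis unfolding c_def d_def by (rule differentiable_alongI(1))
qed

text \<open>As \<open>y\<close> is extended with constant coordinates, the derivative falls on the
  Jacobian of \<open>\<iota>\<close> alone. This leaves the Hessian of \<open>\<iota>\<close> in
  charts and a Christoffel term, from which symmetry and linearity can be read off.\<close>

lemma cd_coord_eq:
  fixes p
  defines "c \<equiv> chart_at M p" and "d \<equiv> chart_at N (\<iota> p)"
  shows "cd_coord M N \<iota> cd p x y
    = frechet_derivative (\<lambda>u. frechet_derivative (snd d \<circ> \<iota> \<circ> cinv c) (at u) y) (at (snd c p)) x
      + christoffel N cd (\<iota> p) (dmap M N \<iota> p x) (dmap M N \<iota> p y)"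
proof -
  note dd = chart_at_atlas[OF N, of "\<iota> p", folded d_def]
  note cc = chart_at_atlas[OF M, of p, folded c_def]
  note cp = chart_props[OF atlas_is_chart[OF M cc(1)]]
  let ?I = "snd d \<circ> \<iota> \<circ> cinv c"
  have W: "snd c p \<in> snd c ` (fst c \<inter> \<iota> -` fst d)" using cc dd by auto
  have "((\<lambda>q. to_chart N d (\<iota> q) (dmap M N \<iota> q (coord_field M c y q))) \<circ> cinv c
      has_derivative frechet_derivative (\<lambda>u. frechet_derivative ?I (at u) y) (at (snd c p))) (at
          (snd c p))"
  proof (rule has_derivative_transform_within_open[OF
        smooth_on_has_derivative[OF smooth_on_frechet_derivative[OF smooth_on_map[OF cc(1) dd(1)]] W]
        open_map_chart_dom[OF cc(1) open_chart_dom[OF N dd(1)]] W])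
    fix u assume "u \<in> snd c ` (fst c \<inter> \<iota> -` fst d)"
    then obtain q where q: "q \<in> fst c" "\<iota> q \<in> fst d" "u = snd c q" by auto
    show "frechet_derivative ?I (at u) y
      = ((\<lambda>q. to_chart N d (\<iota> q) (dmap M N \<iota> q (coord_field M c y q))) \<circ> cinv c) u"
      using dmap_coord_field[OF cc(1) dd(1) q(1,2)] cp(4)[OF q(1)] q(3)
      by (simp add: to_chart_coord_field[OF N dd(1) q(2)] map_deriv_def)
  qed
  note D = this[unfolded c_def d_def]
  show ?thesis
    unfolding cd_coord_def c_def d_def differentiable_alongI(2)[OF D]
    by (simp add: coord_field_chart_at[OF M])
qed

lemma cd_coord_symmetric:
  assumes "affine_connection N cd" "torsion_free N cd"
  shows "cd_coord M N \<iota> cd p x y = cd_coord M N \<iota> cd p y x"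
  unfolding cd_coord_eq christoffel_symmetric[OF N assms, of _ "dmap M N \<iota> p y"]
  by (subst second_derivative_symmetric[OF open_map_chart_dom[OF chart_at_atlas(1)[OF M]
        open_chart_dom[OF N chart_at_atlas(1)[OF N]]] _ smooth_on_map[OF chart_at_atlas(1)[OF M]
            chart_at_atlas(1)[OF N]]])
     (use chart_at_atlas[OF M] chart_at_atlas[OF N] in auto)

lemma cd_coord_linear:
  assumes "affine_connection N cd"
  shows "linear (\<lambda>x. cd_coord M N \<iota> cd p x y)"
proof -
  have "linear (frechet_derivative (\<lambda>u. frechet_derivative
      (snd (chart_at N (\<iota> p)) \<circ> \<iota> \<circ> cinv (chart_at M p)) (at u) y) (at (snd (chart_at M p) p)))"
    by (rule smooth_on_frechet_derivative_linear[OF smooth_on_frechet_derivative[OF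
          smooth_on_map[OF chart_at_atlas(1)[OF M] chart_at_atlas(1)[OF N]]]])
       (use chart_at_atlas[OF M] chart_at_atlas[OF N] in auto)
  then show ?thesis
    unfolding cd_coord_eq
    by (intro linear_compose_add
        linear_compose[OF dmap_linear christoffel_linear_left[OF N assms], unfolded o_def])
qed

lemma cd_coord_metric:
  assumes "affine_connection N cd" "metric_connection N g cd" "riemannian_metric N g"
  shows "((\<lambda>q. induced_metric M N \<iota> g q (coord_field M (chart_at M p) y q)
        (coord_field M (chart_at M p) z q)) \<circ> cinv (chart_at M p) has_derivative
    (\<lambda>x. g (\<iota> p) (cd_coord M N \<iota> cd p x y) (dmap M N \<iota> p z) + g (\<iota> p) (dmap M N \<iota> p y) (cd_coord M N
        \<iota> cd p x z)))
    (at (snd (chart_at M p) p))"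
proof -
  note cc = chart_at_atlas[OF M, of p]
  note vf = smooth_vf_on_coord_field[OF M cc(1)]
  show ?thesis
    using cd_along_metric[OF assms differentiable_along_dmap[OF vf cc(2), of y]
        differentiable_along_dmap[OF vf cc(2), of z]]
    by (simp add: cd_coord_def induced_metric_def coord_field_chart_at[OF M])
qed

end

subsection \<open>Orthonormal systems\<close>

definition inner_form :: "('e::euclidean_space \<Rightarrow> 'e \<Rightarrow> real) \<Rightarrow> bool" where
  "inner_form G \<longleftrightarrow> bilinear G \<and> (\<forall>u v. G u v = G v u) \<and> (\<forall>u. u \<noteq> 0 \<longrightarrow> G u u > 0)"

text \<open>Without the spanning condition of \<open>orthonormal_basis\<close>, so that it also
  covers bases of \<open>D1\<close> and \<open>D2\<close>.\<close>

definition orthonormal :: "('e \<Rightarrow> 'e \<Rightarrow> real) \<Rightarrow> 'e set \<Rightarrow> bool" where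
  "orthonormal G E \<longleftrightarrow> finite E \<and> (\<forall>e\<in>E. \<forall>e'\<in>E. G e e' = (if e = e' then 1 else 0))"

lemma orthonormal_basis_iff: "orthonormal_basis G E \<longleftrightarrow> orthonormal G E \<and> span E = UNIV"
  by (auto simp: orthonormal_basis_def orthonormal_def)

context
  fixes G :: "'e::euclidean_space \<Rightarrow> 'e \<Rightarrow> real"
  assumes G: "inner_form G"
begin

lemma inner_form_linear: "linear (G u)" "linear (\<lambda>u. G u v)"
  using G by (auto simp: inner_form_def bilinear_def)

lemma inner_form_sym: "G u v = G v u"
  using G by (simp add: inner_form_def)

lemma inner_form_pos: "u \<noteq> 0 \<Longrightarrow> G u u > 0"
  using G by (simp add: inner_form_def)

lemma inner_form_simps:
  "G (u + v) w = G u w + G v w" "G w (u + v) = G w u + G w v"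
  "G (u - v) w = G u w - G v w" "G w (u - v) = G w u - G w v"
  "G (- u) w = - G u w" "G w (- u) = - G w u"
  "G (k *\<^sub>R u) w = k * G u w" "G w (k *\<^sub>R u) = k * G w u" "G 0 w = 0" "G w 0 = 0"
  by (simp_all add: inner_form_linear[THEN linear_add] inner_form_linear[THEN linear_diff]
      inner_form_linear[THEN linear_neg] inner_form_linear[THEN linear_cmul]
      inner_form_linear[THEN linear_0])

lemma inner_form_sum:
  "G (sum h A) w = (\<Sum>i\<in>A. G (h i) w)" "G w (sum h A) = (\<Sum>i\<in>A. G w (h i))"
  by (rule linear_sum[OF inner_form_linear(2)], rule linear_sum[OF inner_form_linear(1)])

lemma inner_form_nonneg: "0 \<le> G u u"
  using inner_form_pos[of u] by (cases "u = 0") (auto simp: inner_form_simps)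

lemma inner_form_eqI: "(\<And>v. G u v = G w v) \<Longrightarrow> u = w"
  using inner_form_pos[of "u - w"] by (force simp: inner_form_simps)

lemma bessel_inequality:
  assumes "finite K" "\<And>i j. i \<in> K \<Longrightarrow> j \<in> K \<Longrightarrow> G (\<nu> i) (\<nu> j) = (if i = j then 1 else 0)"
  shows "(\<Sum>i\<in>K. (G v (\<nu> i))\<^sup>2) \<le> G v v"
proof -
  let ?w = "\<Sum>i\<in>K. G v (\<nu> i) *\<^sub>R \<nu> i"
  have vw: "G v ?w = (\<Sum>i\<in>K. (G v (\<nu> i))\<^sup>2)"
    by (simp add: inner_form_sum inner_form_simps power2_eq_square)
  have "G (\<nu> j) ?w = G v (\<nu> j)" if "j \<in> K" for j
  proof -
    have "G (\<nu> j) ?w = (\<Sum>i\<in>K. if j = i then G v (\<nu> i) else 0)"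
      unfolding inner_form_sum
      by (rule sum.cong) (use assms(2) that in \<open>auto simp: inner_form_simps\<close>)
    then show ?thesis using that assms(1) by simp
  qed
  then have "G ?w ?w = (\<Sum>i\<in>K. (G v (\<nu> i))\<^sup>2)"
    by (subst inner_form_sum(1)) (simp add: inner_form_simps power2_eq_square)
  then show ?thesis
    using inner_form_nonneg[of "v - ?w"] vw inner_form_sym[of ?w v] by (simp add: inner_form_simps)
qed

lemma orthonormal_coeff:
  assumes "orthonormal G E" "e \<in> E"
  shows "G (\<Sum>e'\<in>E. k e' *\<^sub>R e') e = k e"
proof -
  have "G (\<Sum>e'\<in>E. k e' *\<^sub>R e') e = (\<Sum>e'\<in>E. if e' = e then k e' else 0)"
    unfolding inner_form_sum
    by (rule sum.cong) (use assms in \<open>auto simp: inner_form_simps orthonormal_def\<close>)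
  then show ?thesis using assms by (simp add: orthonormal_def)
qed

lemma orthonormal_expansion:
  assumes "orthonormal G E" "v \<in> span E"
  shows "v = (\<Sum>e\<in>E. G v e *\<^sub>R e)"
proof -
  have "finite E" using assms by (simp add: orthonormal_def)
  then obtain k where k: "v = (\<Sum>e\<in>E. k e *\<^sub>R e)"
    using assms(2) by (auto simp: span_finite)
  then show ?thesis using orthonormal_coeff[OF assms(1), of _ k] by simp
qed

lemma parseval:
  assumes "orthonormal G E" "v \<in> span E"
  shows "G v w = (\<Sum>e\<in>E. G v e * G w e)"
  by (subst orthonormal_expansion[OF assms])
     (simp add: inner_form_sum inner_form_simps inner_form_sym[of w])

lemma orthonormal_independent:
  assumes "orthonormal G E"
  shows "independent E"
proof (rule independent_if_scalars_zero)
  show "finite E" using assms by (simp add: orthonormal_def)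
  fix k e assume "(\<Sum>e\<in>E. k e *\<^sub>R e) = 0" "e \<in> E"
  then show "k e = 0" using orthonormal_coeff[OF assms, of e k] by (simp add: inner_form_simps)
qed

lemma orthonormal_zero_notin: "orthonormal G E \<Longrightarrow> 0 \<notin> E"
  by (force simp: orthonormal_def inner_form_simps)

text \<open>Gram-Schmidt: a new vector outside the span loses its projection and is normalised; one
  inside the span is dropped.\<close>

lemma orthonormal_set_exists:
  assumes "finite B"
  shows "\<exists>E. orthonormal G E \<and> span E = span B"
  using assms
proof (induction B rule: finite_induct)
  case empty
  show ?case by (intro exI[of _ "{}"]) (simp add: orthonormal_def)
next
  case (insert b B)
  then obtain E where E: "orthonormal G E" "span E = span B" by blast
  show ?case
  proof (cases "b \<in> span B")
    case True
    then show ?thesis using E span_redundant by blast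
  next
    case False
    define w where "w = b - (\<Sum>e\<in>E. G b e *\<^sub>R e)"
    define u where "u = (1 / sqrt (G w w)) *\<^sub>R w"
    have proj: "(\<Sum>e\<in>E. G b e *\<^sub>R e) \<in> span E" by (intro span_sum span_scale span_base)
    have "w \<noteq> 0" using False proj E by (auto simp: w_def)
    then have pos: "G w w > 0" by (rule inner_form_pos)
    have we: "G w e = 0" if "e \<in> E" for e
      using orthonormal_coeff[OF E(1) that] by (simp add: w_def inner_form_simps)
    have uu: "G u u = 1" using pos by (simp add: u_def inner_form_simps)
    have ue: "G u e = 0" "G e u = 0" if "e \<in> E" for e
      using we[OF that] inner_form_sym[of e u] by (simp_all add: u_def inner_form_simps)
    then have "u \<notin> E" using uu by force
    then have "orthonormal G (insert u E)"
      using E(1) uu ue unfolding orthonormal_def by auto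
    moreover have "span (insert u E) = span (insert b E)"
    proof (rule span_eq[THEN iffD2], intro conjI)
      have "(\<Sum>e\<in>E. G b e *\<^sub>R e) \<in> span (insert b E)"
        using proj span_mono[of E "insert b E"] by blast
      then have "w \<in> span (insert b E)"
        unfolding w_def by (rule span_diff[OF span_base[OF insertI1]])
      then have "u \<in> span (insert b E)" unfolding u_def by (rule span_scale)
      moreover have "E \<subseteq> span (insert b E)" by (meson span_superset subset_insertI subset_trans)
      ultimately show "insert u E \<subseteq> span (insert b E)" by simp
      have "b = sqrt (G w w) *\<^sub>R u + (\<Sum>e\<in>E. G b e *\<^sub>R e)"
        using pos by (simp add: u_def w_def)
      moreover have "(\<Sum>e\<in>E. G b e *\<^sub>R e) \<in> span (insert u E)"
        using proj span_mono[of E "insert u E"] by blast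
      ultimately have "b \<in> span (insert u E)"
        by (metis span_add span_scale span_base insertI1)
      moreover have "E \<subseteq> span (insert u E)" by (meson span_superset subset_insertI subset_trans)
      ultimately show "insert b E \<subseteq> span (insert u E)" by simp
    qed
    moreover have "span (insert b E) = span (insert b B)"
      using E(2) by (simp add: span_insert)
    ultimately show ?thesis by (intro exI[of _ "insert u E"]) simp
  qed
qed

lemma orthonormal_basis_of_subspace:
  assumes "subspace S"
  shows "\<exists>E. orthonormal G E \<and> span E = S \<and> card E = dim S"
proof -
  obtain B where "B \<subseteq> S" "independent B" "span B = S"
    using basis_subspace_exists[OF assms] by metis
  then have "finite B" using independent_imp_finite by blast
  then obtain E where E: "orthonormal G E" "span E = S"
    using orthonormal_set_exists \<open>span B = S\<close> by metis
  then have "dim S = card E" using orthonormal_independent dim_span_eq_card_independent by blast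
  then show ?thesis using E by auto
qed

text \<open>Two candidates differ by a vector of \<open>W\<close> that is orthogonal to itself; this
  is the uniqueness required by the definite description in \<open>orth_proj\<close>.\<close>

lemma orth_proj_eqI:
  assumes "subspace W" "w \<in> W" "\<And>z. z \<in> W \<Longrightarrow> G (v - w) z = 0"
  shows "orth_proj G W v = w"
  unfolding orth_proj_def
proof (rule the_equality)
  show "w \<in> W \<and> (\<forall>z\<in>W. G (v - w) z = 0)" using assms by blast
  fix w' assume w': "w' \<in> W \<and> (\<forall>z\<in>W. G (v - w') z = 0)"
  then have "w - w' \<in> W" using assms subspace_diff by blast
  then have "G (v - w') (w - w') - G (v - w) (w - w') = 0"
    using w' assms(3) by simp
  then have "G (w - w') (w - w') = 0" by (simp add: inner_form_simps)
  then show "w' = w" using inner_form_pos[of "w - w'"] by force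
qed

lemma orth_proj_properties:
  assumes "subspace W"
  shows "orth_proj G W v \<in> W" "z \<in> W \<Longrightarrow> G (v - orth_proj G W v) z = 0"
proof -
  obtain E where E: "orthonormal G E" "span E = W"
    using orthonormal_basis_of_subspace[OF assms] by blast
  let ?w = "\<Sum>e\<in>E. G v e *\<^sub>R e"
  have w: "?w \<in> W" unfolding E(2)[symmetric] by (intro span_sum span_scale span_base)
  have o: "G (v - ?w) z = 0" if "z \<in> W" for z
  proof -
    have "G (v - ?w) z = (\<Sum>e\<in>E. G z e * G (v - ?w) e)"
      using parseval[OF E(1), of z "v - ?w"] that E(2) inner_form_sym by simp
    also have "\<dots> = 0"
      using orthonormal_coeff[OF E(1)] by (intro sum.neutral) (simp add: inner_form_simps)
    finally show ?thesis .
  qed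
  have "orth_proj G W v = ?w" by (rule orth_proj_eqI[OF assms w o])
  then show "orth_proj G W v \<in> W" "z \<in> W \<Longrightarrow> G (v - orth_proj G W v) z = 0"
    using w o by simp_all
qed

text \<open>Either sum is the squared length of the vector that represents \<open>L\<close> on the
  common span.\<close>

lemma functional_norm_basis_independent:
  fixes L :: "'e \<Rightarrow> real"
  assumes "linear L" "orthonormal G E" "orthonormal G E'" "span E = span E'"
  shows "(\<Sum>e\<in>E. (L e)\<^sup>2) = (\<Sum>e\<in>E'. (L e)\<^sup>2)"
proof -
  define w where "w = (\<Sum>e\<in>E'. L e *\<^sub>R e)"
  have w: "w \<in> span E'" unfolding w_def by (intro span_sum span_scale span_base)
  have L: "G w v = L v" if "v \<in> span E'" for v
  proof -
    have "G w v = (\<Sum>e\<in>E'. G v e * L e)"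
      by (simp add: w_def inner_form_sum inner_form_simps inner_form_sym[of v] mult.commute)
    also have "\<dots> = L (\<Sum>e\<in>E'. G v e *\<^sub>R e)"
      by (simp add: linear_sum[OF assms(1)] linear_cmul[OF assms(1)])
    finally show ?thesis using orthonormal_expansion[OF assms(3) that] by simp
  qed
  have "(\<Sum>e\<in>D. (L e)\<^sup>2) = G w w" if D: "orthonormal G D" "span D = span E'" for D
  proof -
    have "(\<Sum>e\<in>D. (L e)\<^sup>2) = (\<Sum>e\<in>D. G w e * G w e)"
      by (intro sum.cong refl) (metis L D(2) span_base power2_eq_square)
    then show ?thesis using parseval[OF D(1), of w w] w D(2) by simp
  qed
  from this[OF assms(2,4)] this[OF assms(3) refl] show ?thesis by simp
qed

text \<open>One slot is changed at a time. This allows the arbitrarily chosen basis in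
  \<open>second_ff_norm2\<close> to be exchanged for one adapted to \<open>D1\<close> and
  \<open>D2\<close>.\<close>

lemma bilinear_norm_basis_independent:
  fixes A :: "'e \<Rightarrow> 'e \<Rightarrow> real"
  assumes "bilinear A" "orthonormal G E" "orthonormal G E'" "span E = span E'"
  shows "(\<Sum>e\<in>E. \<Sum>f\<in>E. (A e f)\<^sup>2) = (\<Sum>e\<in>E'. \<Sum>f\<in>E'. (A e f)\<^sup>2)"
proof -
  have "(\<Sum>e\<in>E. \<Sum>f\<in>E. (A e f)\<^sup>2) = (\<Sum>e\<in>E. \<Sum>f\<in>E'. (A e f)\<^sup>2)"
    using assms by (intro sum.cong functional_norm_basis_independent) (auto simp: bilinear_def)
  also have "\<dots> = (\<Sum>f\<in>E'. \<Sum>e\<in>E. (A e f)\<^sup>2)" by (rule sum.swap)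
  also have "\<dots> = (\<Sum>f\<in>E'. \<Sum>e\<in>E'. (A e f)\<^sup>2)"
    using assms by (intro sum.cong functional_norm_basis_independent) (auto simp: bilinear_def)
  also have "\<dots> = (\<Sum>e\<in>E'. \<Sum>f\<in>E'. (A e f)\<^sup>2)" by (rule sum.swap)
  finally show ?thesis .
qed

lemma riesz_representation:
  assumes "linear (\<alpha> :: 'e \<Rightarrow> real)"
  shows "\<exists>!w. \<forall>v. G w v = \<alpha> v"
proof -
  obtain E where E: "orthonormal G E" "span E = UNIV"
    using orthonormal_basis_of_subspace[OF subspace_UNIV] by blast
  let ?w = "\<Sum>e\<in>E. \<alpha> e *\<^sub>R e"
  have "G ?w v = \<alpha> v" for v
  proof -
    have "G ?w v = \<alpha> (\<Sum>e\<in>E. G v e *\<^sub>R e)"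
      by (simp add: linear_sum[OF assms] linear_cmul[OF assms] inner_form_sum inner_form_simps
          inner_form_sym[of v] mult.commute)
    then show ?thesis using orthonormal_expansion[OF E(1), of v] E(2) by simp
  qed
  then show ?thesis by (intro ex1I[of _ ?w]) (auto intro: inner_form_eqI)
qed

end

subsection \<open>The algebraic inequality at a point\<close>

text \<open>Linear algebra on one tangent space: \<open>G\<close> is the induced metric,
  \<open>L\<close> the differential of the immersion, \<open>J\<close> the structure \<phi> pulled
  back to \<open>D1\<close>, \<open>P\<close> the tangential projection and \<open>\<alpha>\<close>
  the differential of ln f. The geometry of the connection enters through \<open>H\<xi>\<close> and
  \<open>HF\<close>; Bessel's inequality is applied to the normal vectors that these two
  control.\<close>

lemma pointwise_inequality:
  fixes G :: "'d::euclidean_space \<Rightarrow> 'd \<Rightarrow> real" and g :: "'e::euclidean_space \<Rightarrow> 'e \<Rightarrow> real"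
    and L :: "'d \<Rightarrow> 'e" and \<phi> :: "'e \<Rightarrow> 'e" and \<xi> :: 'e and J :: "'d \<Rightarrow> 'd"
    and D1 D2 :: "'d set" and H :: "'d \<Rightarrow> 'd \<Rightarrow> 'e" and \<alpha> :: "'d \<Rightarrow> real" and \<theta> :: real
  defines "P \<equiv> orth_proj g (range L)"
  assumes G: "inner_form G" and g: "inner_form g"
    and L: "linear L" and GL: "\<And>u v. G u v = g (L u) (L v)"
    and \<phi>: "linear \<phi>" and skew: "\<And>u v. g (\<phi> u) v = - g u (\<phi> v)"
    and \<phi>L: "\<And>u v. g (\<phi> (L u)) (\<phi> (L v)) = g (L u) (L v)"
    and \<xi>: "g \<xi> \<xi> = 1" "\<And>u. g (L u) \<xi> = 0" "\<And>v. g (\<phi> v) \<xi> = 0"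
    and J: "\<And>x. x \<in> D1 \<Longrightarrow> J x \<in> D1 \<and> L (J x) = \<phi> (L x)"
    and D1: "subspace D1" and D2: "subspace D2" and D12: "\<And>x z. x \<in> D1 \<Longrightarrow> z \<in> D2 \<Longrightarrow> G x z = 0"
    and D: "span (D1 \<union> D2) = UNIV"
    and \<theta>: "0 < \<theta>" "\<theta> < pi / 2"
    and angle: "\<And>z. z \<in> D2 \<Longrightarrow> z \<noteq> 0 \<Longrightarrow> angle_subspace g (\<phi> (L z)) (L ` D2) = \<theta>"
    and H: "bilinear H" "\<And>u v. H u v = H v u" and H\<xi>: "\<And>u v. g (H u v) \<xi> = - G u v"
    and \<alpha>: "linear \<alpha>" "\<And>z. z \<in> D2 \<Longrightarrow> \<alpha> z = 0"
    and HF: "\<And>x z w. x \<in> D1 \<Longrightarrow> z \<in> D2 \<Longrightarrow> w \<in> D2 \<Longrightarrow>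
      g (H x z) (\<phi> (L w) - P (\<phi> (L w))) = - (\<alpha> (J x) * G z w + \<alpha> x * g (L z) (\<phi> (L w)))"
    and E: "orthonormal_basis G E"
  shows "(\<Sum>e\<in>E. \<Sum>f\<in>E. g (H e f - P (H e f)) (H e f - P (H e f)))
    \<ge> 2 * real (dim D2) * ((1 / sin \<theta>)\<^sup>2 + (cot \<theta>)\<^sup>2) * (\<Sum>e\<in>E. (\<alpha> e)\<^sup>2)
      + real (dim D1) + real (dim D2)"
proof -
  note Gs = inner_form_simps[OF G] and gs = inner_form_simps[OF g]
  note Gsym = inner_form_sym[OF G] and gsym = inner_form_sym[OF g]
  have E': "orthonormal G E" "span E = UNIV" using E by (auto simp: orthonormal_basis_iff)
  obtain E1 where E1: "orthonormal G E1" "span E1 = D1" "card E1 = dim D1"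
    using orthonormal_basis_of_subspace[OF G D1] by blast
  obtain E2 where E2: "orthonormal G E2" "span E2 = D2" "card E2 = dim D2"
    using orthonormal_basis_of_subspace[OF G D2] by blast
  have fin: "finite E1" "finite E2" using E1(1) E2(1) by (auto simp: orthonormal_def)
  have in1: "x \<in> D1" if "x \<in> E1" for x using that E1(2) span_base by blast
  have in2: "z \<in> D2" if "z \<in> E2" for z using that E2(2) span_base by blast
  define Eo where "Eo = E1 \<union> E2"
  have disj: "E1 \<inter> E2 = {}"
  proof -
    have "G e e = 1" if "e \<in> E1" for e using that E1(1) by (simp add: orthonormal_def)
    moreover have "G e e = 0" if "e \<in> E1" "e \<in> E2" for e using D12[OF in1 in2] that by blast
    ultimately show ?thesis by fastforce
  qed
  have G0: "G x z = 0" "G z x = 0" if "x \<in> E1" "z \<in> E2" for x z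
    using D12[OF in1 in2] that Gsym[of z x] by auto
  have Eo: "orthonormal G Eo"
    using E1(1) E2(1) disj G0 unfolding orthonormal_def Eo_def by auto
  have spanEo: "span Eo = UNIV"
  proof -
    have "D1 \<subseteq> span Eo" "D2 \<subseteq> span Eo"
      unfolding Eo_def E1(2)[symmetric] E2(2)[symmetric] by (simp_all add: span_mono)
    then have "span (D1 \<union> D2) \<subseteq> span Eo" by (simp add: span_minimal)
    then show ?thesis using D by auto
  qed
  have subR: "subspace (range L)" using linear_subspace_image[OF L subspace_UNIV] .
  have P: "P v \<in> range L" "g (v - P v) (L u) = 0" for v u
    unfolding P_def using orth_proj_properties[OF g subR] by auto

  define F where "F = (\<lambda>z. \<phi> (L z) - P (\<phi> (L z)))"
  \<comment> \<open>Skewness moves \<phi> onto the \<open>D1\<close> vector, where it stays in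
    \<open>D1\<close>.\<close>
  have g\<phi>D: "g (\<phi> (L z)) (L x) = 0" if "z \<in> D2" "x \<in> D1" for z x
    using skew[of "L z" "L x"] J[OF that(2)] GL[of z "J x"] D12[of "J x" z] that Gsym[of z "J x"] by
        simp
  \<comment> \<open>\<phi> maps \<open>D2\<close> orthogonally to \<open>D1\<close>, so projecting
    onto the tangent space agrees with projecting onto the image of \<open>D2\<close>, the
    projection in terms of which the angle is defined.\<close>
  have T: "\<exists>t\<in>D2. P (\<phi> (L z)) = L t \<and> orth_proj g (L ` D2) (\<phi> (L z)) = L t" if z: "z \<in> D2" for z
  proof -
    have sub2: "subspace (L ` D2)" using linear_subspace_image[OF L D2] .
    obtain t where t: "t \<in> D2" "orth_proj g (L ` D2) (\<phi> (L z)) = L t"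
      using orth_proj_properties(1)[OF g sub2] by blast
    have o2: "g (\<phi> (L z) - L t) (L w) = 0" if "w \<in> D2" for w
      using orth_proj_properties(2)[OF g sub2, of "L w" "\<phi> (L z)"] that t(2) by simp
    have o1: "g (\<phi> (L z) - L t) (L x) = 0" if "x \<in> D1" for x
      using g\<phi>D[OF z that] D12[OF that t(1)] GL[of x t] gsym[of "L x" "L t"] by (simp add: gs)
    have "D1 \<union> D2 \<subseteq> {u. g (\<phi> (L z) - L t) (L u) = 0}" using o1 o2 by auto
    moreover have "subspace {u. g (\<phi> (L z) - L t) (L u) = 0}"
      by (auto simp: subspace_def linear_add[OF L] linear_cmul[OF L] linear_0[OF L]
          inner_form_simps(2,8,10)[OF g])
    ultimately have "span (D1 \<union> D2) \<subseteq> {u. g (\<phi> (L z) - L t) (L u) = 0}" by (rule span_minimal)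
    then have "g (\<phi> (L z) - L t) (L u) = 0" for u using D by auto
    then have "P (\<phi> (L z)) = L t" unfolding P_def
      by (intro orth_proj_eqI[OF g subR]) auto
    then show ?thesis using t by auto
  qed
  \<comment> \<open>The angle condition excludes the zero vector, which is treated
    separately.\<close>
  have TT: "g (P (\<phi> (L z))) (P (\<phi> (L z))) = (cos \<theta>)\<^sup>2 * G z z" if z: "z \<in> D2" for z
  proof (cases "z = 0")
    case True
    then have "P (\<phi> (L z)) = 0" unfolding P_def
      by (intro orth_proj_eqI[OF g subR])
         (auto simp: linear_0[OF L] linear_0[OF \<phi>] gs subspace_0[OF subR])
    then show ?thesis using True by (simp add: Gs gs)
  next
    case False
    obtain t where t: "t \<in> D2" "P (\<phi> (L z)) = L t" "orth_proj g (L ` D2) (\<phi> (L z)) = L t"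
      using T[OF z] by blast
    have pos: "G z z > 0" using inner_form_pos[OF G False] .
    have zz: "g (\<phi> (L z)) (\<phi> (L z)) = G z z" by (simp add: \<phi>L GL)
    have ang: "arccos (sqrt (g (L t) (L t)) / sqrt (G z z)) = \<theta>"
      using angle[OF z False] by (simp add: angle_subspace_def t(3) zz Let_def)
    \<comment> \<open>Pythagoras bounds the ratio of lengths by 1, as inverting
      \<open>arccos\<close> requires.\<close>
    have "g (\<phi> (L z) - L t) (L t) = 0" using P(2)[of "\<phi> (L z)" t] t(2) by simp
    then have "g (\<phi> (L z) - L t) (\<phi> (L z) - L t) = G z z - g (L t) (L t)"
      using zz gsym[of "L t" "\<phi> (L z)"] by (simp add: gs)
    then have le: "g (L t) (L t) \<le> G z z"
      using inner_form_nonneg[OF g, of "\<phi> (L z) - L t"] by simp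
    let ?r = "sqrt (g (L t) (L t)) / sqrt (G z z)"
    have "0 \<le> ?r" "?r \<le> 1"
      using le pos inner_form_nonneg[OF g, of "L t"] by simp_all
    then have "cos \<theta> = ?r" unfolding ang[symmetric] by (intro cos_arccos) auto
    then have "(cos \<theta>)\<^sup>2 = g (L t) (L t) / G z z"
      using pos inner_form_nonneg[OF g, of "L t"] by (simp add: power_divide)
    then show ?thesis using pos t(2) by simp
  qed
  have FF1: "g (F z) (F z) = (sin \<theta>)\<^sup>2 * G z z" if z: "z \<in> D2" for z
  proof -
    obtain t where t: "P (\<phi> (L z)) = L t" using T[OF z] by blast
    have "g (F z) (L t) = 0" unfolding F_def by (rule P(2))
    then have "g (F z) (F z) = g (\<phi> (L z)) (\<phi> (L z)) - g (L t) (L t)"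
      using gsym[of "L t" "\<phi> (L z)"] by (simp add: F_def t gs)
    also have "\<dots> = G z z - (cos \<theta>)\<^sup>2 * G z z" using TT[OF z] t by (simp add: \<phi>L GL)
    finally show ?thesis by (simp add: sin_squared_eq algebra_simps)
  qed
  have Padd: "P (u + v) = P u + P v" for u v
    unfolding P_def
    by (rule orth_proj_eqI[OF g subR])
       (use P[unfolded P_def] subspace_add[OF subR] in \<open>auto simp: gs\<close>)
  have Fadd: "F (u + v) = F u + F v" for u v
    by (simp add: F_def linear_add[OF L] linear_add[OF \<phi>] Padd)
  \<comment> \<open>Polarisation of \<open>FF1\<close>, using that \<open>F\<close> is
    additive.\<close>
  have FF: "g (F z) (F w) = (sin \<theta>)\<^sup>2 * G z w" if "z \<in> D2" "w \<in> D2" for z w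
  proof -
    have "g (F (z + w)) (F (z + w)) = (sin \<theta>)\<^sup>2 * G (z + w) (z + w)"
      using FF1 subspace_add[OF D2 that] by blast
    then have "2 * g (F z) (F w) = 2 * ((sin \<theta>)\<^sup>2 * G z w)"
      using FF1[OF that(1)] FF1[OF that(2)] gsym[of "F w" "F z"] Gsym[of w z]
      by (simp add: Fadd gs Gs algebra_simps)
    then show ?thesis by simp
  qed
  have s: "sin \<theta> > 0" using \<theta> by (simp add: sin_gt_zero)
  have F\<xi>: "g (F z) \<xi> = 0" if "z \<in> D2" for z
    using T[OF that] \<xi>(2,3) by (auto simp: F_def gs)

  \<comment> \<open>\<open>0\<close> lies in no orthonormal set, so it is free to serve as the index of \<open>\<xi>\<close>.\<close>
  define \<nu> where "\<nu> = (\<lambda>k. if k = 0 then \<xi> else (1 / sin \<theta>) *\<^sub>R F k)"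
  have z2: "0 \<notin> E2" using orthonormal_zero_notin[OF G E2(1)] .
  have \<nu>: "g (\<nu> i) (\<nu> j) = (if i = j then 1 else 0)" if "i \<in> insert 0 E2" "j \<in> insert 0 E2" for i j
  proof -
    have 1: "g (\<nu> i) (\<nu> j) = (if i = j then 1 else 0)" if "i \<in> E2" "j \<in> E2" for i j
    proof -
      have "g (\<nu> i) (\<nu> j) = G i j"
        using that z2 FF[OF in2 in2, of i j] s by (auto simp: \<nu>_def gs power2_eq_square)
      then show ?thesis using that E2(1) by (simp add: orthonormal_def)
    qed
    have 2: "g (\<nu> i) \<xi> = 0" "g \<xi> (\<nu> i) = 0" if "i \<in> E2" for i
      using that z2 F\<xi>[OF in2] gsym[of \<xi> "F i"] by (auto simp: \<nu>_def gs)
    show ?thesis using that 1 2 \<xi>(1) z2 by (auto simp: \<nu>_def[THEN fun_cong, of 0])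
  qed
  \<comment> \<open>The vectors \<open>\<nu> k\<close> are normal, so they cannot distinguish
    \<open>H\<close> from its normal part; Bessel coefficients may be computed from
    \<open>H\<close>.\<close>
  have \<nu>L: "g (L u) (\<nu> k) = 0" if "k \<in> insert 0 E2" for u k
  proof -
    have "g (F k) (L u) = 0" unfolding F_def by (rule P(2))
    then show ?thesis using \<xi>(2) gsym[of "L u" "F k"] by (auto simp: \<nu>_def gs)
  qed
  have bess: "(\<Sum>k\<in>insert 0 E2. (g (H e f) (\<nu> k))\<^sup>2) \<le> g (H e f - P (H e f)) (H e f - P (H e f))" for e f
  proof -
    obtain u where u: "P (H e f) = L u" using P(1) by blast
    have "(\<Sum>k\<in>insert 0 E2. (g (H e f) (\<nu> k))\<^sup>2) = (\<Sum>k\<in>insert 0 E2. (g (H e f - P (H e f)) (\<nu> k))\<^sup>2)"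
      by (rule sum.cong) (use \<nu>L u in \<open>auto simp: gs\<close>)
    then show ?thesis
      using bessel_inequality[OF g, of "insert 0 E2" \<nu>, OF _ \<nu>] fin by simp
  qed
  have bil: "bilinear (\<lambda>e f. g (H e f) v)" for v
    using H(1) linear_compose[OF _ inner_form_linear(2)[OF g]]
    unfolding bilinear_def o_def by blast

  \<comment> \<open>By \<open>H\<xi>\<close> the matrix of \<xi>-components is minus the identity,
    so its squared norm is the dimension of the tangent space.\<close>
  have xi_part: "(\<Sum>e\<in>Eo. \<Sum>f\<in>Eo. (g (H e f) \<xi>)\<^sup>2) = real (dim D1) + real (dim D2)"
  proof -
    have "(\<Sum>e\<in>Eo. \<Sum>f\<in>Eo. (g (H e f) \<xi>)\<^sup>2) = (\<Sum>e\<in>Eo. \<Sum>f\<in>Eo. if e = f then 1 else 0)"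
      by (intro sum.cong refl) (use Eo in \<open>auto simp: H\<xi> orthonormal_def\<close>)
    also have "\<dots> = real (card Eo)" using fin by (simp add: Eo_def)
    finally show ?thesis using card_Un_disjoint[OF fin disj] E1(3) E2(3) by (simp add: Eo_def)
  qed

  obtain w where w: "\<And>v. G w v = \<alpha> v" using riesz_representation[OF G \<alpha>(1)] by blast
  \<comment> \<open>\<open>w\<close> is the gradient vector of \<open>\<alpha>\<close>; it has no
    \<open>D2\<close> component because \<open>\<alpha>\<close> vanishes there.\<close>
  have wD1: "w \<in> D1"
  proof -
    have "w = (\<Sum>e\<in>Eo. \<alpha> e *\<^sub>R e)" using orthonormal_expansion[OF G Eo, of w] spanEo w by simp
    also have "\<dots> = (\<Sum>e\<in>E1. \<alpha> e *\<^sub>R e)"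
      unfolding Eo_def using \<alpha>(2) in2 by (subst sum.union_disjoint[OF fin disj]) simp
    also have "\<dots> \<in> span E1" by (intro span_sum span_scale span_base)
    finally show ?thesis using E1(2) by simp
  qed
  have a1: "(\<Sum>x\<in>E1. (\<alpha> x)\<^sup>2) = G w w"
    using parseval[OF G E1(1), of w w] wD1 E1(2) by (simp add: w power2_eq_square)
  \<comment> \<open>On \<open>D1\<close> the map \<open>J\<close> is a skew isometry, so this sum is
    the squared length of \<open>J w\<close>, which equals that of \<open>w\<close>.\<close>
  have a2: "(\<Sum>x\<in>E1. (\<alpha> (J x))\<^sup>2) = G w w"
  proof -
    have "\<alpha> (J x) = - G (J w) x" if "x \<in> E1" for x
      using w[of "J x"] skew[of "L w" "L x"] J[OF in1[OF that]] J[OF wD1] by (simp add: GL)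
    then have "(\<Sum>x\<in>E1. (\<alpha> (J x))\<^sup>2) = (\<Sum>x\<in>E1. G (J w) x * G (J w) x)"
      by (intro sum.cong refl) (simp add: power2_eq_square)
    also have "\<dots> = G (J w) (J w)"
      using parseval[OF G E1(1), of "J w" "J w"] J[OF wD1] E1(2) by simp
    finally show ?thesis using J[OF wD1] by (simp add: GL \<phi>L)
  qed
  have a3: "(\<Sum>e\<in>E. (\<alpha> e)\<^sup>2) = G w w"
    using parseval[OF G E'(1), of w w] E'(2) by (simp add: w power2_eq_square)

  define t where "t = (\<lambda>z k. g (L z) (\<phi> (L k)))"
  \<comment> \<open>The diagonal of \<open>t\<close> vanishes by skewness. Since the other summand
    in \<open>HF\<close> lives on the diagonal only, the cross terms of the square drop out.\<close>
  have tzz: "t z z = 0" for z using skew[of "L z" "L z"] gsym[of "\<phi> (L z)"] by (simp add: t_def)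
  \<comment> \<open>The entries \<open>t z k\<close> are the coordinates of the tangential part of
    \<phi> applied to \<open>k\<close>, whose squared length is given by \<open>TT\<close>.\<close>
  have t2: "(\<Sum>z\<in>E2. (t z k)\<^sup>2) = (cos \<theta>)\<^sup>2" if k: "k \<in> E2" for k
  proof -
    obtain u where u: "u \<in> D2" "P (\<phi> (L k)) = L u" using T[OF in2[OF k]] by blast
    have "t z k = G u z" for z
      using P(2)[of "\<phi> (L k)" z] u(2) gsym[of "L z" "\<phi> (L k)"] by (simp add: t_def GL gs)
    then have "(\<Sum>z\<in>E2. (t z k)\<^sup>2) = G u u"
      using parseval[OF G E2(1), of u u] u(1) E2(2) by (simp add: power2_eq_square)
    also have "\<dots> = (cos \<theta>)\<^sup>2 * G k k" using TT[OF in2[OF k]] u(2) by (simp add: GL)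
    finally show ?thesis using k E2(1) by (simp add: orthonormal_def)
  qed
  have mixed: "(\<Sum>k\<in>E2. \<Sum>z\<in>E2. (g (H x z) (\<nu> k))\<^sup>2)
      = real (dim D2) / (sin \<theta>)\<^sup>2 * ((\<alpha> (J x))\<^sup>2 + (\<alpha> x)\<^sup>2 * (cos \<theta>)\<^sup>2)" if x: "x \<in> E1" for x
  proof -
    have "(g (H x z) (\<nu> k))\<^sup>2 = 1 / (sin \<theta>)\<^sup>2 * ((if z = k then (\<alpha> (J x))\<^sup>2 else 0) + (\<alpha> x)\<^sup>2 * (t z
        k)\<^sup>2)"
      if "z \<in> E2" "k \<in> E2" for z k
    proof -
      have "k \<noteq> 0" using that z2 by auto
      then have "g (H x z) (\<nu> k) = (1 / sin \<theta>) * g (H x z) (F k)" by (simp add: \<nu>_def gs)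
      also have "g (H x z) (F k) = - (\<alpha> (J x) * G z k + \<alpha> x * t z k)"
        using HF[OF in1[OF x] in2 in2, OF that] by (simp only: F_def t_def)
      finally have "g (H x z) (\<nu> k) = - (1 / sin \<theta>) * (\<alpha> (J x) * G z k + \<alpha> x * t z k)"
        by (simp only: mult_minus_left mult_minus_right)
      moreover have "G z k = (if z = k then 1 else 0)" using that E2(1) by (simp add: orthonormal_def)
      ultimately show ?thesis using tzz by (auto simp: power_mult_distrib power_divide)
    qed
    then have "(\<Sum>k\<in>E2. \<Sum>z\<in>E2. (g (H x z) (\<nu> k))\<^sup>2)
      = (\<Sum>k\<in>E2. \<Sum>z\<in>E2. 1 / (sin \<theta>)\<^sup>2 * ((if z = k then (\<alpha> (J x))\<^sup>2 else 0) + (\<alpha> x)\<^sup>2 * (t z k)\<^sup>2))"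
      by (intro sum.cong refl) simp
    also have "\<dots> = (\<Sum>k\<in>E2. 1 / (sin \<theta>)\<^sup>2 * ((\<alpha> (J x))\<^sup>2 + (\<alpha> x)\<^sup>2 * (cos \<theta>)\<^sup>2))"
      by (intro sum.cong refl)
         (simp add: sum_distrib_left[symmetric] sum_divide_distrib[symmetric] sum.distrib t2 fin)
    finally show ?thesis using E2(3) by simp
  qed
  have mixed_sum: "(\<Sum>x\<in>E1. \<Sum>k\<in>E2. \<Sum>z\<in>E2. (g (H x z) (\<nu> k))\<^sup>2)
      = real (dim D2) * ((1 / sin \<theta>)\<^sup>2 + (cot \<theta>)\<^sup>2) * G w w"
  proof -
    have "(\<Sum>x\<in>E1. \<Sum>k\<in>E2. \<Sum>z\<in>E2. (g (H x z) (\<nu> k))\<^sup>2)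
      = (\<Sum>x\<in>E1. real (dim D2) / (sin \<theta>)\<^sup>2 * ((\<alpha> (J x))\<^sup>2 + (\<alpha> x)\<^sup>2 * (cos \<theta>)\<^sup>2))"
      by (intro sum.cong refl mixed)
    also have "\<dots> = real (dim D2) / (sin \<theta>)\<^sup>2 * (G w w + G w w * (cos \<theta>)\<^sup>2)"
      by (simp only: sum_distrib_left[symmetric] sum_distrib_right[symmetric] sum.distrib a1 a2)
    finally show ?thesis by (simp add: cot_def power_divide algebra_simps add_divide_distrib)
  qed
  have swap: "(\<Sum>k\<in>E2. \<Sum>x\<in>E1. \<Sum>z\<in>E2. (g (H x z) (\<nu> k))\<^sup>2)
      = real (dim D2) * ((1 / sin \<theta>)\<^sup>2 + (cot \<theta>)\<^sup>2) * G w w"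
    using mixed_sum by (subst sum.swap) simp
  \<comment> \<open>Symmetry of \<open>H\<close> makes each mixed pair occur as
    \<open>(x, z)\<close> and as \<open>(z, x)\<close>, the origin of the factor 2. The two unmixed
    blocks are nonnegative and are discarded.\<close>
  have nu_part: "(\<Sum>k\<in>E2. \<Sum>e\<in>Eo. \<Sum>f\<in>Eo. (g (H e f) (\<nu> k))\<^sup>2)
      \<ge> 2 * (real (dim D2) * ((1 / sin \<theta>)\<^sup>2 + (cot \<theta>)\<^sup>2) * G w w)"
  proof -
    have "(\<Sum>x\<in>E1. \<Sum>z\<in>E2. (g (H x z) v)\<^sup>2) + (\<Sum>x\<in>E1. \<Sum>z\<in>E2. (g (H x z) v)\<^sup>2)
        \<le> (\<Sum>e\<in>Eo. \<Sum>f\<in>Eo. (g (H e f) v)\<^sup>2)" for v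
    proof -
      have "(\<Sum>e\<in>Eo. \<Sum>f\<in>Eo. (g (H e f) v)\<^sup>2)
        = (\<Sum>x\<in>E1. \<Sum>f\<in>E1. (g (H x f) v)\<^sup>2) + (\<Sum>x\<in>E1. \<Sum>z\<in>E2. (g (H x z) v)\<^sup>2)
        + ((\<Sum>z\<in>E2. \<Sum>x\<in>E1. (g (H z x) v)\<^sup>2) + (\<Sum>z\<in>E2. \<Sum>f\<in>E2. (g (H z f) v)\<^sup>2))"
        unfolding Eo_def by (simp add: sum.union_disjoint[OF fin disj] sum.distrib)
      moreover have "(\<Sum>z\<in>E2. \<Sum>x\<in>E1. (g (H z x) v)\<^sup>2) = (\<Sum>x\<in>E1. \<Sum>z\<in>E2. (g (H x z) v)\<^sup>2)"
        by (subst sum.swap) (simp add: H(2))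
      moreover have "0 \<le> (\<Sum>x\<in>E1. \<Sum>f\<in>E1. (g (H x f) v)\<^sup>2)" "0 \<le> (\<Sum>z\<in>E2. \<Sum>f\<in>E2. (g (H z f) v)\<^sup>2)"
        by (intro sum_nonneg; simp)+
      ultimately show ?thesis by linarith
    qed
    then have "(\<Sum>k\<in>E2. (\<Sum>x\<in>E1. \<Sum>z\<in>E2. (g (H x z) (\<nu> k))\<^sup>2) + (\<Sum>x\<in>E1. \<Sum>z\<in>E2. (g (H x z) (\<nu> k))\<^sup>2))
        \<le> (\<Sum>k\<in>E2. \<Sum>e\<in>Eo. \<Sum>f\<in>Eo. (g (H e f) (\<nu> k))\<^sup>2)" by (intro sum_mono)
    then show ?thesis unfolding sum.distrib swap by linarith
  qed

  have "(\<Sum>e\<in>E. \<Sum>f\<in>E. g (H e f - P (H e f)) (H e f - P (H e f)))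
      \<ge> (\<Sum>e\<in>E. \<Sum>f\<in>E. \<Sum>k\<in>insert 0 E2. (g (H e f) (\<nu> k))\<^sup>2)"
    by (intro sum_mono bess)
  also have "(\<Sum>e\<in>E. \<Sum>f\<in>E. \<Sum>k\<in>insert 0 E2. (g (H e f) (\<nu> k))\<^sup>2)
      = (\<Sum>e\<in>E. \<Sum>k\<in>insert 0 E2. \<Sum>f\<in>E. (g (H e f) (\<nu> k))\<^sup>2)"
    by (intro sum.cong refl sum.swap)
  also have "\<dots> = (\<Sum>k\<in>insert 0 E2. \<Sum>e\<in>E. \<Sum>f\<in>E. (g (H e f) (\<nu> k))\<^sup>2)"
    by (rule sum.swap)
  \<comment> \<open>With \<open>k\<close> outermost, each inner double sum is the norm of a scalar
    bilinear form, so the basis can be changed.\<close>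
  also have "\<dots> = (\<Sum>k\<in>insert 0 E2. \<Sum>e\<in>Eo. \<Sum>f\<in>Eo. (g (H e f) (\<nu> k))\<^sup>2)"
    using E'(2) spanEo
    by (intro sum.cong refl bilinear_norm_basis_independent[OF G bil E'(1) Eo]) simp
  also have "\<dots> = (\<Sum>e\<in>Eo. \<Sum>f\<in>Eo. (g (H e f) \<xi>)\<^sup>2) + (\<Sum>k\<in>E2. \<Sum>e\<in>Eo. \<Sum>f\<in>Eo. (g (H e f) (\<nu> k))\<^sup>2)"
    using fin z2 by (simp add: \<nu>_def[THEN fun_cong, of 0])
  finally show ?thesis using xi_part nu_part a3 by simp
qed

subsection \<open>Product manifolds\<close>

lemma smooth_on_map_prod:
  fixes f :: "'a::euclidean_space \<Rightarrow> 'c::euclidean_space" and h :: "'b::euclidean_space \<Rightarrow>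
      'd::euclidean_space"
  assumes "open S" "open T" "smooth_on S f" "smooth_on T h"
  shows "smooth_on (S \<times> T) (map_prod f h)"
proof -
  have o: "open (S \<times> T)" using assms open_Times by blast
  have "smooth_on (S \<times> T) (\<lambda>x. ((f \<circ> fst) x, (h \<circ> snd) x))"
    by (intro smooth_on_Pair o smooth_on_compose[OF o assms(1) _ _ assms(3)]
        smooth_on_compose[OF o assms(2) _ _ assms(4)] smooth_on_linear[OF o]
        bounded_linear_fst bounded_linear_snd) auto
  then show ?thesis by (rule smooth_on_cong[OF o, rotated]) auto
qed

lemma prod_chart_simps [simp]:
  "fst (prod_chart c d) = fst c \<times> fst d" "snd (prod_chart c d) = map_prod (snd c) (snd d)"
  by (simp_all add: prod_chart_def)

lemma atlas_prod_mfd: "atlas (prod_mfd B F) = {prod_chart c d | c d. c \<in> atlas B \<and> d \<in> atlas F}"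
  by (simp add: prod_mfd_def)

lemma chart_at_prod_mfd: "chart_at (prod_mfd B F) (b, x) = prod_chart (chart_at B b) (chart_at F x)"
  by (simp add: prod_mfd_def)

lemma cinv_prod_chart:
  assumes "is_chart c" "is_chart d" "s \<in> snd c ` fst c" "t \<in> snd d ` fst d"
  shows "cinv (prod_chart c d) (s, t) = (cinv c s, cinv d t)"
proof -
  note c = chart_props[OF assms(1)] and d = chart_props[OF assms(2)]
  have "inj_on (map_prod (snd c) (snd d)) (fst c \<times> fst d)" by (rule map_prod_inj_on[OF c(3) d(3)])
  moreover have "(cinv c s, cinv d t) \<in> fst c \<times> fst d" using c(5) d(5) assms by simp
  moreover have "map_prod (snd c) (snd d) (cinv c s, cinv d t) = (s, t)" using c(6) d(6) assms by simp
  ultimately show ?thesis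
    unfolding cinv_def[of "prod_chart c d"] prod_chart_simps by (rule inv_into_f_eq)
qed

lemma is_chart_prod_chart:
  assumes "is_chart c" "is_chart d"
  shows "is_chart (prod_chart c d)"
proof -
  note c = chart_props[OF assms(1)] and d = chart_props[OF assms(2)]
  have im: "snd (prod_chart c d) ` fst (prod_chart c d) = (snd c ` fst c) \<times> (snd d ` fst d)" by auto
  have "continuous_on (snd c ` fst c \<times> snd d ` fst d) (cinv (prod_chart c d))"
  proof (rule continuous_on_eq)
    show "continuous_on (snd c ` fst c \<times> snd d ` fst d) (\<lambda>u. (cinv c (fst u), cinv d (snd u)))"
      by (intro continuous_on_Pair continuous_on_compose2[OF c(8)] continuous_on_compose2[OF d(8)]
          continuous_on_fst continuous_on_snd continuous_on_id) auto
  qed (use cinv_prod_chart[OF assms] in auto)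
  moreover have "continuous_on (fst c \<times> fst d) (map_prod (snd c) (snd d))"
    unfolding map_prod_def case_prod_beta
    by (intro continuous_on_Pair continuous_on_compose2[OF c(7)] continuous_on_compose2[OF d(7)]
        continuous_on_fst continuous_on_snd continuous_on_id) auto
  moreover have inv: "cinv (prod_chart c d) (map_prod (snd c) (snd d) q) = q" if "q \<in> fst c \<times> fst d"
      for q
    using that by (auto simp: cinv_prod_chart[OF assms] c(4) d(4))
  moreover have "cinv (prod_chart c d) ` (snd c ` fst c \<times> snd d ` fst d) = fst c \<times> fst d"
  proof -
    have "cinv (prod_chart c d) ` (map_prod (snd c) (snd d) ` (fst c \<times> fst d)) = (\<lambda>q. q) ` (fst c \<times>
        fst d)"
      unfolding image_image by (rule image_cong[OF refl inv])
    then show ?thesis using im by simp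
  qed
  moreover have "map_prod (snd c) (snd d) (cinv (prod_chart c d) u) = u"
    if "u \<in> snd c ` fst c \<times> snd d ` fst d" for u
    using that by (auto simp: cinv_prod_chart[OF assms] c(4) d(4))
  ultimately show ?thesis
    unfolding is_chart_def homeomorphism_def im
    using c(1,2) d(1,2) im by (auto intro!: open_Times)
qed

lemma prod_chart_change:
  assumes "is_chart c" "is_chart d" "s \<in> snd c ` fst c" "t \<in> snd d ` fst d"
  shows "(snd (prod_chart c' d') \<circ> cinv (prod_chart c d)) (s, t)
    = map_prod (snd c' \<circ> cinv c) (snd d' \<circ> cinv d) (s, t)"
  using cinv_prod_chart[OF assms] by simp

context
  fixes B :: "('b::{t2_space,second_countable_topology}, 'eb::euclidean_space) mfd"
    and F :: "('f::{t2_space,second_countable_topology}, 'ef::euclidean_space) mfd"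
  assumes B: "smooth_manifold B" and F: "smooth_manifold F"
begin

lemma smooth_manifold_prod_mfd: "smooth_manifold (prod_mfd B F)"
  unfolding smooth_manifold_def
proof (intro conjI ballI allI)
  fix c assume "c \<in> atlas (prod_mfd B F)"
  then show "is_chart c"
    using atlas_is_chart[OF B] atlas_is_chart[OF F] by (auto simp: atlas_prod_mfd intro:
        is_chart_prod_chart)
next
  fix p
  show "chart_at (prod_mfd B F) p \<in> atlas (prod_mfd B F)"
  proof (cases p)
    case (Pair b x)
    show ?thesis
      using chart_at_atlas(1)[OF B, of b] chart_at_atlas(1)[OF F, of x]
      unfolding Pair chart_at_prod_mfd atlas_prod_mfd by blast
  qed
  show "p \<in> fst (chart_at (prod_mfd B F) p)"
    by (cases p) (use chart_at_atlas[OF B] chart_at_atlas[OF F] in \<open>auto simp: chart_at_prod_mfd\<close>)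
next
  fix c d assume "c \<in> atlas (prod_mfd B F)" "d \<in> atlas (prod_mfd B F)"
  then obtain c1 c2 d1 d2 where c: "c = prod_chart c1 c2" "c1 \<in> atlas B" "c2 \<in> atlas F"
    and d: "d = prod_chart d1 d2" "d1 \<in> atlas B" "d2 \<in> atlas F"
    by (auto simp: atlas_prod_mfd)
  note ch = atlas_is_chart[OF B c(2)] atlas_is_chart[OF F c(3)]
  let ?S = "snd c1 ` (fst c1 \<inter> fst d1)" and ?T = "snd c2 ` (fst c2 \<inter> fst d2)"
  have o: "open ?S" "open ?T"
    using open_chart_image[OF ch(1) open_chart_dom[OF B d(2)]]
      open_chart_image[OF ch(2) open_chart_dom[OF F d(3)]] by auto
  have im: "snd c ` (fst c \<inter> fst d) = ?S \<times> ?T"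
    by (auto simp: c d)
  show "smooth_on (snd c ` (fst c \<inter> fst d)) (snd d \<circ> cinv c)"
    unfolding im
  proof (rule smooth_on_cong[OF open_Times[OF o] _ smooth_on_map_prod[OF o
        smooth_on_chart_change[OF B c(2) d(2)] smooth_on_chart_change[OF F c(3) d(3)]]])
    fix u assume "u \<in> ?S \<times> ?T"
    then show "map_prod (snd d1 \<circ> cinv c1) (snd d2 \<circ> cinv c2) u = (snd d \<circ> cinv c) u"
      using prod_chart_change[OF ch, of "fst u" "snd u" d1 d2] by (auto simp: c d)
  qed
qed

text \<open>Transition maps between product charts act factorwise, so their Jacobians are block
  diagonal. Hence vectors tangent to base or fibre stay so when extended with constant
  coordinates.\<close>

lemma coord_field_prod_mfd:
  assumes "c \<in> atlas B" "d \<in> atlas F" "b \<in> fst c" "x \<in> fst d"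
  shows "coord_field (prod_mfd B F) (prod_chart c d) (a1, a2) (b, x)
    = (coord_field B c a1 b, coord_field F d a2 x)"
proof -
  note ch = atlas_is_chart[OF B assms(1)] atlas_is_chart[OF F assms(2)]
  note Bc = chart_at_atlas[OF B, of b] and Fc = chart_at_atlas[OF F, of x]
  let ?f = "snd (chart_at B b) \<circ> cinv c" and ?h = "snd (chart_at F x) \<circ> cinv d"
  let ?u = "(snd c b, snd d x)"
  have "((\<lambda>u. (?f (fst u), ?h (snd u))) has_derivative
      (\<lambda>v. (chart_change_deriv c (chart_at B b) b (fst v), chart_change_deriv d (chart_at F x) x
          (snd v))))
      (at ?u)"
  proof (rule has_derivative_Pair)
    show "((\<lambda>u. ?f (fst u)) has_derivative (\<lambda>v. chart_change_deriv c (chart_at B b) b (fst v))) (at ?u)"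
      using diff_chain_at[OF bounded_linear_imp_has_derivative[OF bounded_linear_fst], of ?f _ ?u]
        chart_change_has_derivative[OF B assms(1) Bc(1) assms(3) Bc(2)] by (simp add: o_def)
    show "((\<lambda>u. ?h (snd u)) has_derivative (\<lambda>v. chart_change_deriv d (chart_at F x) x (snd v))) (at ?u)"
      using diff_chain_at[OF bounded_linear_imp_has_derivative[OF bounded_linear_snd], of ?h _ ?u]
        chart_change_has_derivative[OF F assms(2) Fc(1) assms(4) Fc(2)] by (simp add: o_def)
  qed
  then have "(snd (prod_chart (chart_at B b) (chart_at F x)) \<circ> cinv (prod_chart c d) has_derivative
      (\<lambda>v. (chart_change_deriv c (chart_at B b) b (fst v), chart_change_deriv d (chart_at F x) x
          (snd v))))
      (at ?u)"
    by (rule has_derivative_transform_within_open[OF _ open_Times[OF chart_props(2)[OF ch(1)]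
        chart_props(2)[OF ch(2)]]])
       (use assms in \<open>auto simp: cinv_prod_chart[OF ch]\<close>)
  from fun_cong[OF frechet_derivative_at[OF this], of "(a1, a2)"] show ?thesis
    by (simp only: coord_field_eq chart_at_prod_mfd chart_change_deriv_def[of "prod_chart c d"]
        prod_chart_simps map_prod_simp fst_conv snd_conv)
qed

end

lemma has_derivative_along_line:
  assumes "(h has_derivative D) (at u)"
  shows "((\<lambda>s. h (u + s *\<^sub>R v)) has_derivative (\<lambda>s. D (s *\<^sub>R v))) (at 0)"
proof -
  have 1: "((\<lambda>s. u + s *\<^sub>R v) has_derivative (\<lambda>s. s *\<^sub>R v)) (at 0)"
    by (auto intro!: derivative_eq_intros)
  have 2: "(h has_derivative D) (at (u + 0 *\<^sub>R v))" using assms by simp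
  show ?thesis using diff_chain_at[OF 1 2] by (simp add: o_def)
qed

text \<open>Evaluates a derivative in one direction when \<open>h\<close> is known explicitly only
  along the line in that direction, as the metric coefficients of the warped product are.\<close>

lemma has_derivative_along_line_eq:
  assumes "(h has_derivative D) (at u)" "(k has_real_derivative d) (at 0)"
    and "open U" "u \<in> U" "\<And>s. u + s *\<^sub>R v \<in> U \<Longrightarrow> h (u + s *\<^sub>R v) = k s"
  shows "D v = (d :: real)"
proof -
  have "isCont (\<lambda>s. u + s *\<^sub>R v) 0" by (intro continuous_intros)
  then have "open ((\<lambda>s. u + s *\<^sub>R v) -` U)"
    using continuous_on_open_vimage[of UNIV "\<lambda>s. u + s *\<^sub>R v"] assms(3)
    by (auto intro!: continuous_intros)
  then have "(k has_derivative (\<lambda>s. D (s *\<^sub>R v))) (at 0)"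
    by (rule has_derivative_transform_within_open[OF has_derivative_along_line[OF assms(1), of v]])
       (use assms(4,5) in auto)
  from has_derivative_unique[OF this assms(2)[unfolded has_field_derivative_def]]
  show ?thesis by (metis mult.right_neutral scaleR_one)
qed

subsection \<open>Submanifolds normal to the Reeb field and warped products\<close>

text \<open>The image of a chart domain need not lie in one chart of \<open>N\<close>, so smoothness
  is checked near each \<open>q\<close>, in the preferred chart at \<open>\<iota> q\<close>.\<close>

lemma smooth_fun_on_comp_map:
  assumes M: "smooth_manifold M" and N: "smooth_manifold N" and \<iota>: "smooth_map M N \<iota>"
    and h: "smooth_fun_on N U h"
  shows "smooth_fun_on M (\<iota> -` U) (\<lambda>q. h (\<iota> q))"
  unfolding smooth_fun_on_def
proof (intro conjI ballI smooth_on_local)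
  have U: "open U" using h by (simp add: smooth_fun_on_def)
  then show "open (\<iota> -` U)" by (rule open_vimage_map[OF M N \<iota>])
  fix c t assume c: "c \<in> atlas M" and "t \<in> snd c ` (fst c \<inter> \<iota> -` U)"
  then obtain q where q: "q \<in> fst c" "\<iota> q \<in> U" "t = snd c q" by auto
  define e where "e = chart_at N (\<iota> q)"
  have e: "e \<in> atlas N" "\<iota> q \<in> fst e" using chart_at_atlas[OF N] by (simp_all add: e_def)
  note cp = chart_props[OF atlas_is_chart[OF M c]] and ep = chart_props[OF atlas_is_chart[OF N e(1)]]
  define T where "T = snd c ` (fst c \<inter> \<iota> -` (fst e \<inter> U))"
  have T: "open T"
    unfolding T_def by (rule open_map_chart_dom[OF M N \<iota> c open_Int[OF ep(1) U]])
  have "smooth_on T ((h \<circ> cinv e) \<circ> (snd e \<circ> \<iota> \<circ> cinv c))"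
    by (rule smooth_on_compose[OF T open_chart_image[OF atlas_is_chart[OF N e(1)] U] _
          smooth_on_subset[OF smooth_on_map[OF M N \<iota> c e(1)]] smooth_fun_on_chart[OF N h e(1)]])
       (use cp in \<open>auto simp: T_def\<close>)
  then have "smooth_on T ((\<lambda>q. h (\<iota> q)) \<circ> cinv c)"
    by (rule smooth_on_cong[OF T, rotated]) (use cp ep in \<open>auto simp: T_def\<close>)
  then show "\<exists>T. open T \<and> t \<in> T \<and> smooth_on T ((\<lambda>q. h (\<iota> q)) \<circ> cinv c)"
    using T q e by (intro exI[of _ T]) (auto simp: T_def)
qed

section \<open>Submanifolds to which the Reeb field is normal\<close>

context
  fixes N :: "('n::{t2_space,second_countable_topology}, 'en::euclidean_space) mfd"
    and M :: "('m::{t2_space,second_countable_topology}, 'em::euclidean_space) mfd"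
    and \<phi> \<xi> \<eta> g cd \<iota>
  assumes lc: "levi_civita N g cd" and ken: "kenmotsu N \<phi> \<xi> \<eta> g cd"
    and M: "smooth_manifold M" and imm: "immersion M N \<iota>"
    and xi: "\<And>p. \<xi> (\<iota> p) \<in> normal_bundle M N \<iota> g p"
begin

lemma imm_facts:
  "smooth_manifold N" "smooth_map M N \<iota>" "affine_connection N cd" "torsion_free N cd"
  "metric_connection N g cd" "riemannian_metric N g" "almost_contact_metric N \<phi> \<xi> \<eta> g"
  "inner_form (g q)" "linear (dmap M N \<iota> p)"
proof -
  note acm = kenmotsu_acm[OF lc ken] and conn = kenmotsu_connection[OF lc ken]
  show \<iota>: "smooth_map M N \<iota>" using imm by (simp add: immersion_def)
  show N: "smooth_manifold N" and "affine_connection N cd" "torsion_free N cd"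
    "metric_connection N g cd" "almost_contact_metric N \<phi> \<xi> \<eta> g" using acm conn by simp_all
  show "riemannian_metric N g"
    using acm by (simp add: almost_contact_metric_def riemannian_manifold_def)
  show "inner_form (g q)" using acm_basics(3-5)[OF acm] by (auto simp: inner_form_def)
  show "linear (dmap M N \<iota> p)" by (rule dmap_linear[OF M N \<iota>])
qed

lemma induced_metric_inner_form: "inner_form (induced_metric M N \<iota> g p)"
proof -
  note L = imm_facts(9)[of p] and g = imm_facts(8)[of "\<iota> p"]
  \<comment> \<open>Injectivity of the differential gives positive definiteness.\<close>
  have "dmap M N \<iota> p u \<noteq> 0" if "u \<noteq> 0" for u
    using imm that linear_0[OF L] unfolding immersion_def inj_def by metis
  then show ?thesis
    unfolding inner_form_def bilinear_def induced_metric_def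
    using inner_form_pos[OF g] inner_form_sym[OF g]
      linear_compose[OF L inner_form_linear(1)[OF g]] linear_compose[OF L inner_form_linear(2)[OF g]]
    by (auto simp: o_def)
qed

lemma xi_normal: "g (\<iota> p) (dmap M N \<iota> p v) (\<xi> (\<iota> p)) = 0" "g (\<iota> p) (\<xi> (\<iota> p)) (dmap M N \<iota> p v) = 0"
  using xi[of p] inner_form_sym[OF imm_facts(8)] by (auto simp: normal_bundle_def orth_compl_def)

lemma eta_dmap: "\<eta> (\<iota> p) (dmap M N \<iota> p v) = 0"
  using metric_xi[OF imm_facts(7)] xi_normal by metis

lemma normal_part_metric_xi: "g (\<iota> p) (normal_part M N \<iota> g p v) (\<xi> (\<iota> p)) = g (\<iota> p) v (\<xi> (\<iota> p))"
proof -
  obtain u where "orth_proj (g (\<iota> p)) (range (dmap M N \<iota> p)) v = dmap M N \<iota> p u"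
    using orth_proj_properties(1)[OF imm_facts(8) linear_subspace_image[OF imm_facts(9)
        subspace_UNIV]] by blast
  then show ?thesis by (simp add: normal_part_def inner_form_simps[OF imm_facts(8)] xi_normal)
qed

text \<open>The product of a tangent field with \<xi> is identically 0, and differentiating it moves
  the derivative onto \<xi>. By \<open>cd_xi\<close>, \<xi> has derivative equal to the direction
  itself, since \<eta> vanishes on tangent vectors.\<close>

lemma cd_along_metric_xi:
  assumes "smooth_vf_on M U X" "p \<in> U"
  shows "g (\<iota> p) (cd_along M N \<iota> cd p x (\<lambda>q. dmap M N \<iota> q (X q))) (\<xi> (\<iota> p))
    = - induced_metric M N \<iota> g p x (X p)"
proof -
  note f = imm_facts
  note xiv = cd_along_pullback[OF M f(1,2,3) smooth_vf_on_xi[OF f(7)] UNIV_I]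
  have "((\<lambda>q. 0) \<circ> cinv (chart_at M p) has_derivative
    (\<lambda>x. g (\<iota> p) (cd_along M N \<iota> cd p x (\<lambda>q. dmap M N \<iota> q (X q))) (\<xi> (\<iota> p))
      + g (\<iota> p) (dmap M N \<iota> p (X p)) (cd_along M N \<iota> cd p x (\<lambda>q. \<xi> (\<iota> q)))))
    (at (snd (chart_at M p) p))"
    using cd_along_metric[OF M f(1,2,3,5,6) differentiable_along_dmap[OF M f(1,2) assms] xiv(1)]
    by (simp add: xi_normal)
  moreover have "((\<lambda>q. 0) \<circ> cinv (chart_at M p) has_derivative (\<lambda>x. 0)) (at (snd (chart_at M p) p))"
    by (simp add: o_def)
  from fun_cong[OF has_derivative_unique[OF calculation this], of x]
  have "g (\<iota> p) (cd_along M N \<iota> cd p x (\<lambda>q. dmap M N \<iota> q (X q))) (\<xi> (\<iota> p))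
      + g (\<iota> p) (dmap M N \<iota> p (X p)) (cd_along M N \<iota> cd p x (\<lambda>q. \<xi> (\<iota> q))) = 0"
    .
  then show ?thesis
    by (simp add: xiv(2) cd_xi[OF lc ken] eta_dmap induced_metric_def inner_form_sym[OF f(8), of _
        "dmap M N \<iota> p (X p)"])
qed

lemma second_ff_metric_xi:
  "smooth_vf_on M U Y \<Longrightarrow> p \<in> U \<Longrightarrow>
    g (\<iota> p) (second_ff M N \<iota> g cd X Y p) (\<xi> (\<iota> p)) = - induced_metric M N \<iota> g p (X p) (Y p)"
  by (simp add: second_ff_def normal_part_metric_xi cd_along_metric_xi)

lemma cd_coord_metric_xi:
  "g (\<iota> p) (cd_coord M N \<iota> cd p x y) (\<xi> (\<iota> p)) = - induced_metric M N \<iota> g p x y"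
  using cd_along_metric_xi[OF smooth_vf_on_coord_field[OF M chart_at_atlas(1)[OF M, of p]]
      chart_at_atlas(2)[OF M]]
  by (simp add: cd_coord_def coord_field_chart_at[OF M])

lemma cd_coord_bilinear: "bilinear (cd_coord M N \<iota> cd p)"
  unfolding bilinear_def
  using cd_coord_linear[OF M imm_facts(1,2,3)] cd_coord_symmetric[OF M imm_facts(1-4)] by simp

lemma second_ff_at_eq:
  "second_ff_at M N \<iota> g cd p x y = cd_coord M N \<iota> cd p x y
    - orth_proj (g (\<iota> p)) (range (dmap M N \<iota> p)) (cd_coord M N \<iota> cd p x y)"
  by (simp add: second_ff_at_def second_ff_def normal_part_def cd_coord_def coord_field_chart_at[OF M])

end

section \<open>Warped product pointwise semi-slant submanifolds\<close>

context
  fixes N :: "('n::{t2_space,second_countable_topology}, 'en::euclidean_space) mfd"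
    and B :: "('b::{t2_space,second_countable_topology}, 'eb::euclidean_space) mfd"
    and F :: "('f::{t2_space,second_countable_topology}, 'ef::euclidean_space) mfd"
    and \<phi> \<xi> \<eta> g cd gB gF \<iota> \<theta> and f :: "'b \<Rightarrow> real"
    and M :: "('b \<times> 'f, 'eb \<times> 'ef) mfd"
  assumes lc: "levi_civita N g cd" and ken: "kenmotsu N \<phi> \<xi> \<eta> g cd"
    and B: "riemannian_manifold B gB" and F: "riemannian_manifold F gF"
    and f: "smooth_fun_on B UNIV f" "\<And>b. f b > 0"
    and M_def: "M = prod_mfd B F"
    and ind: "induced_metric M N \<iota> g = warped_metric gB gF f"
    and ss: "pointwise_semi_slant M N \<iota> \<phi> g tan_base tan_fibre \<theta>" and proper: "proper_semi_slant \<theta>"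
    and xi: "\<And>p. \<xi> (\<iota> p) \<in> normal_bundle M N \<iota> g p"
begin

lemma manifolds: "smooth_manifold B" "smooth_manifold F" "smooth_manifold M"
  using B F smooth_manifold_prod_mfd by (auto simp: riemannian_manifold_def M_def)

lemma imm: "immersion M N \<iota>"
  using ss by (simp add: pointwise_semi_slant_def)

lemmas wfacts = imm_facts[OF lc ken manifolds(3) imm xi]

lemma fibre_metric_linear: "linear (gF x u)" "linear (\<lambda>u. gF x u v)"
  using F by (auto simp: riemannian_manifold_def riemannian_metric_def bilinear_def)

lemma base_metric_linear: "linear (gB x u)" "linear (\<lambda>u. gB x u v)"
  using B by (auto simp: riemannian_manifold_def riemannian_metric_def bilinear_def)

lemma chart_at_M: "chart_at M (b, x) = prod_chart (chart_at B b) (chart_at F x)"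
  by (simp add: M_def chart_at_prod_mfd)

lemma coord_field_M:
  assumes "(b', x') \<in> fst (chart_at M (b, x))"
  shows "coord_field M (chart_at M (b, x)) (y1, y2) (b', x')
    = (coord_field B (chart_at B b) y1 b', coord_field F (chart_at F x) y2 x')"
  unfolding chart_at_M unfolding M_def
  by (rule coord_field_prod_mfd[OF manifolds(1,2) chart_at_atlas(1)[OF manifolds(1)]
      chart_at_atlas(1)[OF manifolds(2)]])
     (use assms in \<open>auto simp: chart_at_M\<close>)

lemma coord_field_tangent:
  assumes "q \<in> fst (chart_at M p)"
  shows "y \<in> tan_base p \<Longrightarrow> coord_field M (chart_at M p) y q \<in> tan_base q"
    and "y \<in> tan_fibre p \<Longrightarrow> coord_field M (chart_at M p) y q \<in> tan_fibre q"
proof -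
  obtain b x b' x' y1 y2 where e: "p = (b, x)" "q = (b', x')" "y = (y1, y2)"
    by (cases p, cases q, cases y) auto
  have q: "b' \<in> fst (chart_at B b)" "x' \<in> fst (chart_at F x)" using assms by (auto simp: e chart_at_M)
  show "y \<in> tan_base p \<Longrightarrow> coord_field M (chart_at M p) y q \<in> tan_base q"
    using coord_field_M assms linear_0[OF coord_field_linear[OF manifolds(2) chart_at_atlas(1)[OF
        manifolds(2)] q(2)]]
    by (auto simp: e tan_base_def)
  show "y \<in> tan_fibre p \<Longrightarrow> coord_field M (chart_at M p) y q \<in> tan_fibre q"
    using coord_field_M assms linear_0[OF coord_field_linear[OF manifolds(1) chart_at_atlas(1)[OF
        manifolds(1)] q(1)]]
    by (auto simp: e tan_fibre_def)
qed

lemma base_fibre_orthogonal: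
  "x \<in> tan_base p \<Longrightarrow> z \<in> tan_fibre p \<Longrightarrow> induced_metric M N \<iota> g p x z = 0"
  by (auto simp: ind warped_metric_def tan_base_def tan_fibre_def
      linear_0[OF base_metric_linear(1)] linear_0[OF fibre_metric_linear(2)])

text \<open>The coordinate extensions of \<open>x\<close> and \<open>z\<close> are orthogonal
  throughout the chart, so the derivative of their product vanishes in every direction
  \<open>v\<close>.\<close>

lemma cd_coord_base_fibre:
  assumes "x \<in> tan_base p" "z \<in> tan_fibre p"
  shows "g (\<iota> p) (cd_coord M N \<iota> cd p v x) (dmap M N \<iota> p z)
    + g (\<iota> p) (dmap M N \<iota> p x) (cd_coord M N \<iota> cd p v z) = 0"
proof -
  let ?c = "chart_at M p"
  note c = chart_at_atlas[OF manifolds(3), of p]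
  note cp = chart_props[OF atlas_is_chart[OF manifolds(3) c(1)]]
  show ?thesis
  proof (rule has_derivative_along_line_eq[OF cd_coord_metric[OF manifolds(3) wfacts(1,2,3,5,6)]
          DERIV_const cp(2)])
    show "snd ?c p \<in> snd ?c ` fst ?c" using c by blast
    fix s assume "snd ?c p + s *\<^sub>R v \<in> snd ?c ` fst ?c"
    from cp(5)[OF this] show "((\<lambda>q. induced_metric M N \<iota> g q (coord_field M ?c x q)
        (coord_field M ?c z q)) \<circ> cinv ?c) (snd ?c p + s *\<^sub>R v) = 0"
      using base_fibre_orthogonal coord_field_tangent assms by simp
  qed
qed

lemma warping_has_derivative:
  "(f \<circ> cinv (chart_at B b) has_derivative (\<lambda>v. dir_deriv B b v f)) (at (snd (chart_at B b) b))"
  by (rule dir_deriv_has_derivative[OF manifolds(1) f(1) UNIV_I])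

lemma ln_warping_has_derivative:
  "((\<lambda>q. ln (f (fst q))) \<circ> cinv (chart_at M (b, x)) has_derivative (\<lambda>v. dir_deriv B b (fst v) f / f b))
    (at (snd (chart_at M (b, x)) (b, x)))"
proof -
  let ?c = "chart_at B b" and ?d = "chart_at F x"
  note c = chart_at_atlas[OF manifolds(1), of b] and d = chart_at_atlas[OF manifolds(2), of x]
  note ch = atlas_is_chart[OF manifolds(1) c(1)] atlas_is_chart[OF manifolds(2) d(1)]
  note cp = chart_props[OF ch(1)] and dp = chart_props[OF ch(2)]
  have fb: "(f \<circ> cinv ?c) (snd ?c b) = f b" using cp(4)[OF c(2)] by simp
  have "((\<lambda>u. (f \<circ> cinv ?c) (fst u)) has_derivative (\<lambda>v. dir_deriv B b (fst v) f)) (at (snd ?c b,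
      snd ?d x))"
    using diff_chain_at[OF bounded_linear_imp_has_derivative[OF bounded_linear_fst],
        of "f \<circ> cinv ?c" _ "(snd ?c b, snd ?d x)"] warping_has_derivative[of b] by (simp add: o_def)
  from has_derivative_ln[OF _ this] have
    "((\<lambda>u. ln ((f \<circ> cinv ?c) (fst u))) has_derivative (\<lambda>v. dir_deriv B b (fst v) f / f b)) (at (snd
        ?c b, snd ?d x))"
    using f(2)[of b] fb by (simp add: divide_inverse)
  then have "((\<lambda>q. ln (f (fst q))) \<circ> cinv (prod_chart ?c ?d) has_derivative (\<lambda>v. dir_deriv B b (fst
      v) f / f b))
      (at (snd ?c b, snd ?d x))"
    by (rule has_derivative_transform_within_open[OF _ open_Times[OF cp(2) dp(2)]])
       (use c d in \<open>auto simp: cinv_prod_chart[OF ch]\<close>)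
  then show ?thesis by (simp add: chart_at_M)
qed

lemma dir_deriv_ln_warping:
  "dir_deriv M (b, x) v (\<lambda>q. ln (f (fst q))) = dir_deriv B b (fst v) f / f b"
  using frechet_derivative_at[OF ln_warping_has_derivative] unfolding dir_deriv_def by metis

lemma dir_deriv_ln_warping_linear: "linear (\<lambda>v. dir_deriv M p v (\<lambda>q. ln (f (fst q))))"
  by (cases p) (use has_derivative_linear[OF ln_warping_has_derivative] in \<open>simp add:
      dir_deriv_ln_warping\<close>)

lemma dir_deriv_ln_warping_fibre:
  "z \<in> tan_fibre p \<Longrightarrow> dir_deriv M p z (\<lambda>q. ln (f (fst q))) = 0"
  by (cases p) (auto simp: dir_deriv_ln_warping tan_fibre_def
      linear_0[OF has_derivative_linear[OF warping_has_derivative]])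

text \<open>Along a coordinate line in a base direction the fibre point does not move, so the metric
  coefficient is f^2 times a constant. Its derivative 2 f df is 2 d(ln f) times the
  coefficient.\<close>

lemma cd_coord_fibre_metric:
  assumes "v \<in> tan_base p" "z \<in> tan_fibre p" "w \<in> tan_fibre p"
  shows "g (\<iota> p) (cd_coord M N \<iota> cd p v z) (dmap M N \<iota> p w)
    + g (\<iota> p) (dmap M N \<iota> p z) (cd_coord M N \<iota> cd p v w)
    = 2 * dir_deriv M p v (\<lambda>q. ln (f (fst q))) * induced_metric M N \<iota> g p z w"
proof -
  obtain b x v1 z2 w2 where e: "p = (b, x)" "v = (v1, 0)" "z = (0, z2)" "w = (0, w2)"
    using assms by (cases p) (auto simp: tan_base_def tan_fibre_def)
  let ?c = "chart_at B b" and ?d = "chart_at F x" and ?C = "chart_at M (b, x)"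
  note Mc = chart_at_atlas[OF manifolds(3), of "(b, x)"]
  note c = chart_at_atlas[OF manifolds(1), of b] and d = chart_at_atlas[OF manifolds(2), of x]
  note ch = atlas_is_chart[OF manifolds(1) c(1)] atlas_is_chart[OF manifolds(2) d(1)]
  note cp = chart_props[OF ch(1)] and dp = chart_props[OF ch(2)]
  note Cp = chart_props[OF atlas_is_chart[OF manifolds(3) Mc(1)]]
  define k where "k = (\<lambda>s. (f (cinv ?c (snd ?c b + s *\<^sub>R v1)))\<^sup>2 * gF x z2 w2)"
  have fb: "f (cinv ?c (snd ?c b)) = f b" using cp(4)[OF c(2)] by simp
  have lin: "linear (\<lambda>v. dir_deriv B b v f)" using has_derivative_linear[OF warping_has_derivative] .
  have "((\<lambda>s. f (cinv ?c (snd ?c b + s *\<^sub>R v1))) has_real_derivative dir_deriv B b v1 f) (at 0)"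
    using has_derivative_along_line[OF warping_has_derivative, of b v1]
    by (simp add: has_field_derivative_def linear_cmul[OF lin] mult_commute_abs)
  from DERIV_mult[OF DERIV_power[OF this, of 2] DERIV_const[of "gF x z2 w2"]]
  have k: "(k has_real_derivative 2 * f b * dir_deriv B b v1 f * gF x z2 w2) (at 0)"
    unfolding k_def by (simp add: fb mult.commute mult.left_commute)
  have "g (\<iota> (b, x)) (cd_coord M N \<iota> cd (b, x) v z) (dmap M N \<iota> (b, x) w)
      + g (\<iota> (b, x)) (dmap M N \<iota> (b, x) z) (cd_coord M N \<iota> cd (b, x) v w)
    = 2 * f b * dir_deriv B b v1 f * gF x z2 w2"
  proof (rule has_derivative_along_line_eq[OF cd_coord_metric[OF manifolds(3) wfacts(1,2,3,5,6)] k
      Cp(2)])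
    show "snd ?C (b, x) \<in> snd ?C ` fst ?C" using Mc by blast
    fix s assume "snd ?C (b, x) + s *\<^sub>R v \<in> snd ?C ` fst ?C"
    then have u: "snd ?c b + s *\<^sub>R v1 \<in> snd ?c ` fst ?c" by (auto simp: chart_at_M e)
    let ?b = "cinv ?c (snd ?c b + s *\<^sub>R v1)"
    have inv: "cinv ?C (snd ?C (b, x) + s *\<^sub>R v) = (?b, x)"
      using cinv_prod_chart[OF ch u, of "snd ?d x"] d(2) dp(4) by (simp add: chart_at_M e)
    have "(?b, x) \<in> fst ?C" using cp(5)[OF u] d(2) by (simp add: chart_at_M)
    \<comment> \<open>The fibre point is still \<open>x\<close>, where the preferred fibre chart
      represents each vector by itself; so the fibre component is \<open>a\<close> along the whole
      line.\<close>
    from coord_field_M[OF this] have cf: "coord_field M ?C (0, a) (?b, x) = (0, a)" for a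
      using coord_field_chart_at[OF manifolds(2)]
        linear_0[OF coord_field_linear[OF manifolds(1) c(1) cp(5)[OF u]]] by simp
    show "((\<lambda>q. induced_metric M N \<iota> g q (coord_field M ?C z q) (coord_field M ?C w q)) \<circ> cinv ?C)
        (snd ?C (b, x) + s *\<^sub>R v) = k s"
      unfolding o_def inv
      by (simp add: e cf ind warped_metric_def k_def linear_0[OF base_metric_linear(1)])
  qed
  also have "\<dots> = 2 * dir_deriv M p v (\<lambda>q. ln (f (fst q))) * induced_metric M N \<iota> g p z w"
    using f(2)[of b] by (simp add: e dir_deriv_ln_warping ind warped_metric_def
        linear_0[OF base_metric_linear(1)] power2_eq_square)
  finally show ?thesis by (simp add: e)
qed

text \<open>Koszul's formula for the coordinate fields of the warped product.\<close>
lemma cd_coord_mixed_tangential: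
  assumes x: "x \<in> tan_base p" and z: "z \<in> tan_fibre p" and w: "w \<in> tan_fibre p"
  shows "g (\<iota> p) (cd_coord M N \<iota> cd p z x) (dmap M N \<iota> p w)
      = dir_deriv M p x (\<lambda>q. ln (f (fst q))) * induced_metric M N \<iota> g p z w"
    and "g (\<iota> p) (cd_coord M N \<iota> cd p z w) (dmap M N \<iota> p x)
      = - dir_deriv M p x (\<lambda>q. ln (f (fst q))) * induced_metric M N \<iota> g p z w"
proof -
  note sym = cd_coord_symmetric[OF manifolds(3) wfacts(1-4)]
  note gsym = inner_form_sym[OF wfacts(8)]
  let ?g = "g (\<iota> p)" and ?H = "cd_coord M N \<iota> cd p" and ?L = "dmap M N \<iota> p"
  \<comment> \<open>With symmetry of \<open>H\<close>, three linear equations for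
    \<open>?g (?H z x) (?L w)\<close>, \<open>?g (?H w x) (?L z)\<close> and
    \<open>?g (?H z w) (?L x)\<close>: the first two show that the mixed terms agree, the third
    gives their sum.\<close>
  have 1: "?g (?H z x) (?L w) + ?g (?H z w) (?L x) = 0"
    using cd_coord_base_fibre[OF x w, of z] gsym[of _ "?L x"] by simp
  have 2: "?g (?H w x) (?L z) + ?g (?H z w) (?L x) = 0"
    using cd_coord_base_fibre[OF x z, of w] gsym[of _ "?L x"] sym[of p w z] by simp
  have 3: "?g (?H z x) (?L w) + ?g (?H w x) (?L z)
      = 2 * dir_deriv M p x (\<lambda>q. ln (f (fst q))) * induced_metric M N \<iota> g p z w"
    using cd_coord_fibre_metric[OF x z w] gsym[of _ "?L z"] sym[of p x] by simp
  show "?g (?H z x) (?L w) = dir_deriv M p x (\<lambda>q. ln (f (fst q))) * induced_metric M N \<iota> g p z w"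
    and "?g (?H z w) (?L x) = - dir_deriv M p x (\<lambda>q. ln (f (fst q))) * induced_metric M N \<iota> g p z w"
    using 1 2 3 by simp_all
qed

lemma phi_base: "x \<in> tan_base p \<Longrightarrow> \<exists>y\<in>tan_base p. dmap M N \<iota> p y = \<phi> (\<iota> p) (dmap M N \<iota> p x)"
  using ss unfolding pointwise_semi_slant_def by (metis (no_types, lifting) image_subset_iff imageE
      image_eqI)

text \<open>\<open>g(\<phi> d\<iota> X, d\<iota> W)\<close> vanishes for base fields \<open>X\<close> and fibre fields \<open>W\<close>; differentiate it along
  the fibre.\<close>
lemma cd_coord_mixed_phi:
  assumes x: "x \<in> tan_base p" and z: "z \<in> tan_fibre p" and w: "w \<in> tan_fibre p"
    and y: "y \<in> tan_base p" "dmap M N \<iota> p y = \<phi> (\<iota> p) (dmap M N \<iota> p x)"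
  shows "g (\<iota> p) (cd_coord M N \<iota> cd p z x) (\<phi> (\<iota> p) (dmap M N \<iota> p w))
    = - dir_deriv M p y (\<lambda>q. ln (f (fst q))) * induced_metric M N \<iota> g p z w"
proof -
  let ?c = "chart_at M p"
  let ?g = "g (\<iota> p)" and ?H = "cd_coord M N \<iota> cd p" and ?L = "dmap M N \<iota> p" and ?\<phi> = "\<phi> (\<iota> p)"
  note N = wfacts(1) and \<iota> = wfacts(2)
  note c = chart_at_atlas[OF manifolds(3), of p]
  note vf = smooth_vf_on_coord_field[OF manifolds(3) c(1)]
  note gs = inner_form_simps[OF wfacts(8)] and gsym = inner_form_sym[OF wfacts(8)]
  define X where "X = (\<lambda>q. dmap M N \<iota> q (coord_field M ?c x q))"
  define W where "W = (\<lambda>q. dmap M N \<iota> q (coord_field M ?c w q))"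
  have dX: "differentiable_along M N \<iota> p X" and dW: "differentiable_along M N \<iota> p W"
    unfolding X_def W_def by (rule differentiable_along_dmap[OF manifolds(3) N \<iota> vf c(2)])+
  have Xp: "X p = ?L x" "W p = ?L w" by (simp_all add: X_def W_def coord_field_chart_at[OF
      manifolds(3)])
  note phi = cd_along_phi[OF manifolds(3) N \<iota> lc ken dX]
  have "((\<lambda>q. 0) \<circ> cinv ?c has_derivative
    (\<lambda>z. ?g (cd_along M N \<iota> cd p z (\<lambda>q. \<phi> (\<iota> q) (X q))) (W p)
      + ?g (?\<phi> (X p)) (cd_along M N \<iota> cd p z W))) (at (snd ?c p))"
  proof (rule eventually_chart_cong_has_derivative[OF manifolds(3) N \<iota>
        cd_along_metric[OF manifolds(3) wfacts(1,2,3,5,6) phi(1) dW]])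
    fix q assume q: "q \<in> fst ?c"
    obtain y' where "y' \<in> tan_base q" "dmap M N \<iota> q y' = \<phi> (\<iota> q) (X q)"
      using phi_base[OF coord_field_tangent(1)[OF q x]] by (auto simp: X_def)
    then show "g (\<iota> q) (\<phi> (\<iota> q) (X q)) (W q) = 0"
      using base_fibre_orthogonal[OF _ coord_field_tangent(2)[OF q w], of y']
      by (simp add: W_def induced_metric_def)
  qed
  moreover have "((\<lambda>q. 0) \<circ> cinv ?c has_derivative (\<lambda>x. 0)) (at (snd ?c p))"
    by (simp add: o_def)
  from fun_cong[OF has_derivative_unique[OF calculation this], of z]
  have "?g (cd_along M N \<iota> cd p z (\<lambda>q. \<phi> (\<iota> q) (X q))) (W p)
      + ?g (?\<phi> (X p)) (cd_along M N \<iota> cd p z W) = 0"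
    .
  moreover have "cd_along M N \<iota> cd p z X = ?H z x" "cd_along M N \<iota> cd p z W = ?H z w"
    by (simp_all add: cd_coord_def X_def W_def)
  \<comment> \<open>The Kenmotsu corrections vanish here: one is a multiple of \<xi>, paired with a
    tangent vector, the other carries \<eta> of a tangent vector.\<close>
  ultimately have "?g (?\<phi> (?H z x)) (?L w) + ?g (?L y) (?H z w) = 0"
    using xi_normal[OF lc ken manifolds(3) imm xi] eta_dmap[OF lc ken manifolds(3) imm xi]
    by (simp add: phi(2) Xp gs y(2))
  then show ?thesis
    using cd_coord_mixed_tangential(2)[OF y(1) z w] gsym[of _ "?L y"] phi_skew[OF wfacts(7), of "\<iota>
        p" "?H z x" "?L w"]
    by simp
qed

lemma second_ff_norm2_bound:
  "second_ff_norm2 M N \<iota> g cd p \<ge> 2 * real DIM('ef) * ((1 / sin (\<theta> p))\<^sup>2 + (cot (\<theta> p))\<^sup>2) *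
      (let v = gradient M (induced_metric M N \<iota> g) (\<lambda>q. ln (f (fst q))) p
       in induced_metric M N \<iota> g p v v) + real DIM('eb) + real DIM('ef)"
proof -
  let ?G = "induced_metric M N \<iota> g p" and ?g = "g (\<iota> p)" and ?L = "dmap M N \<iota> p" and ?\<phi> = "\<phi> (\<iota> p)"
  let ?H = "cd_coord M N \<iota> cd p" and ?\<alpha> = "\<lambda>v. dir_deriv M p v (\<lambda>q. ln (f (fst q)))"
  let ?P = "orth_proj ?g (range ?L)"
  note acm = wfacts(7) and xin = xi_normal[OF lc ken manifolds(3) imm xi]
  note G = induced_metric_inner_form[OF lc ken manifolds(3) imm xi, of p]
  note g = wfacts(8)[of "\<iota> p"] and L = wfacts(9)[of p]
  note gs = inner_form_simps[OF g] and gsym = inner_form_sym[OF g]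
  define J where "J = (\<lambda>x. SOME y. y \<in> tan_base p \<and> ?L y = ?\<phi> (?L x))"
  have J: "J x \<in> tan_base p \<and> ?L (J x) = ?\<phi> (?L x)" if "x \<in> tan_base p" for x
    unfolding J_def using someI_ex[of "\<lambda>y. y \<in> tan_base p \<and> ?L y = ?\<phi> (?L x)"] phi_base[OF that] by
        blast
  have sub: "subspace (tan_base p :: ('eb \<times> 'ef) set)" "subspace (tan_fibre p :: ('eb \<times> 'ef) set)"
    unfolding tan_base_def tan_fibre_def by (intro subspace_Times subspace_UNIV subspace_single_0)+
  have dim: "dim (tan_base p :: ('eb \<times> 'ef) set) = DIM('eb)" "dim (tan_fibre p :: ('eb \<times> 'ef) set) =
      DIM('ef)"
    unfolding tan_base_def tan_fibre_def by (simp_all add: dim_Times)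
  have span: "span (tan_base p \<union> tan_fibre p) = (UNIV :: ('eb \<times> 'ef) set)"
  proof -
    have "u \<in> span (tan_base p \<union> tan_fibre p)" for u :: "'eb \<times> 'ef"
    proof -
      have "(fst u, 0) + (0, snd u) \<in> span (tan_base p \<union> tan_fibre p)"
        by (intro span_add span_base) (auto simp: tan_base_def tan_fibre_def)
      then show ?thesis by simp
    qed
    then show ?thesis by blast
  qed
  have \<phi>L: "?g (?\<phi> (?L u)) (?\<phi> (?L v)) = ?g (?L u) (?L v)" for u v
    by (simp add: acm_basics(8)[OF acm] eta_dmap[OF lc ken manifolds(3) imm xi])
  \<comment> \<open>\<open>F w\<close> is \<open>\<phi> w\<close> minus its tangential part
    \<open>u\<close>. Once \<open>u\<close> is known to lie in the fibre direction,
    \<open>cd_coord_mixed_phi\<close> handles the first term and the warped product formula the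
    second.\<close>
  have mixed: "?g (?H x z) (?\<phi> (?L w) - ?P (?\<phi> (?L w))) = - (?\<alpha> (J x) * ?G z w + ?\<alpha> x * ?g (?L z)
      (?\<phi> (?L w)))"
    if x: "x \<in> tan_base p" and z: "z \<in> tan_fibre p" and w: "w \<in> tan_fibre p" for x z w
  proof -
    note proj = orth_proj_properties[OF g linear_subspace_image[OF L subspace_UNIV]]
    obtain u where u: "?P (?\<phi> (?L w)) = ?L u" using proj(1) by blast
    have pu: "?g (?\<phi> (?L w)) (?L v) = ?g (?L u) (?L v)" for v
      using proj(2)[of "?L v" "?\<phi> (?L w)"] by (simp add: u gs)
    have "?G x' u = 0" if "x' \<in> tan_base p" for x'
    proof -
      have "?g (?\<phi> (?L w)) (?L x') = - ?g (?L w) (?L (J x'))"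
        using phi_skew[OF acm] J[OF that] by simp
      also have "\<dots> = 0"
        using base_fibre_orthogonal[OF conjunct1[OF J[OF that]] w] gsym by (simp add:
            induced_metric_def)
      finally show ?thesis using pu gsym by (simp add: induced_metric_def)
    qed
    \<comment> \<open>The base component of \<open>u\<close> is orthogonal to \<open>u\<close> and
      to the fibre component of \<open>u\<close>, hence to itself.\<close>
    then have "?G (fst u, 0) (fst u, 0) = 0"
      using base_fibre_orthogonal[of "(fst u, 0)" p "(0, snd u)"]
        inner_form_simps(2)[OF G, of "(fst u, 0)" "(fst u, 0)" "(0, snd u)"]
      by (auto simp: tan_base_def tan_fibre_def)
    then have "(fst u, 0) = (0 :: 'eb \<times> 'ef)" using inner_form_pos[OF G] by force
    then have uf: "u \<in> tan_fibre p" by (cases u) (auto simp: tan_fibre_def zero_prod_def)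
    have "?H x z = ?H z x" by (rule cd_coord_symmetric[OF manifolds(3) wfacts(1-4)])
    moreover have "?g (?H z x) (?L u) = ?\<alpha> x * ?g (?L z) (?\<phi> (?L w))"
      using cd_coord_mixed_tangential(1)[OF x z uf] pu[of z] gsym by (simp add: induced_metric_def)
    moreover have "?g (?H z x) (?\<phi> (?L w)) = - ?\<alpha> (J x) * ?G z w"
      using cd_coord_mixed_phi[OF x z w] J[OF x] by blast
    ultimately show ?thesis by (simp add: u gs)
  qed
  \<comment> \<open>Existence gives meaning to the \<open>SOME\<close> in
    \<open>second_ff_norm2\<close>; the bound holds for whichever basis it selects.\<close>
  obtain E0 where "orthonormal ?G E0" "span E0 = UNIV"
    using orthonormal_basis_of_subspace[OF G subspace_UNIV] by blast
  then have ex: "\<exists>E. orthonormal_basis ?G E" by (auto simp: orthonormal_basis_iff)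
  define E where "E = (SOME E. orthonormal_basis ?G E)"
  have E: "orthonormal_basis ?G E" unfolding E_def by (rule someI_ex[OF ex])
  have ineq: "(\<Sum>e\<in>E. \<Sum>e'\<in>E. ?g (?H e e' - ?P (?H e e')) (?H e e' - ?P (?H e e')))
    \<ge> 2 * real (dim (tan_fibre p :: ('eb \<times> 'ef) set)) * ((1 / sin (\<theta> p))\<^sup>2 + (cot (\<theta> p))\<^sup>2) * (\<Sum>e\<in>E.
        (?\<alpha> e)\<^sup>2)
      + real (dim (tan_base p :: ('eb \<times> 'ef) set)) + real (dim (tan_fibre p :: ('eb \<times> 'ef) set))"
  proof (rule pointwise_inequality[OF G g L _ acm_basics(1)[OF acm] _ \<phi>L _ xin(1) _ J sub _ span])
    show "?g (\<xi> (\<iota> p)) (\<xi> (\<iota> p)) = 1" by (simp add: metric_xi[OF acm] acm_basics(7)[OF acm])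
    show "?g (?\<phi> v) (\<xi> (\<iota> p)) = 0" for v by (simp add: metric_xi[OF acm] eta_phi[OF acm])
    show "?g (?H u v) (\<xi> (\<iota> p)) = - ?G u v" for u v
      by (rule cd_coord_metric_xi[OF lc ken manifolds(3) imm xi])
    show "bilinear ?H" by (rule cd_coord_bilinear[OF lc ken manifolds(3) imm xi])
    show "?H u v = ?H v u" for u v by (rule cd_coord_symmetric[OF manifolds(3) wfacts(1-4)])
    show "0 < \<theta> p" "\<theta> p < pi / 2" using proper unfolding proper_semi_slant_def by blast+
    show "angle_subspace ?g (?\<phi> (?L z)) (?L ` tan_fibre p) = \<theta> p" if "z \<in> tan_fibre p" "z \<noteq> 0" for z
      using ss that unfolding pointwise_semi_slant_def by blast
  qed (use phi_skew[OF acm] base_fibre_orthogonal dir_deriv_ln_warping_linear dir_deriv_ln_warping_fibre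
      mixed E in \<open>auto simp: induced_metric_def\<close>)
  have "second_ff_norm2 M N \<iota> g cd p = (\<Sum>e\<in>E. \<Sum>e'\<in>E. ?g (?H e e' - ?P (?H e e')) (?H e e' - ?P (?H e
      e')))"
    by (simp add: second_ff_norm2_def E_def[symmetric] Let_def second_ff_at_eq[OF lc ken
        manifolds(3) imm xi])
  moreover have "(\<Sum>e\<in>E. (?\<alpha> e)\<^sup>2) = (let v = gradient M (induced_metric M N \<iota> g) (\<lambda>q. ln (f (fst q))) p
       in induced_metric M N \<iota> g p v v)"
  proof -
    define v where "v = gradient M (induced_metric M N \<iota> g) (\<lambda>q. ln (f (fst q))) p"
    \<comment> \<open>Riesz representation justifies the definite description in
      \<open>gradient\<close>; Parseval then gives its squared length.\<close>
    have v: "\<forall>u. ?G v u = ?\<alpha> u"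
      unfolding v_def gradient_def by (rule theI'[OF riesz_representation[OF G
          dir_deriv_ln_warping_linear]])
    have "?G v v = (\<Sum>e\<in>E. ?G v e * ?G v e)"
      using parseval[OF G, of E v v] E by (simp add: orthonormal_basis_iff)
    then show ?thesis by (simp add: v power2_eq_square v_def[symmetric])
  qed
  ultimately show ?thesis using ineq by (simp add: dim)
qed

text \<open>The normal section is \<xi> along \<open>\<iota>\<close>, and \<open>Z\<close> is a
  cutoff coordinate field, since the criterion quantifies over global fields. Scaling by the cutoff
  keeps \<open>Z\<close> tangent to the fibres.\<close>

lemma fibre_second_ff_not_vanishing:
  "\<exists>Z V p. smooth_vf_on M UNIV Z \<and> (\<forall>p. Z p \<in> tan_fibre p) \<and>
     smooth_along M N \<iota> V \<and> (\<forall>p. V p \<in> normal_bundle M N \<iota> g p) \<and>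
     g (\<iota> p) (second_ff M N \<iota> g cd Z Z p) (V p) \<noteq> 0"
proof -
  fix p :: "'b \<times> 'f"
  let ?c = "chart_at M p"
  note c = chart_at_atlas[OF manifolds(3), of p]
  \<comment> \<open>A Euclidean space has a nonempty \<open>Basis\<close>, so there is a nonzero
    fibre direction.\<close>
  obtain i :: 'ef where i: "i \<in> Basis" using nonempty_Basis by blast
  define w where "w = (0 :: 'eb, i)"
  have w: "w \<noteq> 0" "w \<in> tan_fibre p" using nonzero_Basis[OF i] by (auto simp: w_def tan_fibre_def
      zero_prod_def)
  obtain \<psi> :: "'b \<times> 'f \<Rightarrow> real" and C where \<psi>: "smooth_fun_on M (fst ?c) \<psi>" "\<psi> p = 1"
    "closed C" "C \<subseteq> fst ?c" "\<And>q. q \<notin> C \<Longrightarrow> \<psi> q = 0"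
    using cutoff_function_exists[OF manifolds(3) c] by blast
  define Z where "Z = (\<lambda>q. \<psi> q *\<^sub>R coord_field M ?c w q)"
  have Z: "smooth_vf_on M UNIV Z"
    unfolding Z_def by (rule cutoff_coord_field_smooth[OF manifolds(3) c(1) \<psi>(1,3,4,5)])
  have Zf: "Z q \<in> tan_fibre q" for q
  proof (cases "q \<in> fst ?c")
    case True
    then show ?thesis using coord_field_tangent(2)[OF True w(2)] by (auto simp: Z_def tan_fibre_def)
  next
    case False
    then have "\<psi> q = 0" using \<psi>(4,5) by blast
    then show ?thesis by (simp add: Z_def tan_fibre_def zero_prod_def)
  qed
  have "smooth_along M N \<iota> (\<lambda>q. \<xi> (\<iota> q))"
    unfolding smooth_along_def
    using smooth_fun_on_comp_map[OF manifolds(3) wfacts(1,2)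
        smooth_vf_on_to_chart[OF wfacts(1) smooth_vf_on_xi[OF wfacts(7)]]] by simp
  moreover have "g (\<iota> p) (second_ff M N \<iota> g cd Z Z p) (\<xi> (\<iota> p)) \<noteq> 0"
    using second_ff_metric_xi[OF lc ken manifolds(3) imm xi Z UNIV_I, of p Z]
      inner_form_pos[OF induced_metric_inner_form[OF lc ken manifolds(3) imm xi] w(1), of p]
    by (simp add: Z_def \<psi>(2) coord_field_chart_at[OF manifolds(3)])
  ultimately show ?thesis
    using Z Zf xi by (intro exI[of _ Z] exI[of _ "\<lambda>q. \<xi> (\<iota> q)"] exI[of _ p]) auto
qed

end

theorem theorem10p4:
  fixes N :: "('n::{t2_space,second_countable_topology}, 'en::euclidean_space) mfd"
    and B :: "('b::{t2_space,second_countable_topology}, 'eb::euclidean_space) mfd"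
    and F :: "('f::{t2_space,second_countable_topology}, 'ef::euclidean_space) mfd"
    and M :: "('b \<times> 'f, 'eb \<times> 'ef) mfd"
    and \<phi> :: "'n \<Rightarrow> 'en \<Rightarrow> 'en" and \<xi> :: "'n \<Rightarrow> 'en" and \<eta> :: "'n \<Rightarrow> 'en \<Rightarrow> real"
    and g :: "'n \<Rightarrow> 'en \<Rightarrow> 'en \<Rightarrow> real" and cd :: "('n, 'en) connection"
    and gB :: "'b \<Rightarrow> 'eb \<Rightarrow> 'eb \<Rightarrow> real" and gF :: "'f \<Rightarrow> 'ef \<Rightarrow> 'ef \<Rightarrow> real"
    and f :: "'b \<Rightarrow> real" and \<iota> :: "'b \<times> 'f \<Rightarrow> 'n" and \<theta> :: "'b \<times> 'f \<Rightarrow> real"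
    and D1 D2 :: "'b \<times> 'f \<Rightarrow> ('eb \<times> 'ef) set"
    and n m1 m2 :: nat
  assumes N: "levi_civita N g cd" "kenmotsu N \<phi> \<xi> \<eta> g cd" "DIM('en) = 2 * n + 1"
    and warped: "riemannian_manifold B gB" "riemannian_manifold F gF"
      "smooth_fun_on B UNIV f" "\<forall>b. f b > 0"
      "M = prod_mfd B F" "induced_metric M N \<iota> g = warped_metric gB gF f"
    and nontrivial: "\<not> (\<exists>k. \<forall>b. f b = k)"
    and semi_slant: "pointwise_semi_slant M N \<iota> \<phi> g D1 D2 \<theta>" "proper_semi_slant \<theta>"
    and D: "D1 = tan_base" "D2 = tan_fibre"
    and xi: "\<forall>p. \<xi> (\<iota> p) \<in> mu_bundle M N \<iota> \<phi> g D2 p"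
    and dims: "DIM('eb) = 2 * m1" "DIM('ef) = 2 * m2" "n = m1 + 2 * m2"
  defines "R \<equiv> \<lambda>p. 4 * real m2 * ((1 / sin (\<theta> p))\<^sup>2 + (cot (\<theta> p))\<^sup>2) *
      (let v = gradient M (induced_metric M N \<iota> g) (\<lambda>q. ln (f (fst q))) p
       in induced_metric M N \<iota> g p v v) + 2 * real m1"
  shows "(\<forall>p. second_ff_norm2 M N \<iota> g cd p \<ge> R p) \<and>
    ((\<forall>p. second_ff_norm2 M N \<iota> g cd p = R p) \<longleftrightarrow>
     (\<forall>Z W V. smooth_vf_on M UNIV Z \<and> (\<forall>p. Z p \<in> tan_fibre p) \<and>
              smooth_vf_on M UNIV W \<and> (\<forall>p. W p \<in> tan_fibre p) \<and>
              smooth_along M N \<iota> V \<and> (\<forall>p. V p \<in> normal_bundle M N \<iota> g p) \<longrightarrow>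
        (\<forall>p. g (\<iota> p) (second_ff M N \<iota> g cd Z W p) (V p) = 0)))"
proof -
  have xin: "\<And>p. \<xi> (\<iota> p) \<in> normal_bundle M N \<iota> g p" using xi unfolding mu_bundle_def by blast
  have f: "\<And>b. f b > 0" using warped(4) by blast
  note hyps = N(1,2) warped(1,2,3) f warped(5,6) semi_slant(1)[unfolded D] semi_slant(2) xin
  \<comment> \<open>Euclidean spaces have positive dimension, so the surplus
    \<open>2 * real m2\<close> of the bound over \<open>R p\<close> is strictly positive.\<close>
  have "m2 > 0" using dims(2) DIM_positive[where 'a = 'ef] by linarith
  then have gt: "second_ff_norm2 M N \<iota> g cd p > R p" for p
    using second_ff_norm2_bound[OF hyps, of p] dims(1,2) by (simp add: R_def)
  obtain Z V p where "smooth_vf_on M UNIV Z" "\<forall>p. Z p \<in> tan_fibre p" "smooth_along M N \<iota> V"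
    "\<forall>p. V p \<in> normal_bundle M N \<iota> g p" "g (\<iota> p) (second_ff M N \<iota> g cd Z Z p) (V p) \<noteq> 0"
    using fibre_second_ff_not_vanishing[OF hyps] by blast
  then have "\<not> (\<forall>Z W V. smooth_vf_on M UNIV Z \<and> (\<forall>p. Z p \<in> tan_fibre p) \<and>
              smooth_vf_on M UNIV W \<and> (\<forall>p. W p \<in> tan_fibre p) \<and>
              smooth_along M N \<iota> V \<and> (\<forall>p. V p \<in> normal_bundle M N \<iota> g p) \<longrightarrow>
        (\<forall>p. g (\<iota> p) (second_ff M N \<iota> g cd Z W p) (V p) = 0))"
    by blast
  \<comment> \<open>Types are inhabited, so strictness at every point refutes equality at every
    point.\<close>
  moreover have "\<not> (\<forall>p. second_ff_norm2 M N \<iota> g cd p = R p)"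
    using gt by (metis less_irrefl)
  ultimately show ?thesis using less_imp_le[OF gt] by blast
qed

end
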